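(* Let $d=3$. For each $\hbar\in(0,1]$ let $\Psi=\Psi^\hbar(t,\xi)\in C^2((0,\infty)\times\mathbb{R}^3)$ be real-valued, and assume that $$\|\nabla_\xi^2\Psi(t,\xi)\|_{L^\infty_\xi}\le\frac12\Big|\frac t\hbar\Big|,\qquad\|\nabla^2_\xi\Psi(t,\xi)\|_{L^{3,1}_\xi}\lesssim\sqrt{\frac t\hbar}$$ for all $t\in(0,\infty)$ and $\hbar\in(0,1]$. Then $$\Big\|\mathcal{U}^\hbar(t)e^{-i\Psi(t,-i\hbar\nabla)}\Big\|_{L^1_x\to L^\infty_x}\lesssim\frac{1}{|t\hbar|^{3/2}}$$ for any $t\in(0,\infty)$ and $\hbar\in(0,1]$, where the implicit constant is independent of $\hbar$ and $t$.
   Context: $\mathcal{U}^\hbar(t)=e^{it\hbar\Delta/2}$ is the Fourier multiplier with symbol $e^{-it\hbar|\xi|^2/2}$ on $\mathbb{R}^3$; $e^{-i\Psi(t,-i\hbar\nabla)}$ is the Fourier multiplier with symbol $e^{-i\Psi(t,\hbar\xi)}$. $L^{p,q}$ denotes the Lorentz space. $\nabla^2_\xi\Psi$ is the Hessian matrix in $\xi$ (matrices measured in the operator norm). $A\lesssim B$ means $A\le CB$ with $C>0$ independent of $\hbar$ (and of $t$). *)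

theory Defs
  imports "HOL-Analysis.Analysis" "HOL-Probability.Essential_Supremum"
begin

section \<open>Lebesgue and Lorentz norms on Euclidean space\<close>

definition ennpowr :: "ennreal \<Rightarrow> real \<Rightarrow> ennreal"
  where "ennpowr x a = (if x = \<infinity> then \<infinity> else ennreal (enn2real x powr a))"
  \<comment> \<open>only used with \<open>a > 0\<close>\<close>

definition Lp_norm :: "real \<Rightarrow> ('a::euclidean_space \<Rightarrow> 'b::real_normed_vector) \<Rightarrow> ennreal"
  where "Lp_norm p f = ennpowr (\<integral>\<^sup>+x. ennreal (norm (f x) powr p) \<partial>lborel) (1 / p)"

definition Linf_norm :: "('a::euclidean_space \<Rightarrow> 'b::real_normed_vector) \<Rightarrow> ennreal"
  where "Linf_norm f = esssup lborel (\<lambda>x. ennreal (norm (f x)))"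

definition Lp_space :: "real \<Rightarrow> ('a::euclidean_space \<Rightarrow> complex) set"
  where "Lp_space p = {f \<in> borel_measurable lborel. Lp_norm p f < \<infinity>}"

definition rearrangement :: "('a::euclidean_space \<Rightarrow> 'b::real_normed_vector) \<Rightarrow> real \<Rightarrow> ennreal"
  where "rearrangement f s =
    Inf {ennreal r | r. 0 \<le> r \<and> emeasure lborel {x. norm (f x) > r} \<le> ennreal s}"

text \<open>The norm of $L^{p,q}$ for $0 < p, q < \infty$,
  $\bigl(\int_0^\infty (s^{1/p} f^*(s))^q\, ds/s\bigr)^{1/q}$.\<close>

definition Lorentz_norm ::
    "real \<Rightarrow> real \<Rightarrow> ('a::euclidean_space \<Rightarrow> 'b::real_normed_vector) \<Rightarrow> ennreal"
  where "Lorentz_norm p q f =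
    ennpowr (\<integral>\<^sup>+s\<in>{0<..}. ennpowr (ennreal (s powr (1 / p)) * rearrangement f s) q
                              * ennreal (1 / s) \<partial>lborel) (1 / q)"


section \<open>Fourier multipliers\<close>

definition L2_lim :: "(real \<Rightarrow> 'a::euclidean_space \<Rightarrow> complex) \<Rightarrow> 'a \<Rightarrow> complex"
  where "L2_lim F = (SOME g. g \<in> Lp_space 2 \<and> ((\<lambda>R. Lp_norm 2 (\<lambda>x. F R x - g x)) \<longlongrightarrow> 0) at_top)"

text \<open>The unitary Fourier transform on $L^2$ and its inverse, as limits in the mean of the
  truncated Fourier integrals. The values are representatives of their almost-everywhere classes.\<close>

definition fourier :: "('a::euclidean_space \<Rightarrow> complex) \<Rightarrow> 'a \<Rightarrow> complex"
  where "fourier f = L2_lim (\<lambda>R \<xi>. of_real ((2 * pi) powr (- real DIM('a) / 2)) *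
           (LINT x : cball 0 R | lborel. cis (- (x \<bullet> \<xi>)) * f x))"

definition inv_fourier :: "('a::euclidean_space \<Rightarrow> complex) \<Rightarrow> 'a \<Rightarrow> complex"
  where "inv_fourier f = L2_lim (\<lambda>R x. of_real ((2 * pi) powr (- real DIM('a) / 2)) *
           (LINT \<xi> : cball 0 R | lborel. cis (x \<bullet> \<xi>) * f \<xi>))"

definition fourier_multiplier ::
    "('a::euclidean_space \<Rightarrow> complex) \<Rightarrow> ('a \<Rightarrow> complex) \<Rightarrow> 'a \<Rightarrow> complex"
  where "fourier_multiplier m f = inv_fourier (\<lambda>\<xi>. m \<xi> * fourier f \<xi>)"

definition free_propagator ::
    "real \<Rightarrow> real \<Rightarrow> ('a::euclidean_space \<Rightarrow> complex) \<Rightarrow> 'a \<Rightarrow> complex"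
  where "free_propagator h t =
    fourier_multiplier (\<lambda>\<xi>. exp (- \<i> * of_real (t * h * (norm \<xi>)\<^sup>2 / 2)))"

definition phase_multiplier ::
    "real \<Rightarrow> ('a::euclidean_space \<Rightarrow> real) \<Rightarrow> ('a \<Rightarrow> complex) \<Rightarrow> 'a \<Rightarrow> complex"
  where "phase_multiplier h \<psi> =
    fourier_multiplier (\<lambda>\<xi>. exp (- \<i> * of_real (\<psi> (h *\<^sub>R \<xi>))))"

text \<open>The $L^1 \to L^\infty$ norm of an operator defined on $L^2$, taken over the dense subspace
  $L^1 \cap L^2$ of $L^1$; it is infinite if there is no bounded extension.\<close>

definition L1_Linf_norm ::
    "(('a::euclidean_space \<Rightarrow> complex) \<Rightarrow> 'a \<Rightarrow> complex) \<Rightarrow> ennreal"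
  where "L1_Linf_norm T =
    (SUP f \<in> {f \<in> Lp_space 1 \<inter> Lp_space 2. Lp_norm 1 f \<le> 1}. Linf_norm (T f))"


section \<open>Second derivatives\<close>

text \<open>Twice continuous differentiability on an open set.\<close>

definition C2_on :: "'a::real_normed_vector set \<Rightarrow> ('a \<Rightarrow> real) \<Rightarrow> bool"
  where "C2_on S f \<longleftrightarrow>
    (\<exists>(f' :: 'a \<Rightarrow> 'a \<Rightarrow>\<^sub>L real) (f'' :: 'a \<Rightarrow> 'a \<Rightarrow>\<^sub>L 'a \<Rightarrow>\<^sub>L real).
       (\<forall>x\<in>S. (f has_derivative blinfun_apply (f' x)) (at x)) \<and>
       (\<forall>x\<in>S. (f' has_derivative blinfun_apply (f'' x)) (at x)) \<and>
       continuous_on S f'')"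

definition partial_deriv :: "'n::finite \<Rightarrow> (real ^ 'n \<Rightarrow> real) \<Rightarrow> real ^ 'n \<Rightarrow> real"
  where "partial_deriv i g x = deriv (\<lambda>s. g (x + s *\<^sub>R axis i 1)) 0"

definition hessian :: "(real ^ 'n \<Rightarrow> real) \<Rightarrow> real ^ 'n \<Rightarrow> real ^ 'n ^ 'n::finite"
  where "hessian g x = (\<chi> i j. partial_deriv i (partial_deriv j g) x)"

definition matrix_norm :: "real ^ 'n ^ 'm::finite \<Rightarrow> real"
  where "matrix_norm A = onorm ((*v) A)"

end

theory Submission
  imports Defs "HOL-Probability.Probability"
begin

text \<open>
  The composed operator is the Fourier multiplier with symbol
  $\exp(-i t \hbar |\xi|^2 / 2 - i \Psi(t, \hbar\xi))$, so its $L^1 \to L^\infty$ norm is bounded by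
  the supremum of its kernel. A Gaussian factor $e^{-\epsilon|\xi|^2}$ makes the kernel absolutely
  convergent, and the bounds pass to the limit $\epsilon \to 0$ in $L^2$. This only needs the
  $L^2$ theory of the Fourier integral with a non-sharp constant: Bessel's inequality, the
  multiplication formula, and inversion, which follows by testing against translated Gaussians.

  Rescaling by $\sqrt{t\hbar}$ turns the phase into $|\eta|^2/2 + \Phi(\eta) - \eta \cdot z$ with
  $|\nabla^2 \Phi| \le 1/2$ and $\|\nabla^2 \Phi\|_{L^{3,1}} \lesssim 1$. Its gradient $p$ satisfies
  $|p(\eta)| \ge |\eta - \eta_0|/2$ for a single critical point $\eta_0$. One integration by parts
  along $p/(1 + |p|^2)$ gains $1/(1+|p|^2)$, which is not integrable in dimension 3; the part of the
  result that contains $\nabla^2 \Phi$ is integrable since $|\eta - \eta_0|^{-2}$ lies in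
  $L^{3/2,\infty}$, the dual of $L^{3,1}$, and the remaining part depends on $p$ only, so
  it can be integrated by parts once more although the phase is merely $C^2$.
\<close>

section \<open>Gaussian integrals\<close>

text \<open>Both Hessian bounds are scale invariant: with \<open>l = h / sqrt (t * h)\<close> the
  rescaled Hessian is \<open>l^2\<close> times the old one at \<open>l x\<close>, and
  \<open>l^2 = h / t\<close> cancels exactly the growth that the hypotheses allow; the Jacobian of
  the rescaling supplies the decay in \<open>t * h\<close>. The linear term \<open>z\<close> only
  moves the critical point, so uniformity in \<open>z\<close> becomes uniformity over all centres of
  the weight. The regularizing Gaussian is itself an obstacle: each integration by parts
  differentiates it and creates factors such as \<epsilon> |x| |p| that grow at infinity. They are
  paid for with half of the Gaussian exponent and one factor \<open>1 / (1 + |p|^2)\<close>; what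
  cannot be absorbed is a term \<epsilon>^2 exp (- \<epsilon> |x|^2), whose integral in dimension 3
  is of order sqrt \<epsilon>. The operators are built from chosen representatives of limits in the
  mean, so identities between them hold only almost everywhere. Pointwise kernel estimates enter
  solely for functions whose Fourier integral converges absolutely.\<close>

lemma measurable_cnj [measurable]: "cnj \<in> borel_measurable borel"
  by (intro borel_measurable_continuous_onI continuous_intros)

lemma measurable_cis [measurable]: "cis \<in> borel_measurable borel"
  by (intro borel_measurable_continuous_onI continuous_intros)

lemma nn_integral_lborel_affine:
  fixes f :: "'a::euclidean_space \<Rightarrow> ennreal" and c :: real
  assumes "c \<noteq> 0" and [measurable]: "f \<in> borel_measurable borel"
  shows "(\<integral>\<^sup>+x. f x \<partial>lborel) = \<bar>c\<bar> ^ DIM('a) * (\<integral>\<^sup>+x. f (t + c *\<^sub>R x) \<partial>lborel)"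
  by (subst lborel_affine[OF assms(1), of t]) (simp add: nn_integral_density nn_integral_distr nn_integral_cmult)

lemma integrable_lborel_affine:
  fixes f :: "'a::euclidean_space \<Rightarrow> 'b::{banach, second_countable_topology}" and c :: real
  assumes "c \<noteq> 0" and [measurable]: "f \<in> borel_measurable borel"
  shows "integrable lborel (\<lambda>x. f (t + c *\<^sub>R x)) \<longleftrightarrow> integrable lborel f"
proof -
  have "integrable lborel f \<longleftrightarrow> integrable lborel (\<lambda>x. \<bar>c\<bar> ^ DIM('a) *\<^sub>R f (t + c *\<^sub>R x))"
    by (subst lborel_affine[OF assms(1), of t]) (simp add: integrable_density integrable_distr_eq)
  also have "\<dots> \<longleftrightarrow> integrable lborel (\<lambda>x. f (t + c *\<^sub>R x))"
    using assms(1) integrable_scaleR_right[of "1 / \<bar>c\<bar> ^ DIM('a)" lborel "\<lambda>x. \<bar>c\<bar> ^ DIM('a) *\<^sub>R f (t + c *\<^sub>R x)"]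
    by auto
  finally show ?thesis ..
qed

lemma integral_lborel_affine:
  fixes f :: "'a::euclidean_space \<Rightarrow> 'b::{banach, second_countable_topology}" and c :: real
  assumes "c \<noteq> 0" and [measurable]: "f \<in> borel_measurable borel"
  shows "(LBINT x. f x) = \<bar>c\<bar> ^ DIM('a) *\<^sub>R (LBINT x. f (t + c *\<^sub>R x))"
  by (subst lborel_affine[OF assms(1), of t]) (simp add: integral_density integral_distr)

text \<open>This is the characteristic function of the standard normal law with the factor
  \<open>1 / sqrt (2 * pi)\<close> of its density cleared.\<close>

lemma integral_cis_gaussian_real:
  "(LBINT x. cis (t * x) * of_real (exp (- x\<^sup>2 / 2))) = of_real (sqrt (2 * pi) * exp (- t\<^sup>2 / 2))"
proof -
  have "of_real (exp (- t\<^sup>2 / 2)) = char std_normal_distribution t"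
    by (simp add: char_std_normal_distribution)
  also have "\<dots> = (LBINT x. std_normal_density x *\<^sub>R iexp (t * x))"
    unfolding char_def by (subst integral_density) auto
  also have "\<dots> = (LBINT x. of_real (1 / sqrt (2 * pi)) * (cis (t * x) * of_real (exp (- x\<^sup>2 / 2))))"
    by (intro Bochner_Integration.integral_cong)
       (auto simp: std_normal_density_def cis_conv_exp scaleR_conv_of_real)
  also have "\<dots> = of_real (1 / sqrt (2 * pi)) * (LBINT x. (cis (t * x) * of_real (exp (- x\<^sup>2 / 2))))"
    by (rule integral_mult_right_zero)
  finally show ?thesis by (simp add: field_simps)
qed

text \<open>Character and Gaussian both factor over the coordinates, and \<open>lborel\<close> is
  the image of a product of one-dimensional measures, so the integral is a product of real
  ones.\<close>

lemma integral_cis_gaussian_unit: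
  fixes \<xi> :: "'a::euclidean_space"
  shows "(LBINT x. cis (x \<bullet> \<xi>) * of_real (exp (- (norm x)\<^sup>2 / 2)))
    = of_real (sqrt (2 * pi) ^ DIM('a) * exp (- (norm \<xi>)\<^sup>2 / 2))"
proof -
  interpret product_sigma_finite "\<lambda>_::'a. lborel :: real measure" ..
  let ?g = "\<lambda>t x. cis (t * x) * complex_of_real (exp (- x\<^sup>2 / 2))"
  \<comment> \<open>A function that is not integrable has Bochner integral 0. The formula gives a
    nonzero value, which proves integrability without an estimate.\<close>
  have int: "integrable lborel (?g t)" for t
    using not_integrable_integral_eq[of lborel "?g t"] integral_cis_gaussian_real[of t] by fastforce
  have sq: "(norm y)\<^sup>2 = (\<Sum>b\<in>Basis. (y \<bullet> b)\<^sup>2)" for y :: 'a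
    unfolding power2_norm_eq_inner by (subst euclidean_inner) (simp add: power2_eq_square)
  have cis_sum: "cis (sum h S) = (\<Prod>b\<in>S. cis (h b))" if "finite S" for h :: "'a \<Rightarrow> real" and S
    using that by (induction S) (auto simp flip: cis_mult)
  have "(LBINT x. cis (x \<bullet> \<xi>) * of_real (exp (- (norm x)\<^sup>2 / 2)))
    = (\<integral>f. cis ((\<Sum>b\<in>Basis. f b *\<^sub>R b) \<bullet> \<xi>) *
         of_real (exp (- (norm (\<Sum>b\<in>Basis. f b *\<^sub>R b :: 'a))\<^sup>2 / 2)) \<partial>(\<Pi>\<^sub>M b\<in>(Basis::'a set). lborel))"
    by (subst lborel_eq, subst integral_distr) auto
  also have "\<dots> = (\<integral>f. (\<Prod>b\<in>Basis. ?g (\<xi> \<bullet> b) (f b)) \<partial>(\<Pi>\<^sub>M b\<in>(Basis::'a set). lborel))"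
  proof (rule Bochner_Integration.integral_cong[OF refl])
    fix f :: "'a \<Rightarrow> real"
    have "cis ((\<Sum>b\<in>Basis. f b *\<^sub>R b) \<bullet> \<xi>) = (\<Prod>b\<in>Basis. cis (\<xi> \<bullet> b * f b))"
      by (subst cis_sum[symmetric]) (auto simp: inner_sum_right inner_commute[of _ \<xi>] mult.commute)
    moreover have "exp (- (norm (\<Sum>b\<in>Basis. f b *\<^sub>R b :: 'a))\<^sup>2 / 2) = (\<Prod>b\<in>(Basis::'a set). exp (- (f b)\<^sup>2 / 2))"
      by (subst exp_sum[symmetric]) (auto simp: sq sum_negf sum_divide_distrib)
    ultimately show "cis ((\<Sum>b\<in>Basis. f b *\<^sub>R b) \<bullet> \<xi>) *
         of_real (exp (- (norm (\<Sum>b\<in>Basis. f b *\<^sub>R b :: 'a))\<^sup>2 / 2)) = (\<Prod>b\<in>Basis. ?g (\<xi> \<bullet> b) (f b))"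
      by (simp add: prod.distrib)
  qed
  also have "\<dots> = (\<Prod>b\<in>(Basis::'a set). (LBINT x. ?g (\<xi> \<bullet> b) x))"
    by (intro product_integral_prod finite_Basis int)
  also have "\<dots> = of_real (\<Prod>b\<in>(Basis::'a set). sqrt (2 * pi) * exp (- (\<xi> \<bullet> b)\<^sup>2 / 2))"
    unfolding integral_cis_gaussian_real by simp
  also have "(\<Prod>b\<in>(Basis::'a set). sqrt (2 * pi) * exp (- (\<xi> \<bullet> b)\<^sup>2 / 2)) = sqrt (2 * pi) ^ DIM('a) * exp (- (norm \<xi>)\<^sup>2 / 2)"
    by (simp add: prod.distrib sq exp_sum[symmetric] sum_negf sum_divide_distrib)
  finally show ?thesis .
qed

lemma integral_cis_gaussian:
  fixes \<xi> :: "'a::euclidean_space"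
  assumes "\<sigma> > 0"
  shows "(LBINT x. cis (x \<bullet> \<xi>) * of_real (exp (- \<sigma> * (norm x)\<^sup>2 / 2)))
    = of_real (sqrt (2 * pi / \<sigma>) ^ DIM('a) * exp (- (norm \<xi>)\<^sup>2 / (2 * \<sigma>)))"
proof -
  let ?c = "1 / sqrt \<sigma>"
  have "(LBINT x. cis (x \<bullet> \<xi>) * of_real (exp (- \<sigma> * (norm x)\<^sup>2 / 2)))
    = \<bar>?c\<bar> ^ DIM('a) *\<^sub>R (LBINT x. cis ((0 + ?c *\<^sub>R x) \<bullet> \<xi>) * of_real (exp (- \<sigma> * (norm (0 + ?c *\<^sub>R x))\<^sup>2 / 2)))"
    using assms by (intro integral_lborel_affine) (auto intro!: borel_measurable_continuous_onI continuous_intros)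
  also have "(\<lambda>x. cis ((0 + ?c *\<^sub>R x) \<bullet> \<xi>) * of_real (exp (- \<sigma> * (norm (0 + ?c *\<^sub>R x))\<^sup>2 / 2)))
     = (\<lambda>x::'a. cis (x \<bullet> (?c *\<^sub>R \<xi>)) * complex_of_real (exp (- (norm x)\<^sup>2 / 2)))"
    using assms by (auto simp: fun_eq_iff power_mult_distrib power_divide)
  also have "(LBINT x. cis (x \<bullet> (?c *\<^sub>R \<xi>)) * complex_of_real (exp (- (norm x)\<^sup>2 / 2)))
     = of_real (sqrt (2 * pi) ^ DIM('a) * exp (- (norm (?c *\<^sub>R \<xi>))\<^sup>2 / 2))"
    by (rule integral_cis_gaussian_unit)
  also have "\<bar>?c\<bar> ^ DIM('a) *\<^sub>R complex_of_real (sqrt (2 * pi) ^ DIM('a) * exp (- (norm (?c *\<^sub>R \<xi>))\<^sup>2 / 2))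
    = of_real ((?c * sqrt (2 * pi)) ^ DIM('a) * exp (- (norm \<xi>)\<^sup>2 / (2 * \<sigma>)))"
    using assms by (simp add: scaleR_conv_of_real power_mult_distrib power_divide mult.commute)
  also have "?c * sqrt (2 * pi) = sqrt (2 * pi / \<sigma>)" by (simp add: real_sqrt_divide)
  finally show ?thesis .
qed

lemma integral_gaussian:
  assumes "\<sigma> > 0"
  shows "(LBINT x. exp (- \<sigma> * (norm (x :: 'a::euclidean_space))\<^sup>2 / 2)) = sqrt (2 * pi / \<sigma>) ^ DIM('a)"
proof -
  have "complex_of_real (LBINT x. exp (- \<sigma> * (norm (x :: 'a))\<^sup>2 / 2)) = of_real (sqrt (2 * pi / \<sigma>) ^ DIM('a))"
    using integral_cis_gaussian[OF assms, of "0::'a"] by (simp del: of_real_power)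
  then show ?thesis by (simp only: of_real_eq_iff)
qed

text \<open>Again integrability is read off from a nonzero value of the integral.\<close>

lemma integrable_gaussian [simp]:
  assumes "\<sigma> > 0"
  shows "integrable lborel (\<lambda>x::'a::euclidean_space. exp (- (\<sigma> * (norm x)\<^sup>2 / 2)))"
  using not_integrable_integral_eq[of lborel "\<lambda>x::'a. exp (- \<sigma> * (norm x)\<^sup>2 / 2)"] integral_gaussian[OF assms, where 'a='a] assms
  by fastforce

section \<open>The Fourier transform on $L^2$\<close>

text \<open>The square of the norm is kept as a plain nonnegative integral, free of
  \<open>ennpowr\<close>. Its triangle inequality then costs a factor 2, which is where the
  non-sharp constants of the theory come from.\<close>

definition L2_sq :: "('a::euclidean_space \<Rightarrow> complex) \<Rightarrow> ennreal"
  where "L2_sq f = (\<integral>\<^sup>+x. ennreal ((norm (f x))\<^sup>2) \<partial>lborel)"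

definition ft_const :: "'a::euclidean_space itself \<Rightarrow> real"
  where "ft_const _ = (2 * pi) powr (- real DIM('a) / 2)"

text \<open>The sign \<open>s\<close> lets one theory serve both transforms: \<open>s = - 1\<close>
  is the forward one and \<open>s = 1\<close> the inverse. For functions that are not integrable the
  value is 0 by default.\<close>

definition ft :: "real \<Rightarrow> ('a::euclidean_space \<Rightarrow> complex) \<Rightarrow> 'a \<Rightarrow> complex"
  where "ft s f \<xi> = of_real (ft_const TYPE('a)) * (LBINT x. cis (s * (x \<bullet> \<xi>)) * f x)"

lemma ft_const_pos: "ft_const TYPE('a::euclidean_space) > 0" by (simp add: ft_const_def)

lemma ft_const_eq: "ft_const TYPE('a::euclidean_space) = 1 / sqrt (2 * pi) ^ DIM('a)"
proof -
  have "sqrt (2 * pi) ^ DIM('a) = (2 * pi) powr (real DIM('a) / 2)"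
    by (simp add: powr_half_sqrt[symmetric] powr_powr flip: powr_realpow)
  then show ?thesis by (simp add: ft_const_def powr_minus field_simps)
qed

lemma integrable_cis_mult:
  fixes f :: "'a \<Rightarrow> complex"
  assumes f: "integrable M f" and [measurable]: "g \<in> borel_measurable M"
  shows "integrable M (\<lambda>x. cis (g x) * f x)"
proof (rule Bochner_Integration.integrable_bound[OF f])
  have [measurable]: "cis \<in> borel_measurable borel"
    by (intro borel_measurable_continuous_onI continuous_intros)
  show "(\<lambda>x. cis (g x) * f x) \<in> borel_measurable M" using f by simp
qed (auto simp: norm_mult)

lemma measurable_ft [measurable]:
  fixes f :: "'a::euclidean_space \<Rightarrow> complex"
  assumes [measurable]: "f \<in> borel_measurable borel"
  shows "ft s f \<in> borel_measurable borel" unfolding ft_def by measurable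

lemma norm_ft_le:
  fixes f :: "'a::euclidean_space \<Rightarrow> complex"
  shows "norm (ft s f \<xi>) \<le> ft_const TYPE('a) * (LBINT x. norm (f x))"
proof -
  have "norm (LBINT x. cis (s * (x \<bullet> \<xi>)) * f x) \<le> (LBINT x. norm (f x))"
    by (rule order_trans[OF integral_norm_bound]) (simp add: norm_mult)
  then show ?thesis using ft_const_pos[where 'a='a] by (simp add: ft_def norm_mult)
qed

text \<open>Fubini's theorem, since the kernel is symmetric in its two variables.\<close>

lemma ft_multiplication:
  fixes f g :: "'a::euclidean_space \<Rightarrow> complex"
  assumes f: "integrable lborel f" and g: "integrable lborel g"
  shows "(LBINT \<xi>. ft s f \<xi> * g \<xi>) = (LBINT x. f x * ft s g x)"
proof -
  have [measurable]: "f \<in> borel_measurable borel" "g \<in> borel_measurable borel" using f g by auto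
  let ?h = "\<lambda>(x, \<xi>). cis (s * (x \<bullet> \<xi>)) * f x * g \<xi>"
  have "integrable (lborel \<Otimes>\<^sub>M lborel) ?h"
  proof (rule lborel_pair.Fubini_integrable)
    have "integrable lborel (\<lambda>x. norm (f x) * (LBINT \<xi>. norm (g \<xi>)))"
      using f by (intro integrable_mult_left) auto
    then show "integrable lborel (\<lambda>x. \<integral>y. norm (?h (x, y)) \<partial>lborel)"
      by (simp add: norm_mult)
    show "AE x in lborel. integrable lborel (\<lambda>y. ?h (x, y))"
    proof (rule AE_I2)
      fix x :: 'a
      have "integrable lborel (\<lambda>y. f x * (cis (s * (x \<bullet> y)) * g y))"
        by (intro integrable_mult_right integrable_cis_mult g) measurable
      then show "integrable lborel (\<lambda>y. ?h (x, y))" by (simp add: mult_ac)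
    qed
  qed measurable
  then have "(LBINT \<xi>. \<integral>x. cis (s * (x \<bullet> \<xi>)) * f x * g \<xi> \<partial>lborel)
     = (LBINT x. \<integral>\<xi>. cis (s * (x \<bullet> \<xi>)) * f x * g \<xi> \<partial>lborel)"
    by (rule lborel_pair.Fubini_integral)
  also have "\<dots> = (LBINT x. f x * (LBINT \<xi>. cis (s * (x \<bullet> \<xi>)) * g \<xi>))"
    by (simp only: mult.assoc mult.left_commute[of _ "f _"] integral_mult_right_zero)
  finally have "(LBINT \<xi>. (LBINT x. cis (s * (x \<bullet> \<xi>)) * f x) * g \<xi>)
     = (LBINT x. f x * (LBINT \<xi>. cis (s * (x \<bullet> \<xi>)) * g \<xi>))" by simp
  then show ?thesis unfolding ft_def
    by (simp only: mult.assoc mult.left_commute[of _ "of_real _"] integral_mult_right_zero inner_commute)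
qed

lemma ft_gaussian:
  fixes a \<xi> :: "'a::euclidean_space"
  assumes "\<sigma> > 0"
  shows "ft s (\<lambda>x. cis (x \<bullet> a) * of_real (exp (- (\<sigma> * (norm x)\<^sup>2 / 2)))) \<xi>
    = of_real ((1 / sqrt \<sigma>) ^ DIM('a) * exp (- (norm (a + s *\<^sub>R \<xi>))\<^sup>2 / (2 * \<sigma>)))"
proof -
  have "ft s (\<lambda>x. cis (x \<bullet> a) * of_real (exp (- (\<sigma> * (norm x)\<^sup>2 / 2)))) \<xi>
     = of_real (ft_const TYPE('a)) * (LBINT x. cis (x \<bullet> (a + s *\<^sub>R \<xi>)) * of_real (exp (- \<sigma> * (norm x)\<^sup>2 / 2)))"
    unfolding ft_def by (simp add: mult.assoc[symmetric] cis_mult inner_add_right add.commute)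
  also have "\<dots> = of_real (ft_const TYPE('a) * (sqrt (2 * pi / \<sigma>) ^ DIM('a) * exp (- (norm (a + s *\<^sub>R \<xi>))\<^sup>2 / (2 * \<sigma>))))"
    by (simp only: integral_cis_gaussian[OF assms] of_real_mult)
  also have "ft_const TYPE('a) * (sqrt (2 * pi / \<sigma>) ^ DIM('a) * exp (- (norm (a + s *\<^sub>R \<xi>))\<^sup>2 / (2 * \<sigma>)))
     = (1 / sqrt \<sigma>) ^ DIM('a) * exp (- (norm (a + s *\<^sub>R \<xi>))\<^sup>2 / (2 * \<sigma>))"
    by (simp add: ft_const_eq real_sqrt_divide power_divide)
  finally show ?thesis .
qed

lemma cnj_ft: "cnj (ft s f \<xi>) = ft (- s) (\<lambda>x. cnj (f x)) \<xi>"
  unfolding ft_def complex_cnj_mult by (subst Bochner_Integration.integral_cnj[symmetric]) (simp add: cis_cnj del: Bochner_Integration.integral_cnj)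

text \<open>The squared modulus is written as \<open>F\<close> times its conjugate, and the
  multiplication formula moves the transform from \<open>F\<close> to the weighted conjugate.
  Transforming the latter gives the conjugate of \<open>f\<close> convolved with the heat kernel of
  variance \<epsilon>.\<close>

lemma integral_norm_ft_gaussian:
  fixes f :: "'a::euclidean_space \<Rightarrow> complex"
  assumes f: "integrable lborel f" and \<epsilon>: "\<epsilon> > 0" and s: "s\<^sup>2 = 1"
  shows "(LBINT \<xi>. (norm (ft s f \<xi>))\<^sup>2 * exp (- (\<epsilon> * (norm \<xi>)\<^sup>2 / 2)))
    \<le> (LBINT x. norm (f x) * (LBINT y. norm (f y) * ((1 / sqrt (2 * pi * \<epsilon>)) ^ DIM('a) * exp (- (norm (x - y))\<^sup>2 / (2 * \<epsilon>)))))"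
proof -
  have [measurable]: "f \<in> borel_measurable borel" using f by auto
  define \<gamma> where "\<gamma> = (\<lambda>\<xi>::'a. complex_of_real (exp (- (\<epsilon> * (norm \<xi>)\<^sup>2 / 2))))"
  define F where "F = ft s f"
  have [measurable]: "\<gamma> \<in> borel_measurable borel" "F \<in> borel_measurable borel"
    unfolding \<gamma>_def F_def by measurable
  have \<gamma>: "integrable lborel \<gamma>"
    unfolding \<gamma>_def using integrable_gaussian[OF \<epsilon>] by (intro integrable_of_real) auto
  \<comment> \<open>The transform of an integrable function is bounded but may fail to be
    integrable; the Gaussian supplies the integrability that the multiplication formula
    requires.\<close>
  have F\<gamma>: "integrable lborel (\<lambda>\<xi>. cnj (F \<xi>) * \<gamma> \<xi>)"
  proof (rule Bochner_Integration.integrable_bound)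
    show "integrable lborel (\<lambda>\<xi>. ft_const TYPE('a) * (LBINT x. norm (f x)) * norm (\<gamma> \<xi>))"
      using \<gamma> by (intro integrable_mult_right) auto
    show "AE x in lborel. norm (cnj (F x) * \<gamma> x) \<le> norm (ft_const TYPE('a) * (LBINT x. norm (f x)) * norm (\<gamma> x))"
      using norm_ft_le[of s f] ft_const_pos[where 'a='a]
      by (intro AE_I2) (simp add: norm_mult F_def mult_right_mono abs_mult)
  qed measurable
  have inner: "ft s (\<lambda>\<xi>. cnj (F \<xi>) * \<gamma> \<xi>) x =
     (LBINT y. cnj (f y) * of_real ((1 / sqrt (2 * pi * \<epsilon>)) ^ DIM('a) * exp (- (norm (x - y))\<^sup>2 / (2 * \<epsilon>))))" for x
  proof -
    let ?g = "\<lambda>\<xi>. cis (\<xi> \<bullet> (s *\<^sub>R x)) * \<gamma> \<xi>"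
    have "ft s (\<lambda>\<xi>. cnj (F \<xi>) * \<gamma> \<xi>) x = of_real (ft_const TYPE('a)) * (LBINT \<xi>. ft (- s) (\<lambda>x. cnj (f x)) \<xi> * ?g \<xi>)"
      by (subst ft_def) (simp add: F_def cnj_ft mult_ac)
    also have "\<dots> = of_real (ft_const TYPE('a)) * (LBINT y. cnj (f y) * ft (- s) ?g y)"
      using f by (subst ft_multiplication) (auto intro!: integrable_cis_mult \<gamma>)
    also have "\<dots> = (LBINT y. cnj (f y) * (of_real (ft_const TYPE('a)) * ft (- s) ?g y))"
      by (simp only: mult.left_commute[of "of_real _"] integral_mult_right_zero[symmetric])
    also have "(\<lambda>y. of_real (ft_const TYPE('a)) * ft (- s) ?g y) =
      (\<lambda>y. of_real ((1 / sqrt (2 * pi * \<epsilon>)) ^ DIM('a) * exp (- (norm (x - y))\<^sup>2 / (2 * \<epsilon>))))"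
    proof
      fix y
      have "norm (s *\<^sub>R x - s *\<^sub>R y) = norm (x - y)"
        using s by (simp flip: scaleR_diff_right add: power2_eq_1_iff) auto
      moreover have "ft_const TYPE('a) * (1 / sqrt \<epsilon>) ^ DIM('a) = (1 / sqrt (2 * pi * \<epsilon>)) ^ DIM('a)"
        by (simp add: ft_const_eq real_sqrt_mult power_divide power_mult_distrib)
      ultimately show "of_real (ft_const TYPE('a)) * ft (- s) ?g y =
        complex_of_real ((1 / sqrt (2 * pi * \<epsilon>)) ^ DIM('a) * exp (- (norm (x - y))\<^sup>2 / (2 * \<epsilon>)))"
        unfolding \<gamma>_def by (subst ft_gaussian[OF \<epsilon>]) (simp flip: of_real_mult add: mult.assoc[symmetric] del: of_real_power)
    qed
    finally show ?thesis .
  qed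
  have "complex_of_real (LBINT \<xi>. (norm (F \<xi>))\<^sup>2 * exp (- (\<epsilon> * (norm \<xi>)\<^sup>2 / 2)))
     = (LBINT \<xi>. F \<xi> * (cnj (F \<xi>) * \<gamma> \<xi>))"
    unfolding \<gamma>_def integral_complex_of_real[symmetric]
    by (intro Bochner_Integration.integral_cong refl) (simp add: complex_norm_square[symmetric] mult.assoc[symmetric] del: of_real_power)
  also have "\<dots> = (LBINT x. f x * ft s (\<lambda>\<xi>. cnj (F \<xi>) * \<gamma> \<xi>) x)"
    unfolding F_def by (rule ft_multiplication[OF f]) (use F\<gamma> F_def in auto)
  finally have eq: "complex_of_real (LBINT \<xi>. (norm (F \<xi>))\<^sup>2 * exp (- (\<epsilon> * (norm \<xi>)\<^sup>2 / 2)))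
     = (LBINT x. f x * ft s (\<lambda>\<xi>. cnj (F \<xi>) * \<gamma> \<xi>) x)" .
  have "(LBINT \<xi>. (norm (F \<xi>))\<^sup>2 * exp (- (\<epsilon> * (norm \<xi>)\<^sup>2 / 2)))
     \<le> norm (LBINT x. f x * ft s (\<lambda>\<xi>. cnj (F \<xi>) * \<gamma> \<xi>) x)"
    unfolding eq[symmetric] norm_of_real by (rule abs_ge_self)
  also have "\<dots> \<le> (LBINT x. norm (f x * ft s (\<lambda>\<xi>. cnj (F \<xi>) * \<gamma> \<xi>) x))"
    by (rule integral_norm_bound)
  also have "\<dots> \<le> (LBINT x. norm (f x) * (LBINT y. norm (f y) * ((1 / sqrt (2 * pi * \<epsilon>)) ^ DIM('a) * exp (- (norm (x - y))\<^sup>2 / (2 * \<epsilon>)))))"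
  proof (rule integral_mono')
    let ?k = "\<lambda>x y::'a. (1 / sqrt (2 * pi * \<epsilon>)) ^ DIM('a) * exp (- (norm (x - y))\<^sup>2 / (2 * \<epsilon>))"
    show "norm (f x * ft s (\<lambda>\<xi>. cnj (F \<xi>) * \<gamma> \<xi>) x) \<le> norm (f x) * (LBINT y. norm (f y) * ?k x y)" for x
    proof -
      have "norm (ft s (\<lambda>\<xi>. cnj (F \<xi>) * \<gamma> \<xi>) x) \<le> (LBINT y. norm (cnj (f y) * of_real (?k x y)))"
        unfolding inner by (rule integral_norm_bound)
      also have "\<dots> = (LBINT y. norm (f y) * ?k x y)"
        using \<epsilon> by (simp add: norm_mult del: of_real_mult of_real_power)
      finally show ?thesis by (simp add: norm_mult mult_left_mono)
    qed
    show "integrable lborel (\<lambda>x. norm (f x) * (LBINT y. norm (f y) * ?k x y))"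
    proof (rule Bochner_Integration.integrable_bound)
      show "integrable lborel (\<lambda>x. norm (f x) * (LBINT y. norm (f y) * ((1 / sqrt (2 * pi * \<epsilon>)) ^ DIM('a))))"
        using f by (intro integrable_mult_left) auto
      show "AE x in lborel. norm (norm (f x) * (LBINT y. norm (f y) * ?k x y)) \<le> norm (norm (f x) * (LBINT y. norm (f y) * ((1 / sqrt (2 * pi * \<epsilon>)) ^ DIM('a))))"
      proof (rule AE_I2)
        fix x :: 'a
        have "0 \<le> (LBINT y. norm (f y) * ?k x y)" using \<epsilon> by (intro integral_nonneg_AE) auto
        moreover have "(LBINT y. norm (f y) * ?k x y) \<le> (LBINT y. norm (f y) * ((1 / sqrt (2 * pi * \<epsilon>)) ^ DIM('a)))"
          using f \<epsilon> by (intro integral_mono') (auto intro!: mult_left_mono mult_left_le simp: divide_nonpos_pos)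
        moreover have "\<bar>(1 / sqrt (2 * pi * \<epsilon>)) ^ DIM('a)\<bar> = (1 / sqrt (2 * pi * \<epsilon>)) ^ DIM('a)"
          using \<epsilon> by (intro abs_of_nonneg) simp
        ultimately show "norm (norm (f x) * (LBINT y. norm (f y) * ?k x y)) \<le> norm (norm (f x) * (LBINT y. norm (f y) * ((1 / sqrt (2 * pi * \<epsilon>)) ^ DIM('a))))"
          by (auto simp: abs_mult intro!: mult_left_mono)
      qed
    qed measurable
  qed (use \<epsilon> in auto)
  finally show ?thesis unfolding F_def .
qed

text \<open>Integrability is not assumed: where it fails, the left side is the default value
  0.\<close>

lemma ennreal_integral_le_nn_integral:
  assumes "\<And>x. 0 \<le> f x"
  shows "ennreal (\<integral>x. f x \<partial>M) \<le> (\<integral>\<^sup>+x. ennreal (f x) \<partial>M)"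
proof (cases "integrable M f")
  case True
  then show ?thesis using assms by (subst nn_integral_eq_integral) auto
qed (simp add: not_integrable_integral_eq)

lemma nn_integral_heat_kernel:
  fixes x :: "'a::euclidean_space"
  assumes "\<epsilon> > 0"
  shows "(\<integral>\<^sup>+y. ennreal ((1 / sqrt (2 * pi * \<epsilon>)) ^ DIM('a) * exp (- (norm (x - y))\<^sup>2 / (2 * \<epsilon>))) \<partial>lborel) = 1"
    (is "?L = 1")
proof -
  let ?c = "(1 / sqrt (2 * pi * \<epsilon>)) ^ DIM('a)"
  have c: "?c \<ge> 0" using assms by simp
  have "?L = (\<integral>\<^sup>+y. ennreal (?c * exp (- (norm (x - (x + (-1) *\<^sub>R y)))\<^sup>2 / (2 * \<epsilon>))) \<partial>lborel)"
    by (subst nn_integral_lborel_affine[where c="-1" and t=x]) auto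
  also have "\<dots> = (\<integral>\<^sup>+y. ennreal (?c * exp (- (1 / \<epsilon>) * (norm (y :: 'a))\<^sup>2 / 2)) \<partial>lborel)"
    by (simp add: field_simps)
  also have "\<dots> = ennreal (?c * sqrt (2 * pi / (1 / \<epsilon>)) ^ DIM('a))"
  proof -
    have "integrable lborel (\<lambda>y::'a. ?c * exp (- (1 / \<epsilon>) * (norm y)\<^sup>2 / 2))"
      using integrable_gaussian[of "1 / \<epsilon>", where 'a='a] assms by (intro integrable_mult_right) simp
    then show ?thesis
      using assms c by (subst nn_integral_eq_integral) (auto simp del: power_one_over simp: integral_gaussian[of "1 / \<epsilon>", simplified])
  qed
  also have "?c * sqrt (2 * pi / (1 / \<epsilon>)) ^ DIM('a) = 1"
    using assms by (simp add: power_mult_distrib[symmetric])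
  finally show ?thesis by simp
qed

text \<open>Bessel's inequality by Schur's test: with the Gaussian weight,
  \<open>a * b \<le> a^2 / 2 + b^2 / 2\<close> and the unit mass of the heat kernel in either
  variable give a bound that does not see \<epsilon>. Fatou's lemma then removes the weight.\<close>

lemma L2_sq_ft_le:
  fixes f :: "'a::euclidean_space \<Rightarrow> complex"
  assumes f: "integrable lborel f" and s: "s\<^sup>2 = 1"
  shows "L2_sq (ft s f) \<le> L2_sq f"
proof -
  have [measurable]: "f \<in> borel_measurable borel" using f by auto
  have reg: "(\<integral>\<^sup>+\<xi>. ennreal ((norm (ft s f \<xi>))\<^sup>2 * exp (- (\<epsilon> * (norm \<xi>)\<^sup>2 / 2))) \<partial>lborel) \<le> L2_sq f" if \<epsilon>: "\<epsilon> > 0" for \<epsilon>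
  proof -
    define k where "k = (\<lambda>x y::'a. (1 / sqrt (2 * pi * \<epsilon>)) ^ DIM('a) * exp (- (norm (x - y))\<^sup>2 / (2 * \<epsilon>)))"
    have [measurable]: "(\<lambda>(x, y). k x y) \<in> borel_measurable (borel \<Otimes>\<^sub>M borel)"
      unfolding k_def by measurable
    have k0: "k x y \<ge> 0" for x y using \<epsilon> by (simp add: k_def)
    have k1: "(\<integral>\<^sup>+y. ennreal (k x y) \<partial>lborel) = 1" for x
      unfolding k_def by (rule nn_integral_heat_kernel[OF \<epsilon>])
    have k2: "(\<integral>\<^sup>+x. ennreal (k x y) \<partial>lborel) = 1" for y
      using k1[of y] by (simp add: k_def norm_minus_commute)
    let ?C = "ft_const TYPE('a) * (LBINT x. norm (f x))"
    have "integrable lborel (\<lambda>\<xi>. (norm (ft s f \<xi>))\<^sup>2 * exp (- (\<epsilon> * (norm \<xi>)\<^sup>2 / 2)))"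
    proof (rule Bochner_Integration.integrable_bound)
      show "integrable lborel (\<lambda>\<xi>::'a. ?C\<^sup>2 * exp (- (\<epsilon> * (norm \<xi>)\<^sup>2 / 2)))"
        using \<epsilon> by (intro integrable_mult_right integrable_gaussian)
      show "AE \<xi> in lborel. norm ((norm (ft s f \<xi>))\<^sup>2 * exp (- (\<epsilon> * (norm \<xi>)\<^sup>2 / 2)))
         \<le> norm (?C\<^sup>2 * exp (- (\<epsilon> * (norm \<xi>)\<^sup>2 / 2)))"
        by (intro AE_I2) (auto simp: abs_mult intro!: mult_right_mono power_mono norm_ft_le)
    qed measurable
    then have "(\<integral>\<^sup>+\<xi>. ennreal ((norm (ft s f \<xi>))\<^sup>2 * exp (- (\<epsilon> * (norm \<xi>)\<^sup>2 / 2))) \<partial>lborel)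
       = ennreal (LBINT \<xi>. (norm (ft s f \<xi>))\<^sup>2 * exp (- (\<epsilon> * (norm \<xi>)\<^sup>2 / 2)))"
      by (intro nn_integral_eq_integral) auto
    also have "\<dots> \<le> ennreal (LBINT x. norm (f x) * (LBINT y. norm (f y) * k x y))"
      unfolding k_def by (intro ennreal_leI integral_norm_ft_gaussian f \<epsilon> s)
    also have "\<dots> \<le> (\<integral>\<^sup>+x. ennreal (norm (f x) * (LBINT y. norm (f y) * k x y)) \<partial>lborel)"
      by (rule ennreal_integral_le_nn_integral) (simp add: k0)
    also have "\<dots> \<le> (\<integral>\<^sup>+x. \<integral>\<^sup>+y. ennreal (norm (f x) * (norm (f y) * k x y)) \<partial>lborel \<partial>lborel)"
    proof (rule nn_integral_mono)
      fix x
      have "ennreal (norm (f x) * (LBINT y. norm (f y) * k x y)) = ennreal (LBINT y. norm (f x) * (norm (f y) * k x y))"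
        by simp
      also have "\<dots> \<le> (\<integral>\<^sup>+y. ennreal (norm (f x) * (norm (f y) * k x y)) \<partial>lborel)"
        by (rule ennreal_integral_le_nn_integral) (simp add: k0)
      finally show "ennreal (norm (f x) * (LBINT y. norm (f y) * k x y)) \<le> (\<integral>\<^sup>+y. ennreal (norm (f x) * (norm (f y) * k x y)) \<partial>lborel)" .
    qed
    also have "\<dots> \<le> (\<integral>\<^sup>+x. \<integral>\<^sup>+y. ennreal ((norm (f x))\<^sup>2 / 2) * ennreal (k x y) + ennreal ((norm (f y))\<^sup>2 / 2) * ennreal (k x y) \<partial>lborel \<partial>lborel)"
    proof (intro nn_integral_mono)
      fix x y
      have "norm (f x) * norm (f y) \<le> (norm (f x))\<^sup>2 / 2 + (norm (f y))\<^sup>2 / 2"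
        using sum_squares_bound[of "norm (f x)" "norm (f y)"] by simp
      from mult_right_mono[OF this k0[of x y]]
      show "ennreal (norm (f x) * (norm (f y) * k x y)) \<le> ennreal ((norm (f x))\<^sup>2 / 2) * ennreal (k x y) + ennreal ((norm (f y))\<^sup>2 / 2) * ennreal (k x y)"
        by (simp add: k0 distrib_right mult.assoc flip: ennreal_mult ennreal_plus)
    qed
    also have "\<dots> = (\<integral>\<^sup>+x. \<integral>\<^sup>+y. ennreal ((norm (f x))\<^sup>2 / 2) * ennreal (k x y) \<partial>lborel \<partial>lborel)
        + (\<integral>\<^sup>+x. \<integral>\<^sup>+y. ennreal ((norm (f y))\<^sup>2 / 2) * ennreal (k x y) \<partial>lborel \<partial>lborel)"
      by (simp add: nn_integral_add)
    also have "(\<integral>\<^sup>+x. \<integral>\<^sup>+y. ennreal ((norm (f x))\<^sup>2 / 2) * ennreal (k x y) \<partial>lborel \<partial>lborel) = (\<integral>\<^sup>+x. ennreal ((norm (f x))\<^sup>2 / 2) \<partial>lborel)"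
      by (simp add: nn_integral_cmult k1)
    also have "(\<integral>\<^sup>+x. \<integral>\<^sup>+y. ennreal ((norm (f y))\<^sup>2 / 2) * ennreal (k x y) \<partial>lborel \<partial>lborel)
       = (\<integral>\<^sup>+y. \<integral>\<^sup>+x. ennreal ((norm (f y))\<^sup>2 / 2) * ennreal (k x y) \<partial>lborel \<partial>lborel)"
      by (rule lborel_pair.Fubini') measurable
    also have "\<dots> = (\<integral>\<^sup>+x. ennreal ((norm (f x))\<^sup>2 / 2) \<partial>lborel)"
      by (simp add: nn_integral_cmult k2)
    also have "(\<integral>\<^sup>+x. ennreal ((norm (f x))\<^sup>2 / 2) \<partial>lborel) + (\<integral>\<^sup>+x. ennreal ((norm (f x))\<^sup>2 / 2) \<partial>lborel) = L2_sq f"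
      unfolding L2_sq_def by (subst nn_integral_add[symmetric]) (auto simp flip: ennreal_plus)
    finally show ?thesis .
  qed
  have lim: "(\<lambda>n. ennreal ((norm (ft s f \<xi>))\<^sup>2 * exp (- (1 / real (Suc n) * (norm \<xi>)\<^sup>2 / 2)))) \<longlonglongrightarrow> ennreal ((norm (ft s f \<xi>))\<^sup>2)" for \<xi>
  proof (rule tendsto_ennrealI)
    have "(\<lambda>n. 1 / real (Suc n)) \<longlonglongrightarrow> 0" by (rule LIMSEQ_Suc[OF lim_1_over_n])
    then have "(\<lambda>n. (norm (ft s f \<xi>))\<^sup>2 * exp (- (1 / real (Suc n) * (norm \<xi>)\<^sup>2 / 2))) \<longlonglongrightarrow> (norm (ft s f \<xi>))\<^sup>2 * exp (- (0 * (norm \<xi>)\<^sup>2 / 2))"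
      by (intro tendsto_intros) simp_all
    then show "(\<lambda>n. (norm (ft s f \<xi>))\<^sup>2 * exp (- (1 / real (Suc n) * (norm \<xi>)\<^sup>2 / 2))) \<longlonglongrightarrow> (norm (ft s f \<xi>))\<^sup>2"
      by simp
  qed
  have "L2_sq (ft s f) = (\<integral>\<^sup>+\<xi>. liminf (\<lambda>n. ennreal ((norm (ft s f \<xi>))\<^sup>2 * exp (- (1 / real (Suc n) * (norm \<xi>)\<^sup>2 / 2)))) \<partial>lborel)"
    unfolding L2_sq_def using lim_imp_Liminf[OF _ lim] by (intro nn_integral_cong) simp
  also have "\<dots> \<le> liminf (\<lambda>n. \<integral>\<^sup>+\<xi>. ennreal ((norm (ft s f \<xi>))\<^sup>2 * exp (- (1 / real (Suc n) * (norm \<xi>)\<^sup>2 / 2))) \<partial>lborel)"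
    by (rule nn_integral_liminf) measurable
  also have "\<dots> \<le> L2_sq f"
  proof (rule Liminf_le)
    show "\<forall>\<^sub>F n in sequentially. (\<integral>\<^sup>+\<xi>. ennreal ((norm (ft s f \<xi>))\<^sup>2 * exp (- (1 / real (Suc n) * (norm \<xi>)\<^sup>2 / 2))) \<partial>lborel) \<le> L2_sq f"
      by (intro always_eventually allI reg) simp
  qed simp
  finally show ?thesis .
qed

section \<open>The mean-square distance: triangle inequality, completeness and limits\<close>

lemma L2_sq_add_le:
  assumes [measurable]: "f \<in> borel_measurable borel" "g \<in> borel_measurable borel"
  shows "L2_sq (\<lambda>x. f x + g x) \<le> 2 * L2_sq f + 2 * L2_sq g"
proof -
  have "L2_sq (\<lambda>x. f x + g x) \<le> (\<integral>\<^sup>+x. 2 * ennreal ((norm (f x))\<^sup>2) + 2 * ennreal ((norm (g x))\<^sup>2) \<partial>lborel)"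
    unfolding L2_sq_def
  proof (rule nn_integral_mono)
    fix x
    have "(norm (f x + g x))\<^sup>2 \<le> (norm (f x) + norm (g x))\<^sup>2"
      by (intro power_mono norm_triangle_ineq) auto
    also have "\<dots> \<le> 2 * (norm (f x))\<^sup>2 + 2 * (norm (g x))\<^sup>2"
      using sum_squares_bound[of "norm (f x)" "norm (g x)"] by (simp add: power2_sum)
    finally have "ennreal ((norm (f x + g x))\<^sup>2) \<le> ennreal (2 * (norm (f x))\<^sup>2 + 2 * (norm (g x))\<^sup>2)"
      by (rule ennreal_leI)
    then show "ennreal ((norm (f x + g x))\<^sup>2) \<le> 2 * ennreal ((norm (f x))\<^sup>2) + 2 * ennreal ((norm (g x))\<^sup>2)"
      by (simp add: ennreal_mult)
  qed
  also have "\<dots> = 2 * L2_sq f + 2 * L2_sq g"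
    unfolding L2_sq_def by (simp add: nn_integral_add nn_integral_cmult)
  finally show ?thesis .
qed

lemma L2_sq_minus_commute: "L2_sq (\<lambda>x. f x - g x) = L2_sq (\<lambda>x. g x - f x)"
  by (simp add: L2_sq_def norm_minus_commute)

lemma L2_sq_diff_le:
  assumes [measurable]: "f \<in> borel_measurable borel" "g \<in> borel_measurable borel" "h \<in> borel_measurable borel"
  shows "L2_sq (\<lambda>x. f x - g x) \<le> 2 * L2_sq (\<lambda>x. f x - h x) + 2 * L2_sq (\<lambda>x. g x - h x)"
  using L2_sq_add_le[of "\<lambda>x. f x - h x" "\<lambda>x. h x - g x"] by (simp add: L2_sq_minus_commute[of h g])

lemma L2_sq_cong_AE: "AE x in lborel. f x = g x \<Longrightarrow> L2_sq f = L2_sq g"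
  unfolding L2_sq_def by (intro nn_integral_cong_AE) auto

lemma L2_sq_eq_0_iff:
  assumes [measurable]: "f \<in> borel_measurable borel"
  shows "L2_sq f = 0 \<longleftrightarrow> (AE x in lborel. f x = 0)"
  unfolding L2_sq_def by (subst nn_integral_0_iff_AE) (auto simp: ennreal_eq_0_iff)

text \<open>Real tolerances suffice because every positive \<open>ennreal\<close> has a finite
  positive number below it.\<close>

lemma tendsto_ennreal_0_iff:
  fixes F :: "'a \<Rightarrow> ennreal"
  shows "(F \<longlongrightarrow> 0) A \<longleftrightarrow> (\<forall>e>0. eventually (\<lambda>x. F x < ennreal e) A)"
proof
  show "(F \<longlongrightarrow> 0) A \<Longrightarrow> \<forall>e>0. eventually (\<lambda>x. F x < ennreal e) A"
    by (auto intro!: order_tendstoD(2))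
next
  assume *: "\<forall>e>0. eventually (\<lambda>x. F x < ennreal e) A"
  show "(F \<longlongrightarrow> 0) A"
  proof (rule order_tendstoI)
    fix a :: ennreal assume "0 < a"
    then obtain b where "0 < b" "b < a" using dense by blast
    then have b: "b \<noteq> \<top>" by auto
    with \<open>0 < b\<close> have "0 < enn2real b" by (simp add: enn2real_positive_iff less_top)
    with * have "eventually (\<lambda>x. F x < ennreal (enn2real b)) A" by blast
    moreover have "ennreal (enn2real b) = b" using b by (simp add: less_top)
    ultimately show "eventually (\<lambda>x. F x < a) A"
      using \<open>b < a\<close> by (auto elim!: eventually_mono)
  qed auto
qed

text \<open>Riesz-Fischer: a subsequence whose squared increments are summable with geometric
  weights converges almost everywhere, and Fatou's lemma shows that the whole sequence converges in
  mean to its limit.\<close>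

lemma L2_sq_complete:
  fixes G :: "nat \<Rightarrow> 'a::euclidean_space \<Rightarrow> complex"
  assumes [measurable]: "\<And>n. G n \<in> borel_measurable borel"
    and Cauchy: "\<And>e. e > 0 \<Longrightarrow> \<exists>N. \<forall>m\<ge>N. \<forall>n\<ge>N. L2_sq (\<lambda>x. G m x - G n x) < ennreal e"
  shows "\<exists>g\<in>borel_measurable borel. (\<lambda>n. L2_sq (\<lambda>x. G n x - g x)) \<longlonglongrightarrow> 0"
proof -
  have "\<exists>N. \<forall>m\<ge>N. \<forall>n\<ge>N. L2_sq (\<lambda>x. G m x - G n x) < ennreal ((1/16) ^ k)" for k
    by (rule Cauchy) simp
  then obtain N where N: "\<And>k m n. m \<ge> N k \<Longrightarrow> n \<ge> N k \<Longrightarrow> L2_sq (\<lambda>x. G m x - G n x) < ennreal ((1/16) ^ k)"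
    by metis
  \<comment> \<open>Summing the thresholds makes \<open>r k\<close> at least \<open>N j\<close> for
    every \<open>j \<le> k\<close>, and the summand \<open>k\<close> makes it tend to
    infinity.\<close>
  define r where "r k = (\<Sum>j\<le>k. N j) + k" for k
  have rN: "r k \<ge> N j" if "j \<le> k" for j k
    unfolding r_def using member_le_sum[of j "{..k}" N] that by simp
  have r_k: "r k \<ge> k" for k by (simp add: r_def)
  \<comment> \<open>The weight \<open>4 ^ k\<close> is chosen between two needs: against squared
    increments below \<open>(1/16) ^ k\<close> the integral of \<open>S\<close> is still a geometric
    series, and finiteness of \<open>S x\<close> forces increments of order
    \<open>(1/2) ^ k\<close>, hence convergence.\<close>
  define S where "S x = (\<Sum>k. ennreal (4 ^ k) * ennreal ((norm (G (r (Suc k)) x - G (r k) x))\<^sup>2))" for x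
  have [measurable]: "S \<in> borel_measurable borel" unfolding S_def by measurable
  have "(\<integral>\<^sup>+x. S x \<partial>lborel) = (\<Sum>k. ennreal (4 ^ k) * L2_sq (\<lambda>x. G (r (Suc k)) x - G (r k) x))"
    unfolding S_def L2_sq_def by (simp add: nn_integral_suminf nn_integral_cmult)
  also have "\<dots> \<le> (\<Sum>k. ennreal ((1/4) ^ k))"
  proof (rule suminf_le)
    fix k
    have "ennreal (4 ^ k) * L2_sq (\<lambda>x. G (r (Suc k)) x - G (r k) x) \<le> ennreal (4 ^ k) * ennreal ((1/16) ^ k)"
      using N[of k "r (Suc k)" "r k"] rN[of k k] rN[of k "Suc k"] by (intro mult_left_mono) auto
    also have "\<dots> = ennreal ((1/4) ^ k)" by (simp flip: ennreal_mult power_mult_distrib)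
    finally show "ennreal (4 ^ k) * L2_sq (\<lambda>x. G (r (Suc k)) x - G (r k) x) \<le> ennreal ((1/4) ^ k)" .
  qed auto
  also have "\<dots> < \<infinity>" by (subst suminf_ennreal2) (auto intro!: summable_geometric)
  finally have "AE x in lborel. S x \<noteq> \<infinity>" by (intro nn_integral_PInf_AE) auto
  then have conv: "AE x in lborel. convergent (\<lambda>k. G (r k) x)"
  proof eventually_elim
    case (elim x)
    let ?d = "\<lambda>k. G (r (Suc k)) x - G (r k) x"
    define s where "s = enn2real (S x)"
    have s: "S x = ennreal s" using elim by (simp add: s_def less_top)
    have "norm (?d k) \<le> sqrt s * (1/2) ^ k" for k
    proof -
      have "ennreal (4 ^ k) * ennreal ((norm (?d k))\<^sup>2) \<le> S x"
        unfolding S_def using sum_le_suminf[of "\<lambda>k. ennreal (4 ^ k) * ennreal ((norm (?d k))\<^sup>2)" "{k}"] by simp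
      then have "ennreal (4 ^ k * (norm (?d k))\<^sup>2) \<le> ennreal s" by (simp add: s ennreal_mult)
      then have "4 ^ k * (norm (?d k))\<^sup>2 \<le> s" by (subst (asm) ennreal_le_iff) (auto simp: s_def)
      moreover have "(2 ^ k * norm (?d k))\<^sup>2 = 4 ^ k * (norm (?d k))\<^sup>2"
      proof -
        have "((2::real) ^ k)\<^sup>2 = 4 ^ k" by (simp add: power2_eq_square flip: power_mult_distrib)
        then show ?thesis by (simp add: power_mult_distrib)
      qed
      ultimately have "(2 ^ k * norm (?d k))\<^sup>2 \<le> s" by simp
      then have "2 ^ k * norm (?d k) \<le> sqrt s" by (rule real_le_rsqrt)
      then show ?thesis by (simp add: field_simps power_divide)
    qed
    then have *: "\<And>k. norm (norm (?d k)) \<le> sqrt s * (1/2) ^ k" by simp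
    have "summable (\<lambda>k. sqrt s * (1/2) ^ k)" by (intro summable_mult summable_geometric) simp
    then have "summable (\<lambda>k. norm (?d k))" by (rule summable_comparison_test') (rule *)
    then have "summable ?d" by (rule summable_norm_cancel)
    then have "convergent (\<lambda>n. G (r n) x - G (r 0) x)"
      unfolding summable_iff_convergent sum_lessThan_telescope[of "\<lambda>k. G (r k) x"] .
    then have "convergent (\<lambda>n. G (r n) x - G (r 0) x + G (r 0) x)"
      by (intro convergent_add convergent_const)
    then show ?case by simp
  qed
  define g where "g x = lim (\<lambda>k. G (r k) x)" for x
  have [measurable]: "g \<in> borel_measurable borel"
    unfolding g_def by (rule borel_measurable_lim_metric) measurable
  have lim: "AE x in lborel. (\<lambda>k. G (r k) x) \<longlonglongrightarrow> g x"
    using conv by eventually_elim (simp add: g_def convergent_LIMSEQ_iff)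
  have "(\<lambda>n. L2_sq (\<lambda>x. G n x - g x)) \<longlonglongrightarrow> 0"
    unfolding tendsto_ennreal_0_iff
  proof (intro allI impI)
    fix e :: real assume "e > 0"
    then obtain M where M: "\<And>m n. m \<ge> M \<Longrightarrow> n \<ge> M \<Longrightarrow> L2_sq (\<lambda>x. G m x - G n x) < ennreal (e / 2)"
      using Cauchy[of "e / 2"] by auto
    have "L2_sq (\<lambda>x. G m x - g x) < ennreal e" if "m \<ge> M" for m
    proof -
      have "L2_sq (\<lambda>x. G m x - g x) = (\<integral>\<^sup>+x. liminf (\<lambda>k. ennreal ((norm (G m x - G (r k) x))\<^sup>2)) \<partial>lborel)"
        unfolding L2_sq_def
      proof (rule nn_integral_cong_AE)
        show "AE x in lborel. ennreal ((norm (G m x - g x))\<^sup>2) = liminf (\<lambda>k. ennreal ((norm (G m x - G (r k) x))\<^sup>2))"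
          using lim
        proof eventually_elim
          case (elim x)
          then have "(\<lambda>k. ennreal ((norm (G m x - G (r k) x))\<^sup>2)) \<longlonglongrightarrow> ennreal ((norm (G m x - g x))\<^sup>2)"
            by (intro tendsto_intros)
          from lim_imp_Liminf[OF trivial_limit_sequentially this] show ?case by (rule sym)
        qed
      qed
      also have "\<dots> \<le> liminf (\<lambda>k. L2_sq (\<lambda>x. G m x - G (r k) x))"
        unfolding L2_sq_def by (rule nn_integral_liminf) measurable
      also have "\<dots> \<le> ennreal (e / 2)"
      proof (rule Liminf_le)
        show "\<forall>\<^sub>F k in sequentially. L2_sq (\<lambda>x. G m x - G (r k) x) \<le> ennreal (e / 2)"
          using eventually_ge_at_top[of M]
          by eventually_elim (rule less_imp_le[OF M[OF that order_trans[OF _ r_k]]])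
      qed auto
      also have "\<dots> < ennreal e" using \<open>e > 0\<close> by (intro ennreal_lessI) auto
      finally show ?thesis .
    qed
    then show "\<forall>\<^sub>F n in sequentially. L2_sq (\<lambda>x. G n x - g x) < ennreal e"
      unfolding eventually_sequentially by blast
  qed
  then show ?thesis by (rule bexI[where x=g]) measurable
qed

lemma ennpowr_half_less_iff:
  assumes "e > 0"
  shows "ennpowr x (1 / 2) < ennreal e \<longleftrightarrow> x < ennreal (e\<^sup>2)"
proof (cases x)
  case (real r)
  have 1: "r powr (1 / 2) = sqrt r" using real(1) by (rule powr_half_sqrt)
  have 2: "sqrt r < e \<longleftrightarrow> r < e\<^sup>2"
    using assms real_sqrt_less_iff[of r "e\<^sup>2"] by simp
  have 3: "ennpowr x (1 / 2) = ennreal (sqrt r)" using real by (simp add: ennpowr_def 1)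
  show ?thesis unfolding 3 unfolding real(2) using 2 real(1) assms by (simp add: ennreal_less_iff)
next
  case top
  then show ?thesis by (simp add: ennpowr_def)
qed

lemma Lp_norm_2: "Lp_norm 2 f = ennpowr (L2_sq f) (1 / 2)"
  for f :: "'a::euclidean_space \<Rightarrow> complex"
proof -
  have "norm (f x) powr 2 = (norm (f x))\<^sup>2" for x by (cases "f x = 0") (auto simp: powr_numeral)
  then show ?thesis by (simp add: Lp_norm_def L2_sq_def)
qed

lemma Lp_space_2_iff: "f \<in> Lp_space 2 \<longleftrightarrow> f \<in> borel_measurable borel \<and> L2_sq f < \<infinity>"
  by (auto simp: Lp_space_def Lp_norm_2 ennpowr_def less_top)

lemma Lp_norm_2_tendsto_0_iff:
  fixes F :: "'b \<Rightarrow> 'a::euclidean_space \<Rightarrow> complex"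
  shows "((\<lambda>R. Lp_norm 2 (F R)) \<longlongrightarrow> 0) A \<longleftrightarrow> ((\<lambda>R. L2_sq (F R)) \<longlongrightarrow> 0) A"
  unfolding Lp_norm_2 tendsto_ennreal_0_iff
proof safe
  fix e :: real assume "e > 0" "\<forall>e>0. \<forall>\<^sub>F x in A. ennpowr (L2_sq (F x)) (1 / 2) < ennreal e"
  then have "\<forall>\<^sub>F x in A. ennpowr (L2_sq (F x)) (1 / 2) < ennreal (sqrt e)" by simp
  with \<open>e > 0\<close> show "\<forall>\<^sub>F x in A. L2_sq (F x) < ennreal e"
    by (subst (asm) ennpowr_half_less_iff) auto
next
  fix e :: real assume "e > 0" "\<forall>e>0. \<forall>\<^sub>F x in A. L2_sq (F x) < ennreal e"
  then have "\<forall>\<^sub>F x in A. L2_sq (F x) < ennreal (e\<^sup>2)" by simp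
  with \<open>e > 0\<close> show "\<forall>\<^sub>F x in A. ennpowr (L2_sq (F x)) (1 / 2) < ennreal e"
    by (simp add: ennpowr_half_less_iff)
qed

lemma L2_sq_tendsto_0_squeeze:
  assumes "((\<lambda>R. L2_sq (F R)) \<longlongrightarrow> 0) A" "((\<lambda>R. L2_sq (G R)) \<longlongrightarrow> 0) A"
    and "\<And>R. H R \<le> 2 * L2_sq (F R) + 2 * L2_sq (G R)"
  shows "(H \<longlongrightarrow> 0) A"
proof -
  have "((\<lambda>R. 2 * L2_sq (F R) + 2 * L2_sq (G R)) \<longlongrightarrow> 2 * 0 + 2 * 0) A"
    using assms(1,2) by (intro tendsto_add ennreal_tendsto_cmult) auto
  then show ?thesis
    by (intro tendsto_sandwich[of "\<lambda>_. 0" H A, OF _ _ tendsto_const]) (auto intro!: always_eventually assms(3))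
qed

text \<open>\<open>L2_lim\<close> is a choice, so it carries information only once some limit
  \<open>g\<close> is exhibited. The chosen function is then a limit as well, and the triangle
  inequality makes the two agree almost everywhere.\<close>

lemma L2_lim:
  fixes F :: "real \<Rightarrow> 'a::euclidean_space \<Rightarrow> complex"
  assumes F: "\<And>R. F R \<in> borel_measurable borel"
    and g: "g \<in> Lp_space 2" and lim: "((\<lambda>R. L2_sq (\<lambda>x. F R x - g x)) \<longlongrightarrow> 0) at_top"
  shows "L2_lim F \<in> Lp_space 2" and "((\<lambda>R. L2_sq (\<lambda>x. F R x - L2_lim F x)) \<longlongrightarrow> 0) at_top"
    and "AE x in lborel. L2_lim F x = g x"
proof -
  let ?P = "\<lambda>g. g \<in> Lp_space 2 \<and> ((\<lambda>R. Lp_norm 2 (\<lambda>x. F R x - g x)) \<longlongrightarrow> 0) at_top"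
  have "?P (L2_lim F)" unfolding L2_lim_def by (rule someI[of ?P g]) (simp add: g lim Lp_norm_2_tendsto_0_iff)
  then show L: "L2_lim F \<in> Lp_space 2" and lim': "((\<lambda>R. L2_sq (\<lambda>x. F R x - L2_lim F x)) \<longlongrightarrow> 0) at_top"
    by (simp_all add: Lp_norm_2_tendsto_0_iff)
  have [measurable]: "g \<in> borel_measurable borel" "L2_lim F \<in> borel_measurable borel"
    using L g by (auto simp: Lp_space_2_iff)
  have "((\<lambda>R::real. L2_sq (\<lambda>x. L2_lim F x - g x)) \<longlongrightarrow> 0) at_top"
  proof (rule L2_sq_tendsto_0_squeeze)
    show "L2_sq (\<lambda>x. L2_lim F x - g x) \<le> 2 * L2_sq (\<lambda>x. F R x - L2_lim F x) + 2 * L2_sq (\<lambda>x. F R x - g x)" for R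
      using L2_sq_diff_le[of "L2_lim F" g "F R"] F by (simp add: L2_sq_minus_commute[of _ "F R"])
  qed (use lim lim' in auto)
  then have "L2_sq (\<lambda>x. L2_lim F x - g x) = 0" by (simp add: tendsto_const_iff)
  then show "AE x in lborel. L2_lim F x = g x" by (subst (asm) L2_sq_eq_0_iff) auto
qed

section \<open>The Fourier transform on L^2 as a limit of truncated integrals\<close>

definition trunc :: "real \<Rightarrow> ('a::euclidean_space \<Rightarrow> complex) \<Rightarrow> 'a \<Rightarrow> complex"
  where "trunc R f x = (if norm x \<le> R then f x else 0)"

definition L2_ft :: "real \<Rightarrow> ('a::euclidean_space \<Rightarrow> complex) \<Rightarrow> 'a \<Rightarrow> complex"
  where "L2_ft s f = L2_lim (\<lambda>R. ft s (trunc R f))"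

lemma fourier_eq_L2_ft: "fourier f = L2_ft (- 1) f"
  and inv_fourier_eq_L2_ft: "inv_fourier f = L2_ft 1 f"
proof -
  have "indicator (cball 0 R) x *\<^sub>R (cis c * f x) = cis c * trunc R f x" for R x c
    by (simp add: trunc_def indicator_def)
  then show "fourier f = L2_ft (- 1) f" "inv_fourier f = L2_ft 1 f"
    unfolding fourier_def inv_fourier_def L2_ft_def ft_def[abs_def] set_lebesgue_integral_def ft_const_def
    by (simp_all add: inner_commute)
qed

lemma measurable_trunc [measurable]:
  assumes [measurable]: "f \<in> borel_measurable borel"
  shows "trunc R f \<in> borel_measurable borel" unfolding trunc_def[abs_def] by measurable

lemma L2_sq_trunc_diff_tendsto:
  fixes f :: "'a::euclidean_space \<Rightarrow> complex"
  assumes f: "f \<in> Lp_space 2"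
  shows "((\<lambda>R. L2_sq (\<lambda>x. trunc R f x - f x)) \<longlongrightarrow> 0) at_top"
proof (rule tendsto_at_topI_sequentially)
  fix X :: "nat \<Rightarrow> real" assume X: "filterlim X at_top sequentially"
  have [measurable]: "f \<in> borel_measurable borel" and N: "L2_sq f < \<infinity>"
    using f by (auto simp: Lp_space_2_iff)
  have "(\<lambda>n. L2_sq (\<lambda>x. trunc (X n) f x - f x)) \<longlonglongrightarrow> (\<integral>\<^sup>+x. 0 \<partial>(lborel :: 'a measure))"
    unfolding L2_sq_def
  proof (rule nn_integral_dominated_convergence[where w="\<lambda>x. ennreal ((norm (f x))\<^sup>2)"])
    show "AE x in lborel. (\<lambda>n. ennreal ((norm (trunc (X n) f x - f x))\<^sup>2)) \<longlonglongrightarrow> 0"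
    proof (rule AE_I2)
      fix x :: 'a
      have "\<forall>\<^sub>F n in sequentially. norm x \<le> X n" using X by (simp add: filterlim_at_top)
      then have "\<forall>\<^sub>F n in sequentially. ennreal ((norm (trunc (X n) f x - f x))\<^sup>2) = 0"
        by eventually_elim (simp add: trunc_def)
      then show "(\<lambda>n. ennreal ((norm (trunc (X n) f x - f x))\<^sup>2)) \<longlonglongrightarrow> 0"
        by (rule tendsto_eventually)
    qed
    show "(\<integral>\<^sup>+x. ennreal ((norm (f x))\<^sup>2) \<partial>lborel) < \<infinity>"
      using N by (simp add: L2_sq_def)
  qed (auto simp: trunc_def intro!: AE_I2)
  then show "(\<lambda>n. L2_sq (\<lambda>x. trunc (X n) f x - f x)) \<longlonglongrightarrow> 0" by simp
qed

lemma Lp_space_2_integrable_sq: "f \<in> Lp_space 2 \<Longrightarrow> integrable lborel (\<lambda>x. (norm (f x))\<^sup>2)"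
  by (auto simp: Lp_space_2_iff L2_sq_def integrable_iff_bounded)

text \<open>On the ball \<open>|f| \<le> 1 + |f|^2\<close>, and the ball has finite measure.\<close>

lemma integrable_trunc:
  fixes f :: "'a::euclidean_space \<Rightarrow> complex"
  assumes f: "f \<in> Lp_space 2"
  shows "integrable lborel (trunc R f)"
proof (rule Bochner_Integration.integrable_bound)
  have [measurable]: "f \<in> borel_measurable borel" using f by (auto simp: Lp_space_2_iff)
  have "integrable lborel (indicator (cball (0::'a) R) :: 'a \<Rightarrow> real)"
    using emeasure_lborel_cball_finite[of "0::'a" R] by (intro integrable_real_indicator) auto
  then show "integrable lborel (\<lambda>x. indicator (cball 0 R) x + (norm (f x))\<^sup>2 :: real)"
    using f by (intro Bochner_Integration.integrable_add Lp_space_2_integrable_sq)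
  have "t \<le> 1 + t\<^sup>2" if "0 \<le> t" for t :: real using sum_squares_bound[of 1 t] that by simp
  then show "AE x in lborel. norm (trunc R f x) \<le> norm (indicator (cball 0 R) x + (norm (f x))\<^sup>2 :: real)"
    by (intro AE_I2) (auto simp: trunc_def indicator_def)
  show "trunc R f \<in> borel_measurable lborel" by measurable
qed

lemma ft_diff:
  assumes "integrable lborel f" "integrable lborel g"
  shows "ft s (\<lambda>x. f x - g x) \<xi> = ft s f \<xi> - ft s g \<xi>"
  using assms unfolding ft_def by (simp add: right_diff_distrib Bochner_Integration.integral_diff integrable_cis_mult)

lemma L2_sq_ft_diff_le:
  assumes "integrable lborel f" "integrable lborel g" "s\<^sup>2 = 1"
  shows "L2_sq (\<lambda>\<xi>. ft s f \<xi> - ft s g \<xi>) \<le> L2_sq (\<lambda>x. f x - g x)"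
proof -
  have "(\<lambda>\<xi>. ft s f \<xi> - ft s g \<xi>) = ft s (\<lambda>x. f x - g x)"
    by (rule ext) (simp add: ft_diff assms)
  then show ?thesis using L2_sq_ft_le[of "\<lambda>x. f x - g x" s] assms by simp
qed

lemma Lp_space_2_diff:
  assumes "f \<in> Lp_space 2" "g \<in> Lp_space 2"
  shows "(\<lambda>x. f x - g x) \<in> Lp_space 2"
proof -
  have [measurable]: "f \<in> borel_measurable borel" "g \<in> borel_measurable borel" and "L2_sq f < \<infinity>" "L2_sq g < \<infinity>"
    using assms by (auto simp: Lp_space_2_iff)
  moreover have "L2_sq (\<lambda>x. f x - g x) \<le> 2 * L2_sq f + 2 * L2_sq g"
    using L2_sq_diff_le[of f g "\<lambda>_. 0"] by simp
  moreover have "2 * L2_sq f + 2 * L2_sq g < \<infinity>"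
    using calculation by (auto simp: ennreal_mult_less_top)
  ultimately show ?thesis by (auto simp: Lp_space_2_iff intro: le_less_trans)
qed

lemma L2_sq_approx_Lp_space_2:
  assumes "f \<in> Lp_space 2" and [measurable]: "g \<in> borel_measurable borel" and "L2_sq (\<lambda>x. f x - g x) < \<infinity>"
  shows "g \<in> Lp_space 2"
  using Lp_space_2_diff[of f "\<lambda>x. f x - g x"] assms by (auto simp: Lp_space_2_iff)

lemma trunc_Lp_space_2:
  assumes "f \<in> Lp_space 2"
  shows "trunc R f \<in> Lp_space 2"
proof -
  have "L2_sq (trunc R f) \<le> L2_sq f" unfolding L2_sq_def by (intro nn_integral_mono) (simp add: trunc_def)
  then show ?thesis using assms by (auto simp: Lp_space_2_iff intro: le_less_trans)
qed

context
  fixes s :: real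
  assumes s: "s\<^sup>2 = 1"
begin

lemma ft_Lp_space_2:
  assumes "f \<in> Lp_space 2" "integrable lborel f"
  shows "ft s f \<in> Lp_space 2"
  using L2_sq_ft_le[OF assms(2) s] assms(1) by (auto simp: Lp_space_2_iff intro: le_less_trans)

text \<open>Bessel's inequality transfers the convergence of the truncations to their transforms.
  Completeness is stated for sequences, so the limit is found along integer radii and then compared
  with an arbitrary sequence of radii.\<close>

lemma ft_trunc_limit_exists:
  assumes f: "f \<in> Lp_space 2"
  shows "\<exists>g\<in>Lp_space 2. ((\<lambda>R. L2_sq (\<lambda>x. ft s (trunc R f) x - g x)) \<longlongrightarrow> 0) at_top"
proof -
  have [measurable]: "f \<in> borel_measurable borel" using f by (auto simp: Lp_space_2_iff)
  have le: "L2_sq (\<lambda>x. ft s (trunc R f) x - ft s (trunc R' f) x) \<le> 2 * L2_sq (\<lambda>x. trunc R f x - f x) + 2 * L2_sq (\<lambda>x. trunc R' f x - f x)" for R R'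
    by (rule order_trans[OF L2_sq_ft_diff_le[OF integrable_trunc integrable_trunc] L2_sq_diff_le]) (auto simp: f s)
  have lim: "(\<lambda>n. L2_sq (\<lambda>x. trunc (real n) f x - f x)) \<longlonglongrightarrow> 0"
    by (rule filterlim_compose[OF L2_sq_trunc_diff_tendsto[OF f] filterlim_real_sequentially])
  have "\<exists>g\<in>borel_measurable borel. (\<lambda>n. L2_sq (\<lambda>x. ft s (trunc (real n) f) x - g x)) \<longlonglongrightarrow> 0"
  proof (rule L2_sq_complete)
    fix e :: real assume "e > 0"
    then obtain N where N: "\<And>n. n \<ge> N \<Longrightarrow> L2_sq (\<lambda>x. trunc (real n) f x - f x) < ennreal (e / 4)"
      using lim unfolding tendsto_ennreal_0_iff eventually_sequentially by (meson divide_pos_pos zero_less_numeral)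
    have "L2_sq (\<lambda>x. ft s (trunc (real m) f) x - ft s (trunc (real n) f) x) < ennreal e" if "m \<ge> N" "n \<ge> N" for m n
    proof -
      have "2 * L2_sq (\<lambda>x. trunc (real m) f x - f x) + 2 * L2_sq (\<lambda>x. trunc (real n) f x - f x) < 2 * ennreal (e / 4) + 2 * ennreal (e / 4)"
        using N[OF that(1)] N[OF that(2)] by (intro add_strict_mono) (simp_all add: ennreal_mult_strict_left_mono)
      also have "\<dots> = ennreal e"
        using \<open>e > 0\<close> by (simp flip: ennreal_numeral ennreal_mult ennreal_plus)
      finally show ?thesis using le le_less_trans by blast
    qed
    then show "\<exists>N. \<forall>m\<ge>N. \<forall>n\<ge>N. L2_sq (\<lambda>x. ft s (trunc (real m) f) x - ft s (trunc (real n) f) x) < ennreal e" by blast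
  qed measurable
  then obtain g where [measurable]: "g \<in> borel_measurable borel"
    and g: "(\<lambda>n. L2_sq (\<lambda>x. ft s (trunc (real n) f) x - g x)) \<longlonglongrightarrow> 0" by blast
  obtain n where n: "L2_sq (\<lambda>x. ft s (trunc (real n) f) x - g x) < ennreal 1"
    using g unfolding tendsto_ennreal_0_iff eventually_sequentially by (meson order_refl zero_less_one)
  have "ft s (trunc (real n) f) \<in> Lp_space 2" by (intro ft_Lp_space_2 trunc_Lp_space_2 integrable_trunc f)
  then have "g \<in> Lp_space 2"
    by (rule L2_sq_approx_Lp_space_2) (auto intro: less_trans[OF n ennreal_less_top])
  moreover have "((\<lambda>R. L2_sq (\<lambda>x. ft s (trunc R f) x - g x)) \<longlongrightarrow> 0) at_top"
  proof (rule tendsto_at_topI_sequentially)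
    fix X :: "nat \<Rightarrow> real" assume X: "filterlim X at_top sequentially"
    have "(\<lambda>n. L2_sq (\<lambda>x. ft s (trunc (X n) f) x - ft s (trunc (real n) f) x)) \<longlonglongrightarrow> 0"
      by (rule L2_sq_tendsto_0_squeeze[OF filterlim_compose[OF L2_sq_trunc_diff_tendsto[OF f] X] lim le])
    then show "(\<lambda>n. L2_sq (\<lambda>x. ft s (trunc (X n) f) x - g x)) \<longlonglongrightarrow> 0"
    proof (rule L2_sq_tendsto_0_squeeze[OF _ g])
      show "L2_sq (\<lambda>x. ft s (trunc (X n) f) x - g x) \<le> 2 * L2_sq (\<lambda>x. ft s (trunc (X n) f) x - ft s (trunc (real n) f) x) + 2 * L2_sq (\<lambda>x. ft s (trunc (real n) f) x - g x)" for n
        using L2_sq_diff_le[of "ft s (trunc (X n) f)" g "ft s (trunc (real n) f)"] by (simp add: L2_sq_minus_commute[of g])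
    qed
  qed
  ultimately show ?thesis by blast
qed

lemma L2_ft_Lp_space_2: "f \<in> Lp_space 2 \<Longrightarrow> L2_ft s f \<in> Lp_space 2"
  and L2_ft_limit: "f \<in> Lp_space 2 \<Longrightarrow> ((\<lambda>R. L2_sq (\<lambda>x. ft s (trunc R f) x - L2_ft s f x)) \<longlongrightarrow> 0) at_top"
  and L2_ft_unique: "f \<in> Lp_space 2 \<Longrightarrow> g \<in> Lp_space 2 \<Longrightarrow>
     ((\<lambda>R. L2_sq (\<lambda>x. ft s (trunc R f) x - g x)) \<longlongrightarrow> 0) at_top \<Longrightarrow> AE x in lborel. L2_ft s f x = g x"
proof -
  have m: "ft s (trunc R f) \<in> borel_measurable borel" if "f \<in> Lp_space 2" for R f
    using that by (auto simp: Lp_space_2_iff)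
  show "L2_ft s f \<in> Lp_space 2" if f: "f \<in> Lp_space 2"
  proof -
    obtain g where "g \<in> Lp_space 2" "((\<lambda>R. L2_sq (\<lambda>x. ft s (trunc R f) x - g x)) \<longlongrightarrow> 0) at_top"
      using ft_trunc_limit_exists[OF f] by blast
    then show ?thesis unfolding L2_ft_def by (rule L2_lim(1)[OF m[OF f]])
  qed
  show "((\<lambda>R. L2_sq (\<lambda>x. ft s (trunc R f) x - L2_ft s f x)) \<longlongrightarrow> 0) at_top" if f: "f \<in> Lp_space 2"
  proof -
    obtain g where "g \<in> Lp_space 2" "((\<lambda>R. L2_sq (\<lambda>x. ft s (trunc R f) x - g x)) \<longlongrightarrow> 0) at_top"
      using ft_trunc_limit_exists[OF f] by blast
    then show ?thesis unfolding L2_ft_def by (rule L2_lim(2)[OF m[OF f]])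
  qed
  show "AE x in lborel. L2_ft s f x = g x" if f: "f \<in> Lp_space 2" "g \<in> Lp_space 2"
     "((\<lambda>R. L2_sq (\<lambda>x. ft s (trunc R f) x - g x)) \<longlongrightarrow> 0) at_top"
    using f(2,3) unfolding L2_ft_def by (rule L2_lim(3)[OF m[OF f(1)]])
qed

lemma measurable_L2_ft: "f \<in> Lp_space 2 \<Longrightarrow> L2_ft s f \<in> borel_measurable borel"
  using L2_ft_Lp_space_2 by (auto simp: Lp_space_2_iff)

text \<open>On the intersection of L^1 and L^2 the limit in the mean is the absolutely convergent
  integral. This is the bridge from the abstract operators to pointwise kernel bounds.\<close>

lemma L2_ft_eq_ft:
  assumes f: "f \<in> Lp_space 2" "integrable lborel f"
  shows "AE x in lborel. L2_ft s f x = ft s f x"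
proof (rule L2_ft_unique[OF f(1) ft_Lp_space_2[OF f]])
  show "((\<lambda>R. L2_sq (\<lambda>x. ft s (trunc R f) x - ft s f x)) \<longlongrightarrow> 0) at_top"
    by (rule tendsto_sandwich[OF _ _ tendsto_const L2_sq_trunc_diff_tendsto[OF f(1)]])
      (auto intro!: always_eventually L2_sq_ft_diff_le integrable_trunc f s)
qed

text \<open>The constant 4 is the triangle inequality with factor 2 applied twice, around Bessel's
  inequality for the truncations; the other terms vanish as \<open>R\<close> grows.\<close>

lemma L2_sq_L2_ft_diff_le:
  assumes f: "f \<in> Lp_space 2" and g: "g \<in> Lp_space 2"
  shows "L2_sq (\<lambda>x. L2_ft s f x - L2_ft s g x) \<le> 4 * L2_sq (\<lambda>x. f x - g x)"
proof -
  have [measurable]: "f \<in> borel_measurable borel" "g \<in> borel_measurable borel"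
    "L2_ft s f \<in> borel_measurable borel" "L2_ft s g \<in> borel_measurable borel"
    using f g measurable_L2_ft by (auto simp: Lp_space_2_iff)
  have "L2_sq (\<lambda>x. L2_ft s f x - L2_ft s g x) \<le> 2 * L2_sq (\<lambda>x. ft s (trunc R f) x - L2_ft s f x)
     + 2 * (2 * L2_sq (\<lambda>x. f x - g x) + 2 * L2_sq (\<lambda>x. ft s (trunc R g) x - L2_ft s g x))" for R
  proof -
    have 1: "L2_sq (\<lambda>x. L2_ft s f x - L2_ft s g x) \<le> 2 * L2_sq (\<lambda>x. L2_ft s f x - ft s (trunc R f) x) + 2 * L2_sq (\<lambda>x. L2_ft s g x - ft s (trunc R f) x)"
      by (rule L2_sq_diff_le) measurable
    have 2: "L2_sq (\<lambda>x. L2_ft s g x - ft s (trunc R f) x) \<le> 2 * L2_sq (\<lambda>x. ft s (trunc R f) x - ft s (trunc R g) x) + 2 * L2_sq (\<lambda>x. L2_ft s g x - ft s (trunc R g) x)"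
      using L2_sq_diff_le[of "L2_ft s g" "ft s (trunc R f)" "ft s (trunc R g)"] by (simp add: add.commute)
    have "L2_sq (\<lambda>x. ft s (trunc R f) x - ft s (trunc R g) x) \<le> L2_sq (\<lambda>x. trunc R f x - trunc R g x)"
      by (intro L2_sq_ft_diff_le integrable_trunc f g s)
    also have "\<dots> \<le> L2_sq (\<lambda>x. f x - g x)"
      unfolding L2_sq_def by (intro nn_integral_mono) (simp add: trunc_def)
    finally have 3: "L2_sq (\<lambda>x. ft s (trunc R f) x - ft s (trunc R g) x) \<le> L2_sq (\<lambda>x. f x - g x)" .
    have 4: "L2_sq (\<lambda>x. L2_ft s f x - ft s (trunc R f) x) = L2_sq (\<lambda>x. ft s (trunc R f) x - L2_ft s f x)"
      and 5: "L2_sq (\<lambda>x. L2_ft s g x - ft s (trunc R g) x) = L2_sq (\<lambda>x. ft s (trunc R g) x - L2_ft s g x)"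
      by (rule L2_sq_minus_commute)+
    show ?thesis by (rule order_trans[OF 1[unfolded 4] add_left_mono[OF mult_left_mono[OF
            order_trans[OF 2[unfolded 5] add_right_mono[OF mult_left_mono[OF 3]]]]]]) auto
  qed
  moreover have "((\<lambda>R. 2 * L2_sq (\<lambda>x. ft s (trunc R f) x - L2_ft s f x)
     + 2 * (2 * L2_sq (\<lambda>x. f x - g x) + 2 * L2_sq (\<lambda>x. ft s (trunc R g) x - L2_ft s g x))) \<longlongrightarrow> 2 * 0 + 2 * (2 * L2_sq (\<lambda>x. f x - g x) + 2 * 0)) at_top"
    by (intro tendsto_add ennreal_tendsto_cmult L2_ft_limit f g tendsto_const) auto
  ultimately have "L2_sq (\<lambda>x. L2_ft s f x - L2_ft s g x) \<le> 2 * 0 + 2 * (2 * L2_sq (\<lambda>x. f x - g x) + 2 * 0)"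
    by (intro tendsto_lowerbound[where F=at_top]) (auto intro!: always_eventually)
  then show ?thesis by (simp add: mult.assoc[symmetric])
qed

lemma L2_ft_cong_AE:
  assumes f: "f \<in> Lp_space 2" and g: "g \<in> Lp_space 2" and "AE x in lborel. f x = g x"
  shows "AE x in lborel. L2_ft s f x = L2_ft s g x"
proof -
  have [measurable]: "L2_ft s f \<in> borel_measurable borel" "L2_ft s g \<in> borel_measurable borel"
    using f g measurable_L2_ft by auto
  have "L2_sq (\<lambda>x. f x - g x) = L2_sq (\<lambda>_::'a::euclidean_space. 0)"
    by (rule L2_sq_cong_AE) (use assms(3) in auto)
  then have "L2_sq (\<lambda>x. L2_ft s f x - L2_ft s g x) = 0"
    using L2_sq_L2_ft_diff_le[OF f g] by (simp add: L2_sq_def)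
  then show ?thesis by (subst (asm) L2_sq_eq_0_iff) auto
qed

end

section \<open>Fourier inversion on $L^2$\<close>

lemma Lp_space_2_integrable_mult:
  fixes f g :: "'a::euclidean_space \<Rightarrow> complex"
  assumes f: "f \<in> Lp_space 2" and g: "g \<in> Lp_space 2"
  shows "integrable lborel (\<lambda>x. f x * g x)"
proof (rule Bochner_Integration.integrable_bound)
  show "integrable lborel (\<lambda>x. (norm (f x))\<^sup>2 + (norm (g x))\<^sup>2)"
    by (intro Bochner_Integration.integrable_add Lp_space_2_integrable_sq f g)
  have "a * b \<le> a\<^sup>2 + b\<^sup>2" if "0 \<le> a" "0 \<le> b" for a b :: real
    using sum_squares_bound[of a b] that mult_nonneg_nonneg[OF that] by linarith
  then show "AE x in lborel. norm (f x * g x) \<le> norm ((norm (f x))\<^sup>2 + (norm (g x))\<^sup>2)"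
    by (intro AE_I2) (simp add: norm_mult)
  show "(\<lambda>x. f x * g x) \<in> borel_measurable lborel" using f g by (auto simp: Lp_space_2_iff)
qed

lemma norm_integral_mult_le:
  fixes f g :: "'a::euclidean_space \<Rightarrow> complex"
  assumes f: "f \<in> Lp_space 2" and g: "g \<in> Lp_space 2"
  shows "ennreal ((norm (LBINT x. f x * g x))\<^sup>2) \<le> L2_sq f * L2_sq g"
proof -
  have [measurable]: "f \<in> borel_measurable borel" "g \<in> borel_measurable borel"
    using f g by (auto simp: Lp_space_2_iff)
  have "ennreal (norm (LBINT x. f x * g x)) \<le> (\<integral>\<^sup>+x. ennreal (norm (f x * g x)) \<partial>lborel)"
    by (rule integral_norm_bound_ennreal[OF Lp_space_2_integrable_mult[OF f g]])
  also have "\<dots> = (\<integral>\<^sup>+x. ennreal (norm (f x)) * ennreal (norm (g x)) \<partial>lborel)"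
    by (simp add: norm_mult ennreal_mult)
  finally have "(ennreal (norm (LBINT x. f x * g x)))\<^sup>2 \<le> (\<integral>\<^sup>+x. ennreal (norm (f x)) * ennreal (norm (g x)) \<partial>lborel)\<^sup>2"
    by (rule power_mono) simp
  also have "\<dots> \<le> (\<integral>\<^sup>+x. ennreal (norm (f x)) ^ 2 \<partial>lborel) * (\<integral>\<^sup>+x. ennreal (norm (g x)) ^ 2 \<partial>lborel)"
    by (rule Cauchy_Schwarz_nn_integral) measurable
  finally show ?thesis by (simp add: L2_sq_def ennreal_power)
qed

text \<open>The formula for truncations passes to the limit, since by Cauchy-Schwarz both sides are
  continuous in \<open>f\<close> with respect to the L^2 distance. The defect \<open>D\<close> does
  not depend on \<open>R\<close> and is bounded by a quantity that tends to 0.\<close>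

lemma L2_ft_multiplication:
  fixes f w :: "'a::euclidean_space \<Rightarrow> complex"
  assumes s: "s\<^sup>2 = 1" and f: "f \<in> Lp_space 2" and w: "w \<in> Lp_space 2" "integrable lborel w"
  shows "(LBINT \<xi>. L2_ft s f \<xi> * w \<xi>) = (LBINT x. f x * ft s w x)"
proof -
  define D where "D = (LBINT \<xi>. L2_ft s f \<xi> * w \<xi>) - (LBINT x. f x * ft s w x)"
  have fw: "ft s w \<in> Lp_space 2" by (rule ft_Lp_space_2[OF s w])
  have Ff: "L2_ft s f \<in> Lp_space 2" by (rule L2_ft_Lp_space_2[OF s f])
  have le: "ennreal ((norm D)\<^sup>2) \<le> 2 * (L2_sq w * L2_sq (\<lambda>x. ft s (trunc R f) x - L2_ft s f x)) + 2 * (L2_sq (ft s w) * L2_sq (\<lambda>x. trunc R f x - f x))" for R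
  proof -
    have t: "trunc R f \<in> Lp_space 2" by (rule trunc_Lp_space_2[OF f])
    have ft: "ft s (trunc R f) \<in> Lp_space 2" by (intro ft_Lp_space_2[OF s] t integrable_trunc f)
    let ?a = "\<integral>x. (ft s (trunc R f) x - L2_ft s f x) * w x \<partial>lborel" and ?b = "\<integral>x. (trunc R f x - f x) * ft s w x \<partial>lborel"
    have "?b - ?a = D" unfolding D_def using ft_multiplication[OF integrable_trunc[OF f] w(2), of s R]
      by (simp add: left_diff_distrib Bochner_Integration.integral_diff Lp_space_2_integrable_mult t f fw ft Ff w)
    then have "norm D \<le> norm ?a + norm ?b" using norm_triangle_ineq4[of ?b ?a] by simp
    then have "(norm D)\<^sup>2 \<le> (norm ?a + norm ?b)\<^sup>2" by (intro power_mono) auto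
    also have "\<dots> \<le> 2 * (norm ?a)\<^sup>2 + 2 * (norm ?b)\<^sup>2"
      using sum_squares_bound[of "norm ?a" "norm ?b"] by (simp add: power2_sum)
    finally have "ennreal ((norm D)\<^sup>2) \<le> ennreal (2 * (norm ?a)\<^sup>2 + 2 * (norm ?b)\<^sup>2)"
      by (rule ennreal_leI)
    also have "\<dots> = 2 * ennreal ((norm ?a)\<^sup>2) + 2 * ennreal ((norm ?b)\<^sup>2)"
      by (simp add: ennreal_mult)
    also have "\<dots> \<le> 2 * (L2_sq w * L2_sq (\<lambda>x. ft s (trunc R f) x - L2_ft s f x)) + 2 * (L2_sq (ft s w) * L2_sq (\<lambda>x. trunc R f x - f x))"
      unfolding mult.commute[of "L2_sq w"] mult.commute[of "L2_sq (ft s w)"]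
      by (intro add_mono mult_left_mono norm_integral_mult_le Lp_space_2_diff ft t f fw Ff w) auto
    finally show ?thesis .
  qed
  have "((\<lambda>R. 2 * (L2_sq w * L2_sq (\<lambda>x. ft s (trunc R f) x - L2_ft s f x)) + 2 * (L2_sq (ft s w) * L2_sq (\<lambda>x. trunc R f x - f x)))
     \<longlongrightarrow> 2 * (L2_sq w * 0) + 2 * (L2_sq (ft s w) * 0)) at_top"
    using w fw by (intro tendsto_add ennreal_tendsto_cmult L2_ft_limit[OF s] L2_sq_trunc_diff_tendsto f tendsto_const)
      (auto simp: Lp_space_2_iff)
  then have "ennreal ((norm D)\<^sup>2) \<le> 2 * (L2_sq w * 0) + 2 * (L2_sq (ft s w) * 0)"
    by (rule tendsto_lowerbound) (auto intro!: always_eventually le)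
  then have "D = 0" by (simp add: ennreal_eq_0_iff)
  then show ?thesis by (simp add: D_def)
qed

text \<open>Boxes are stable under intersection and generate the Borel sets, so a Dynkin argument
  extends the vanishing from boxes to all Borel sets, and a density with vanishing integrals is 0.
  The complement step uses the integral over the whole space, which is exhausted by boxes.\<close>

lemma integral_eq_0_on_boxes_imp_AE_0:
  fixes K :: "'a::euclidean_space \<Rightarrow> complex"
  assumes K: "integrable lborel K" and box: "\<And>a b. (LBINT x. indicator (box a b) x *\<^sub>R K x) = 0"
  shows "AE x in lborel. K x = 0"
proof (rule sigma_finite_measure.density_zero[OF sigma_finite_lborel K])
  have [measurable]: "K \<in> borel_measurable borel" using K by auto
  have int: "integrable lborel (\<lambda>x. indicator A x *\<^sub>R K x)" if "A \<in> sets borel" for A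
    using that K by (intro integrable_mult_indicator) auto
  have UNIV: "(LBINT x. K x) = 0"
  proof -
    have "(\<lambda>n. \<integral>x. indicator (box (- (real n *\<^sub>R One)) (real n *\<^sub>R One)) x *\<^sub>R K x \<partial>lborel) \<longlonglongrightarrow> (LBINT x. K x)"
    proof (rule integral_dominated_convergence[where w="\<lambda>x. norm (K x)"])
      show "AE x in lborel. (\<lambda>n. indicator (box (- (real n *\<^sub>R One)) (real n *\<^sub>R One)) x *\<^sub>R K x) \<longlonglongrightarrow> K x"
      proof (rule AE_I2)
        fix x :: 'a
        have "\<forall>\<^sub>F n in sequentially. norm x < real n"
          using filterlim_real_sequentially by (simp add: filterlim_at_top_dense)
        then have "\<forall>\<^sub>F n in sequentially. indicator (box (- (real n *\<^sub>R One)) (real n *\<^sub>R One)) x *\<^sub>R K x = K x"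
        proof eventually_elim
          case (elim n)
          have "x \<in> box (- (real n *\<^sub>R One)) (real n *\<^sub>R One)" unfolding mem_box
          proof
            fix i :: 'a assume i: "i \<in> Basis"
            show "- (real n *\<^sub>R One) \<bullet> i < x \<bullet> i \<and> x \<bullet> i < (real n *\<^sub>R One) \<bullet> i"
              using Basis_le_norm[OF i, of x] elim i by (auto simp: inner_sum_left_Basis)
          qed
          then show ?case by simp
        qed
        then show "(\<lambda>n. indicator (box (- (real n *\<^sub>R One)) (real n *\<^sub>R One)) x *\<^sub>R K x) \<longlonglongrightarrow> K x"
          by (rule tendsto_eventually)
      qed
    qed (use K in \<open>auto simp: indicator_def\<close>)
    then show ?thesis unfolding box by (simp add: LIMSEQ_const_iff)
  qed
  fix A :: "'a set" assume A: "A \<in> sets lborel"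
  have "Int_stable (range (\<lambda>(a, b). box a b :: 'a set))" by (auto simp: Int_stable_def box_Int_box)
  moreover have "range (\<lambda>(a, b). box a b :: 'a set) \<subseteq> Pow UNIV" by auto
  moreover have "A \<in> sigma_sets UNIV (range (\<lambda>(a, b). box a b))"
    using A unfolding sets_lborel borel_eq_box by simp
  ultimately have "(LBINT x. indicator A x *\<^sub>R K x) = 0"
  proof (induction rule: sigma_sets_induct_disjoint)
    case (compl A)
    then have A: "A \<in> sets borel" by (simp add: borel_eq_box)
    have "(LBINT x. indicator (UNIV - A) x *\<^sub>R K x) = (LBINT x. K x - indicator A x *\<^sub>R K x)"
      by (intro Bochner_Integration.integral_cong) (auto simp: indicator_def)
    also have "\<dots> = 0"
      using compl.IH UNIV by (subst Bochner_Integration.integral_diff[OF K int[OF A]]) simp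
    finally show ?case .
  next
    case (union F)
    then have F: "F i \<in> sets borel" for i by (auto simp: borel_eq_box subset_eq)
    then have "set_integrable lborel (\<Union>i. F i) K" unfolding set_integrable_def by (intro int) auto
    with union.hyps F have "(LINT x:(\<Union>i. F i)|lborel. K x) = (\<Sum>i. (LINT x:(F i)|lborel. K x))"
      by (intro lebesgue_integral_countable_add) (auto simp: disjoint_family_on_def)
    then show ?case using union.IH by (simp add: set_lebesgue_integral_def)
  qed (auto simp: box)
  then show "set_lebesgue_integral lborel A K = 0" by (simp add: set_lebesgue_integral_def)
qed

text \<open>Dominated convergence. The boundary of the box is excluded because the averages may have
  another limit there; it is a null set, so the limit still holds almost everywhere.\<close>

lemma gaussian_average_box_tendsto:
  fixes y :: "'a::euclidean_space"
  assumes y: "y \<notin> cbox p q - box p q"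
  shows "(\<lambda>n. \<integral>z. indicator (box p q) (y + (1 / real (Suc n)) *\<^sub>R z) *
      ((1 / sqrt (2 * pi)) ^ DIM('a) * exp (- (norm z)\<^sup>2 / 2)) \<partial>lborel) \<longlonglongrightarrow> indicator (box p q) y"
proof -
  define \<gamma> where "\<gamma> = (\<lambda>z::'a. (1 / sqrt (2 * pi)) ^ DIM('a) * exp (- (norm z)\<^sup>2 / 2))"
  have \<gamma>: "integrable lborel \<gamma>"
    unfolding \<gamma>_def using integrable_gaussian[of 1, where 'a='a] by (intro integrable_mult_right) simp
  have \<gamma>1: "(LBINT z. \<gamma> z) = 1"
    unfolding \<gamma>_def using integral_gaussian[of 1, where 'a='a] by (simp add: power_divide)
  have "(\<lambda>n. \<integral>z. indicator (box p q) (y + (1 / real (Suc n)) *\<^sub>R z) * \<gamma> z \<partial>lborel) \<longlonglongrightarrow> (LBINT z. indicator (box p q) y * \<gamma> z)"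
  proof (rule integral_dominated_convergence[where w=\<gamma>])
    show "AE z in lborel. (\<lambda>n. indicator (box p q) (y + (1 / real (Suc n)) *\<^sub>R z) * \<gamma> z) \<longlonglongrightarrow> indicator (box p q) y * \<gamma> z"
    proof (rule AE_I2)
      fix z :: 'a
      have "(\<lambda>n. 1 / real (Suc n)) \<longlonglongrightarrow> 0" by (rule LIMSEQ_Suc[OF lim_1_over_n])
      then have "(\<lambda>n. y + (1 / real (Suc n)) *\<^sub>R z) \<longlonglongrightarrow> y + 0 *\<^sub>R z"
        by (intro tendsto_intros)
      then have lim: "(\<lambda>n. y + (1 / real (Suc n)) *\<^sub>R z) \<longlonglongrightarrow> y" by simp
      have "\<forall>\<^sub>F n in sequentially. indicator (box p q) (y + (1 / real (Suc n)) *\<^sub>R z) = (indicator (box p q) y :: real)"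
      proof (cases "y \<in> box p q")
        case True
        then show ?thesis using topological_tendstoD[OF lim open_box True] by (auto elim!: eventually_mono)
      next
        case False
        with y have "y \<in> - cbox p q" by auto
        then have "\<forall>\<^sub>F n in sequentially. y + (1 / real (Suc n)) *\<^sub>R z \<in> - cbox p q"
          by (intro topological_tendstoD[OF lim]) (auto intro: closed_cbox)
        then show ?thesis
        proof eventually_elim
          case (elim n)
          then have "y + (1 / real (Suc n)) *\<^sub>R z \<notin> box p q" using box_subset_cbox by blast
          then show ?case using False by simp
        qed
      qed
      then show "(\<lambda>n. indicator (box p q) (y + (1 / real (Suc n)) *\<^sub>R z) * \<gamma> z) \<longlonglongrightarrow> indicator (box p q) y * \<gamma> z"
        by (intro tendsto_mult tendsto_const tendsto_eventually)
    qed
    show "AE z in lborel. norm (indicator (box p q) (y + (1 / real (Suc n)) *\<^sub>R z) * \<gamma> z) \<le> \<gamma> z" for n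
      by (intro AE_I2) (simp add: \<gamma>_def indicator_def)
    show "(\<lambda>z. indicator (box p q) (y + (1 / real (Suc n)) *\<^sub>R z) * \<gamma> z) \<in> borel_measurable lborel" for n
      unfolding \<gamma>_def by measurable
    show "(\<lambda>z. indicator (box p q) y * \<gamma> z) \<in> borel_measurable lborel"
      unfolding \<gamma>_def by measurable
  qed (rule \<gamma>)
  moreover have "(LBINT z. indicator (box p q) y * \<gamma> z) = indicator (box p q) y"
    by (simp add: \<gamma>1)
  ultimately show ?thesis unfolding \<gamma>_def by (simp only:)
qed

text \<open>Fubini's theorem carries orthogonality from Gaussians to their averages over a box, that
  is, to the indicator of the box mollified at scale \<delta>. As \<delta> tends to 0 the mollified
  indicators recover the box.\<close>

lemma gaussian_orthogonal_imp_AE_0: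
  fixes K :: "'a::euclidean_space \<Rightarrow> complex"
  assumes K: "integrable lborel K"
    and orth: "\<And>a \<sigma>. \<sigma> > 0 \<Longrightarrow> (LBINT y. K y * of_real (exp (- (norm (y - a))\<^sup>2 / (2 * \<sigma>)))) = 0"
  shows "AE x in lborel. K x = 0"
proof (rule integral_eq_0_on_boxes_imp_AE_0[OF K])
  fix p q :: 'a
  have [measurable]: "K \<in> borel_measurable borel" using K by auto
  define \<gamma> where "\<gamma> = (\<lambda>z::'a. (1 / sqrt (2 * pi)) ^ DIM('a) * exp (- (norm z)\<^sup>2 / 2))"
  have [measurable]: "\<gamma> \<in> borel_measurable borel" unfolding \<gamma>_def by measurable
  have \<gamma>0: "\<gamma> z \<ge> 0" for z by (simp add: \<gamma>_def)
  have \<gamma>: "integrable lborel \<gamma>"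
    unfolding \<gamma>_def using integrable_gaussian[of 1, where 'a='a] by (intro integrable_mult_right) simp
  have \<gamma>1: "(LBINT z. \<gamma> z) = 1"
    unfolding \<gamma>_def using integral_gaussian[of 1, where 'a='a] by (simp add: power_divide)
  \<comment> \<open>\<open>T \<delta>\<close> is the mollified indicator, written with the Gaussian
    at unit scale so that its bound by 1 and its limit are immediate. The substitution
    \<open>a = y + \<delta> z\<close> in \<open>T_eq\<close> brings back Gaussians centred at
    \<open>a\<close>.\<close>
  define T where "T \<delta> y = (LBINT z. indicator (box p q) (y + \<delta> *\<^sub>R z) * \<gamma> z)" for \<delta> y
  have T_abs: "norm (T \<delta> y) \<le> 1" for \<delta> y
  proof -
    have "norm (T \<delta> y) \<le> (LBINT z. norm (indicator (box p q) (y + \<delta> *\<^sub>R z) * \<gamma> z))"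
      unfolding T_def by (rule integral_norm_bound)
    also have "\<dots> \<le> (LBINT z. \<gamma> z)"
      by (rule integral_mono'[OF \<gamma>]) (auto simp: \<gamma>0 indicator_def)
    finally show ?thesis by (simp add: \<gamma>1)
  qed
  have [measurable]: "T \<delta> \<in> borel_measurable borel" for \<delta>
    unfolding T_def[abs_def] by measurable
  have zero: "(LBINT y. K y * of_real (T \<delta> y)) = 0" if \<delta>: "\<delta> > 0" for \<delta>
  proof -
    let ?h = "\<lambda>(y, z). K y * of_real (indicator (box p q) (y + \<delta> *\<^sub>R z) * \<gamma> z)"
    define c where "c = complex_of_real (\<bar>1 / \<delta>\<bar> ^ DIM('a) * (1 / sqrt (2 * pi)) ^ DIM('a))"
    let ?g = "\<lambda>(y, a). K y * of_real (exp (- (norm (y - a))\<^sup>2 / (2 * \<delta>\<^sup>2))) * (of_real (indicator (box p q) a) * c)"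
    have T_eq: "complex_of_real (T \<delta> y) = (LBINT a. of_real (exp (- (norm (y - a))\<^sup>2 / (2 * \<delta>\<^sup>2))) * (of_real (indicator (box p q) a) * c))" for y
    proof -
      have "(LBINT a. of_real (exp (- (norm (y - a))\<^sup>2 / (2 * \<delta>\<^sup>2))) * (of_real (indicator (box p q) a) * c))
        = \<bar>\<delta>\<bar> ^ DIM('a) *\<^sub>R (LBINT z. of_real (exp (- (norm (y - (y + \<delta> *\<^sub>R z)))\<^sup>2 / (2 * \<delta>\<^sup>2))) * (of_real (indicator (box p q) (y + \<delta> *\<^sub>R z)) * c))"
        using \<delta> by (intro integral_lborel_affine) auto
      also have "\<dots> = (LBINT z. of_real (indicator (box p q) (y + \<delta> *\<^sub>R z) * \<gamma> z))"
        unfolding integral_scaleR_right[symmetric]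
      proof (rule Bochner_Integration.integral_cong[OF refl])
        fix z :: 'a
        have alg: "A * (E * (I * (B * C))) = I * (C * E)" if "A * B = 1" for A B C E I :: real
        proof -
          have "A * (E * (I * (B * C))) = (A * B) * (I * (C * E))" by (simp only: mult_ac)
          then show ?thesis by (simp add: that)
        qed
        have 1: "\<bar>\<delta>\<bar> ^ DIM('a) * \<bar>1 / \<delta>\<bar> ^ DIM('a) = 1"
          using \<delta> by (simp flip: power_mult_distrib)
        have 2: "- (norm (y - (y + \<delta> *\<^sub>R z)))\<^sup>2 / (2 * \<delta>\<^sup>2) = - (norm z)\<^sup>2 / 2"
          using \<delta> by (simp add: power_mult_distrib)
        show "\<bar>\<delta>\<bar> ^ DIM('a) *\<^sub>R (complex_of_real (exp (- (norm (y - (y + \<delta> *\<^sub>R z)))\<^sup>2 / (2 * \<delta>\<^sup>2))) * (of_real (indicator (box p q) (y + \<delta> *\<^sub>R z)) * c))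
          = of_real (indicator (box p q) (y + \<delta> *\<^sub>R z) * \<gamma> z)"
          unfolding c_def \<gamma>_def scaleR_conv_of_real of_real_mult[symmetric] of_real_eq_iff 2
          by (rule alg[OF 1])
      qed
      also have "\<dots> = of_real (T \<delta> y)" unfolding T_def by (rule integral_complex_of_real)
      finally show ?thesis by simp
    qed
    have int_a: "integrable lborel (\<lambda>a. complex_of_real (exp (- (norm (y - a))\<^sup>2 / (2 * \<delta>\<^sup>2))) * (of_real (indicator (box p q) a) * c))" for y
    proof (rule Bochner_Integration.integrable_bound)
      have "integrable lborel (indicator (box p q) :: 'a \<Rightarrow> real)"
        using emeasure_lborel_box_finite[of p q] by (intro integrable_real_indicator) auto
      then show "integrable lborel (\<lambda>a. indicator (box p q) a * norm c)" by (rule integrable_mult_left)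
      show "AE a in lborel. norm (complex_of_real (exp (- (norm (y - a))\<^sup>2 / (2 * \<delta>\<^sup>2))) * (of_real (indicator (box p q) a) * c)) \<le> norm (indicator (box p q) a * norm c)"
        by (intro AE_I2) (auto simp: norm_mult indicator_def mult_left_le_one_le)
    qed measurable
    have c_norm: "complex_of_real (norm c) = c" unfolding c_def norm_of_real by (subst abs_of_nonneg) auto
    have int: "integrable (lborel \<Otimes>\<^sub>M lborel) ?g"
    proof (rule lborel_pair.Fubini_integrable)
      show "?g \<in> borel_measurable (lborel \<Otimes>\<^sub>M lborel)" by measurable
      show "AE x in lborel. integrable lborel (\<lambda>y. ?g (x, y))"
        using int_a by (intro AE_I2) (simp add: mult.assoc)
      have eq: "(LBINT a. norm (?g (y, a))) = norm (K y) * T \<delta> y" for y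
      proof -
        have "complex_of_real (LBINT a. norm (?g (y, a))) = (LBINT a. of_real (norm (K y)) * (complex_of_real (exp (- (norm (y - a))\<^sup>2 / (2 * \<delta>\<^sup>2))) * (of_real (indicator (box p q) a) * c)))"
          unfolding integral_complex_of_real[symmetric]
          by (intro Bochner_Integration.integral_cong) (auto simp: norm_mult indicator_def c_norm)
        also have "\<dots> = of_real (norm (K y)) * of_real (T \<delta> y)"
          unfolding T_eq by (rule integral_mult_right_zero)
        finally show ?thesis by (simp only: of_real_mult[symmetric] of_real_eq_iff)
      qed
      show "integrable lborel (\<lambda>x. \<integral>y. norm (?g (x, y)) \<partial>lborel)" unfolding eq
      proof (rule Bochner_Integration.integrable_bound)
        show "AE x in lborel. norm (norm (K x) * T \<delta> x) \<le> norm (norm (K x))"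
          using T_abs by (intro AE_I2) (auto simp: abs_mult mult_left_le)
      qed (use K in auto)
    qed
    have "(LBINT y. K y * of_real (T \<delta> y)) = (LBINT y. \<integral>a. ?g (y, a) \<partial>lborel)"
      unfolding T_eq by (simp add: mult.assoc)
    also have "\<dots> = (LBINT a. \<integral>y. ?g (y, a) \<partial>lborel)"
      using lborel_pair.Fubini_integral[of "\<lambda>y a. ?g (y, a)"] int by simp
    also have "\<dots> = (LBINT a. (LBINT y. K y * of_real (exp (- (norm (y - a))\<^sup>2 / (2 * \<delta>\<^sup>2)))) * (of_real (indicator (box p q) a) * c))"
      by simp
    also have "\<dots> = 0" using \<delta> by (subst orth) auto
    finally show ?thesis .
  qed
  have "(\<lambda>n. \<integral>y. K y * of_real (T (1 / real (Suc n)) y) \<partial>lborel) \<longlonglongrightarrow> (LBINT y. K y * of_real (indicator (box p q) y))"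
  proof (rule integral_dominated_convergence[where w="\<lambda>x. norm (K x)"])
    have "AE y in lborel. y \<notin> cbox p q - box p q" by (rule AE_not_in[OF null_sets_cbox_Diff_box])
    then show "AE y in lborel. (\<lambda>n. K y * of_real (T (1 / real (Suc n)) y)) \<longlonglongrightarrow> K y * of_real (indicator (box p q) y)"
    proof eventually_elim
      case (elim y)
      then have "(\<lambda>n. T (1 / real (Suc n)) y) \<longlonglongrightarrow> indicator (box p q) y"
        unfolding T_def \<gamma>_def by (rule gaussian_average_box_tendsto)
      then show ?case by (intro tendsto_intros)
    qed
    show "AE x in lborel. norm (K x * of_real (T (1 / real (Suc n)) x)) \<le> norm (K x)" for n
      using T_abs by (intro AE_I2) (auto simp: norm_mult mult_left_le)
  qed (use K in auto)
  then have "(LBINT y. K y * of_real (indicator (box p q) y)) = 0" by (simp add: zero LIMSEQ_const_iff)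
  then show "(LBINT x. indicator (box p q) x *\<^sub>R K x) = 0"
    by (simp add: scaleR_conv_of_real mult.commute)
qed

lemma modulated_gaussian_Lp:
  fixes a :: "'a::euclidean_space"
  assumes \<sigma>: "\<sigma> > 0"
  shows "(\<lambda>x. C * (cis (x \<bullet> a) * of_real (exp (- (\<sigma> * (norm x)\<^sup>2 / 2))))) \<in> Lp_space 2" (is "?g \<in> _")
    and "integrable lborel (\<lambda>x. C * (cis (x \<bullet> a) * of_real (exp (- (\<sigma> * (norm x)\<^sup>2 / 2)))))"
proof -
  have m: "?g \<in> borel_measurable borel" by measurable
  show "integrable lborel ?g"
    by (intro integrable_mult_right integrable_cis_mult integrable_of_real integrable_gaussian \<sigma>) measurable
  have "(norm (?g x))\<^sup>2 = (norm C)\<^sup>2 * exp (- ((2 * \<sigma>) * (norm x)\<^sup>2 / 2))" for x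
    by (simp add: norm_mult power_mult_distrib exp_double[symmetric])
  moreover have "integrable lborel (\<lambda>x::'a. (norm C)\<^sup>2 * exp (- ((2 * \<sigma>) * (norm x)\<^sup>2 / 2)))"
    using \<sigma> by (intro integrable_mult_right integrable_gaussian) simp
  ultimately have "integrable lborel (\<lambda>x. (norm (?g x))\<^sup>2)" by simp
  then have "L2_sq ?g < \<infinity>" unfolding L2_sq_def integrable_iff_bounded by simp
  with m show "?g \<in> Lp_space 2" by (simp add: Lp_space_2_iff)
qed

lemma ft_gaussian_translate:
  fixes a \<xi> :: "'a::euclidean_space"
  assumes \<sigma>: "\<sigma> > 0" and t: "t\<^sup>2 = 1"
  shows "ft t (\<lambda>y. of_real (exp (- (norm (y - a))\<^sup>2 / (2 * \<sigma>)))) \<xi>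
    = of_real (sqrt \<sigma> ^ DIM('a)) * (cis (\<xi> \<bullet> (t *\<^sub>R a)) * of_real (exp (- (\<sigma> * (norm \<xi>)\<^sup>2 / 2))))"
proof -
  have "(LBINT x. cis (t * (x \<bullet> \<xi>)) * of_real (exp (- (norm (x - a))\<^sup>2 / (2 * \<sigma>))))
     = \<bar>1\<bar> ^ DIM('a) *\<^sub>R (LBINT x. cis (t * ((a + 1 *\<^sub>R x) \<bullet> \<xi>)) * of_real (exp (- (norm ((a + 1 *\<^sub>R x) - a))\<^sup>2 / (2 * \<sigma>))))"
    by (intro integral_lborel_affine) auto
  also have "\<dots> = (LBINT x. cis (\<xi> \<bullet> (t *\<^sub>R a)) * (cis (x \<bullet> (t *\<^sub>R \<xi>)) * of_real (exp (- (1 / \<sigma>) * (norm x)\<^sup>2 / 2))))"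
    by (simp add: mult.assoc[symmetric] cis_mult inner_add_left distrib_left inner_commute[of \<xi> a] mult.commute[of \<sigma> 2])
  also have "\<dots> = cis (\<xi> \<bullet> (t *\<^sub>R a)) * of_real (sqrt (2 * pi / (1 / \<sigma>)) ^ DIM('a) * exp (- (norm (t *\<^sub>R \<xi>))\<^sup>2 / (2 * (1 / \<sigma>))))"
    unfolding integral_mult_right_zero using \<sigma> by (subst integral_cis_gaussian) auto
  also have "sqrt (2 * pi / (1 / \<sigma>)) ^ DIM('a) * exp (- (norm (t *\<^sub>R \<xi>))\<^sup>2 / (2 * (1 / \<sigma>)))
     = sqrt (2 * pi) ^ DIM('a) * (sqrt \<sigma> ^ DIM('a) * exp (- (\<sigma> * (norm \<xi>)\<^sup>2 / 2)))"
    using t by (simp add: power_mult_distrib real_sqrt_mult)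
  finally show ?thesis by (simp add: ft_def ft_const_eq mult_ac)
qed

text \<open>Completing the square: the product of two Gaussians is, up to a factor free of
  \<open>y\<close>, a Gaussian with centre \<open>a / (1 + \<sigma>)\<close> and variance
  \<open>\<sigma> / (1 + \<sigma>)\<close>.\<close>

lemma gaussian_product:
  fixes y a :: "'a::real_inner"
  assumes "\<sigma> > 0"
  shows "(norm y)\<^sup>2 / 2 + (norm (y - a))\<^sup>2 / (2 * \<sigma>)
    = (norm (y - (1 / (1 + \<sigma>)) *\<^sub>R a))\<^sup>2 / (2 * (\<sigma> / (1 + \<sigma>))) + (norm a)\<^sup>2 / (2 * (1 + \<sigma>))"
proof -
  define Y A I where "Y = y \<bullet> y" and "A = a \<bullet> a" and "I = y \<bullet> a"
  have 1: "(norm (y - a))\<^sup>2 = Y - 2 * I + A"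
    by (simp add: power2_norm_eq_inner inner_diff_left inner_diff_right inner_commute Y_def A_def I_def)
  have "(norm (y - c *\<^sub>R a))\<^sup>2 = Y - 2 * c * I + c\<^sup>2 * A" for c
    unfolding power2_norm_eq_inner
    by (simp add: inner_diff_left inner_diff_right inner_commute[of a y] Y_def A_def I_def power2_eq_square algebra_simps)
  then have 2: "(norm (y - (1 / (1 + \<sigma>)) *\<^sub>R a))\<^sup>2 = Y - 2 * (1 / (1 + \<sigma>)) * I + (1 / (1 + \<sigma>))\<^sup>2 * A" .
  have 3: "(norm y)\<^sup>2 = Y" "(norm a)\<^sup>2 = A" by (simp_all add: power2_norm_eq_inner Y_def A_def)
  define \<tau> where "\<tau> = 1 + \<sigma>"
  have \<tau>: "\<tau> > 0" "\<sigma> = \<tau> - 1" "\<tau> - 1 \<noteq> 0" using assms by (auto simp: \<tau>_def)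
  show ?thesis unfolding 1 2 3 unfolding \<tau>_def[symmetric] using \<tau>(1,3) unfolding \<tau>(2)
    by (simp add: divide_simps power2_eq_square) (simp add: algebra_simps)
qed

text \<open>Multiplying \<open>K\<close> by a fixed Gaussian makes it integrable, and by
  \<open>gaussian_product\<close> the product is still orthogonal to all translated Gaussians. The
  fixed Gaussian never vanishes, so it can be divided out at the end.\<close>

lemma gaussian_orthogonal_Lp2_imp_AE_0:
  fixes K :: "'a::euclidean_space \<Rightarrow> complex"
  assumes K: "K \<in> Lp_space 2"
    and orth: "\<And>a \<sigma>. \<sigma> > 0 \<Longrightarrow> (LBINT y. K y * of_real (exp (- (norm (y - a))\<^sup>2 / (2 * \<sigma>)))) = 0"
  shows "AE x in lborel. K x = 0"
proof -
  have g: "(\<lambda>x::'a. complex_of_real (exp (- ((norm x)\<^sup>2 / 2)))) \<in> Lp_space 2"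
    using modulated_gaussian_Lp(1)[of 1 1 "0::'a"] by simp
  have "AE x in lborel. K x * complex_of_real (exp (- ((norm x)\<^sup>2 / 2))) = 0"
  proof (rule gaussian_orthogonal_imp_AE_0)
    show "integrable lborel (\<lambda>x. K x * complex_of_real (exp (- ((norm x)\<^sup>2 / 2))))"
      by (rule Lp_space_2_integrable_mult[OF K g])
    fix a :: 'a and \<sigma> :: real assume \<sigma>: "\<sigma> > 0"
    let ?a = "(1 / (1 + \<sigma>)) *\<^sub>R a" and ?\<sigma> = "\<sigma> / (1 + \<sigma>)"
    have "(LBINT y. K y * complex_of_real (exp (- ((norm y)\<^sup>2 / 2))) * of_real (exp (- (norm (y - a))\<^sup>2 / (2 * \<sigma>))))
      = (LBINT y. K y * of_real (exp (- (norm (y - ?a))\<^sup>2 / (2 * ?\<sigma>))) * of_real (exp (- ((norm a)\<^sup>2 / (2 * (1 + \<sigma>))))))"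
    proof (rule Bochner_Integration.integral_cong[OF refl])
      fix y
      have "exp (- ((norm y)\<^sup>2 / 2)) * exp (- (norm (y - a))\<^sup>2 / (2 * \<sigma>))
        = exp (- (norm (y - ?a))\<^sup>2 / (2 * ?\<sigma>)) * exp (- ((norm a)\<^sup>2 / (2 * (1 + \<sigma>))))"
        unfolding exp_add[symmetric] using gaussian_product[OF \<sigma>, of y a] by (intro arg_cong[where f=exp]) linarith
      then show "K y * complex_of_real (exp (- ((norm y)\<^sup>2 / 2))) * of_real (exp (- (norm (y - a))\<^sup>2 / (2 * \<sigma>)))
        = K y * of_real (exp (- (norm (y - ?a))\<^sup>2 / (2 * ?\<sigma>))) * of_real (exp (- ((norm a)\<^sup>2 / (2 * (1 + \<sigma>)))))"
        unfolding mult.assoc of_real_mult[symmetric] by simp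
    qed
    also have "\<dots> = 0" unfolding integral_mult_left_zero using \<sigma> by (subst orth) auto
    finally show "(LBINT y. K y * complex_of_real (exp (- ((norm y)\<^sup>2 / 2))) * of_real (exp (- (norm (y - a))\<^sup>2 / (2 * \<sigma>)))) = 0" .
  qed
  then show ?thesis by simp
qed

text \<open>Tested against a translated Gaussian \<open>W\<close>, the multiplication formula moves
  both transforms onto \<open>W\<close>: the first sends \<open>W\<close> to the modulated Gaussian
  \<open>g\<close>, the second sends \<open>g\<close> back to \<open>W\<close>. Translated Gaussians
  separate the elements of L^2.\<close>

theorem L2_ft_inversion:
  fixes G :: "'a::euclidean_space \<Rightarrow> complex"
  assumes s: "s\<^sup>2 = 1" and G: "G \<in> Lp_space 2"
  shows "AE x in lborel. L2_ft (- s) (L2_ft s G) x = G x"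
proof -
  have s': "(- s)\<^sup>2 = 1" using s by simp
  have F: "L2_ft s G \<in> Lp_space 2" by (rule L2_ft_Lp_space_2[OF s G])
  have H: "L2_ft (- s) (L2_ft s G) \<in> Lp_space 2" by (rule L2_ft_Lp_space_2[OF s' F])
  have "AE x in lborel. L2_ft (- s) (L2_ft s G) x - G x = 0"
  proof (rule gaussian_orthogonal_Lp2_imp_AE_0[OF Lp_space_2_diff[OF H G]])
    fix a :: 'a and \<sigma> :: real assume \<sigma>: "\<sigma> > 0"
    define W where "W = (\<lambda>y. complex_of_real (exp (- (norm (y - a))\<^sup>2 / (2 * \<sigma>))))"
    define g where "g = (\<lambda>\<xi>. complex_of_real (sqrt \<sigma> ^ DIM('a)) * (cis (\<xi> \<bullet> ((- s) *\<^sub>R a)) * of_real (exp (- (\<sigma> * (norm \<xi>)\<^sup>2 / 2)))))"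
    have g: "g \<in> Lp_space 2" "integrable lborel g"
      unfolding g_def by (rule modulated_gaussian_Lp[OF \<sigma>])+
    have ftW: "ft (- s) W = g"
      unfolding W_def g_def by (rule ext) (rule ft_gaussian_translate[OF \<sigma> s'])
    have ftg: "ft s g = W"
    proof
      fix y
      have "ft s g y = of_real (sqrt \<sigma> ^ DIM('a)) * ft s (\<lambda>\<xi>. cis (\<xi> \<bullet> ((- s) *\<^sub>R a)) * of_real (exp (- (\<sigma> * (norm \<xi>)\<^sup>2 / 2)))) y"
        unfolding g_def ft_def mult.left_commute[of "cis _" "of_real (sqrt \<sigma> ^ DIM('a))"] integral_mult_right_zero by simp
      also have "\<dots> = of_real (sqrt \<sigma> ^ DIM('a) * ((1 / sqrt \<sigma>) ^ DIM('a) * exp (- (norm ((- s) *\<^sub>R a + s *\<^sub>R y))\<^sup>2 / (2 * \<sigma>))))"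
        by (simp only: ft_gaussian[OF \<sigma>] of_real_mult)
      also have "norm ((- s) *\<^sub>R a + s *\<^sub>R y) = norm (y - a)"
        using s by (auto simp: power2_eq_1_iff norm_minus_commute)
      also have "sqrt \<sigma> ^ DIM('a) * ((1 / sqrt \<sigma>) ^ DIM('a) * exp (- (norm (y - a))\<^sup>2 / (2 * \<sigma>))) = exp (- (norm (y - a))\<^sup>2 / (2 * \<sigma>))"
        using \<sigma> by (simp add: power_divide)
      finally show "ft s g y = W y" by (simp add: W_def)
    qed
    have W: "W \<in> Lp_space 2" "integrable lborel W"
    proof -
      show "W \<in> Lp_space 2" using ft_Lp_space_2[OF s g] by (simp add: ftg)
      have "integrable lborel (\<lambda>y::'a. exp (- ((1 / \<sigma>) * (norm y)\<^sup>2 / 2)))"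
        using \<sigma> by (intro integrable_gaussian) simp
      then have "integrable lborel (\<lambda>y::'a. exp (- ((1 / \<sigma>) * (norm (- a + 1 *\<^sub>R y))\<^sup>2 / 2)))"
        by (subst integrable_lborel_affine) auto
      then show "integrable lborel W" unfolding W_def by (intro integrable_of_real) (simp add: field_simps)
    qed
    have "(LBINT y. L2_ft (- s) (L2_ft s G) y * W y) = (LBINT \<xi>. L2_ft s G \<xi> * g \<xi>)"
      using L2_ft_multiplication[OF s' F W] by (simp add: ftW)
    also have "\<dots> = (LBINT y. G y * W y)" using L2_ft_multiplication[OF s G g] by (simp add: ftg)
    finally show "(LBINT y. (L2_ft (- s) (L2_ft s G) y - G y) * of_real (exp (- (norm (y - a))\<^sup>2 / (2 * \<sigma>)))) = 0"
      unfolding W_def[symmetric] fun_cong[OF W_def[symmetric]] left_diff_distrib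
      by (simp add: Bochner_Integration.integral_diff Lp_space_2_integrable_mult H G W)
  qed
  then show ?thesis by simp
qed

section \<open>Dispersive bounds for Fourier multipliers\<close>

lemma Lp_space_2_mult_bounded:
  assumes f: "f \<in> Lp_space 2" and [measurable]: "m \<in> borel_measurable borel" and m: "\<And>x. norm (m x) \<le> 1"
  shows "(\<lambda>x. m x * f x) \<in> Lp_space 2"
proof -
  have [measurable]: "f \<in> borel_measurable borel" and "L2_sq f < \<infinity>"
    using f by (auto simp: Lp_space_2_iff)
  moreover have "L2_sq (\<lambda>x. m x * f x) \<le> L2_sq f"
    unfolding L2_sq_def by (intro nn_integral_mono ennreal_leI power_mono) (auto simp: norm_mult m mult_left_le_one_le)
  ultimately show ?thesis by (auto simp: Lp_space_2_iff intro: le_less_trans)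
qed

lemma L2_sq_gaussian_cutoff_tendsto:
  fixes Q :: "'a::euclidean_space \<Rightarrow> complex"
  assumes Q: "Q \<in> Lp_space 2"
  shows "(\<lambda>n. L2_sq (\<lambda>\<xi>. Q \<xi> - of_real (exp (- (1 / real (Suc n) * (norm \<xi>)\<^sup>2))) * Q \<xi>)) \<longlonglongrightarrow> 0"
proof -
  have [measurable]: "Q \<in> borel_measurable borel" and N: "L2_sq Q < \<infinity>"
    using Q by (auto simp: Lp_space_2_iff)
  have eq: "norm (Q \<xi> - of_real r * Q \<xi>) = norm (Q \<xi>) * \<bar>1 - r\<bar>" for \<xi> r
  proof -
    have "Q \<xi> - of_real r * Q \<xi> = Q \<xi> * of_real (1 - r)" by (simp add: algebra_simps)
    then show ?thesis by (simp only: norm_mult norm_of_real)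
  qed
  have "(\<lambda>n. L2_sq (\<lambda>\<xi>. Q \<xi> - of_real (exp (- (1 / real (Suc n) * (norm \<xi>)\<^sup>2))) * Q \<xi>)) \<longlonglongrightarrow> (\<integral>\<^sup>+x. 0 \<partial>(lborel :: 'a measure))"
    unfolding L2_sq_def eq
  proof (rule nn_integral_dominated_convergence[where w="\<lambda>x. ennreal ((norm (Q x))\<^sup>2)"])
    show "AE \<xi> in lborel. (\<lambda>n. ennreal ((norm (Q \<xi>) * \<bar>1 - exp (- (1 / real (Suc n) * (norm \<xi>)\<^sup>2))\<bar>)\<^sup>2)) \<longlonglongrightarrow> 0"
    proof (rule AE_I2)
      fix \<xi> :: 'a
      have "(\<lambda>n. 1 / real (Suc n)) \<longlonglongrightarrow> 0" by (rule LIMSEQ_Suc[OF lim_1_over_n])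
      then have "(\<lambda>n. ennreal ((norm (Q \<xi>) * \<bar>1 - exp (- (1 / real (Suc n) * (norm \<xi>)\<^sup>2))\<bar>)\<^sup>2))
         \<longlonglongrightarrow> ennreal ((norm (Q \<xi>) * \<bar>1 - exp (- (0 * (norm \<xi>)\<^sup>2))\<bar>)\<^sup>2)"
        by (intro tendsto_intros tendsto_ennrealI)
      then show "(\<lambda>n. ennreal ((norm (Q \<xi>) * \<bar>1 - exp (- (1 / real (Suc n) * (norm \<xi>)\<^sup>2))\<bar>)\<^sup>2)) \<longlonglongrightarrow> 0"
        by simp
    qed
    show "(\<integral>\<^sup>+x. ennreal ((norm (Q x))\<^sup>2) \<partial>lborel) < \<infinity>"
      using N by (simp add: L2_sq_def)
    show "AE \<xi> in lborel. ennreal ((norm (Q \<xi>) * \<bar>1 - exp (- (1 / real (Suc n) * (norm \<xi>)\<^sup>2))\<bar>)\<^sup>2) \<le> ennreal ((norm (Q \<xi>))\<^sup>2)" for n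
    proof (rule AE_I2)
      fix \<xi> :: 'a
      have "exp (- (1 / real (Suc n) * (norm \<xi>)\<^sup>2)) \<le> 1" by simp
      then have "\<bar>1 - exp (- (1 / real (Suc n) * (norm \<xi>)\<^sup>2))\<bar> \<le> 1"
        using exp_gt_zero[of "- (1 / real (Suc n) * (norm \<xi>)\<^sup>2)"] by linarith
      then show "ennreal ((norm (Q \<xi>) * \<bar>1 - exp (- (1 / real (Suc n) * (norm \<xi>)\<^sup>2))\<bar>)\<^sup>2) \<le> ennreal ((norm (Q \<xi>))\<^sup>2)"
        by (intro ennreal_leI power_mono mult_left_le) auto
    qed
  qed measurable
  then show ?thesis by simp
qed

text \<open>The excess of |u| over \<open>M\<close> is almost everywhere at most |u - v n|, so its
  square integral lies below a sequence that tends to 0.\<close>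

lemma AE_bounded_if_L2_sq_limit:
  fixes u :: "'a::euclidean_space \<Rightarrow> complex"
  assumes [measurable]: "u \<in> borel_measurable borel" "\<And>n. v n \<in> borel_measurable borel"
    and lim: "(\<lambda>n. L2_sq (\<lambda>x. u x - v n x)) \<longlonglongrightarrow> 0"
    and bound: "\<And>n. AE x in lborel. norm (v n x) \<le> M"
  shows "AE x in lborel. norm (u x) \<le> M"
proof -
  let ?e = "\<lambda>x. max 0 (norm (u x) - M)"
  have "(\<integral>\<^sup>+x. ennreal ((?e x)\<^sup>2) \<partial>lborel) \<le> L2_sq (\<lambda>x. u x - v n x)" for n
    unfolding L2_sq_def
  proof (rule nn_integral_mono_AE)
    show "AE x in lborel. ennreal ((?e x)\<^sup>2) \<le> ennreal ((norm (u x - v n x))\<^sup>2)"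
      using bound[of n]
    proof eventually_elim
      case (elim x)
      have "norm (u x) \<le> norm (u x - v n x) + norm (v n x)"
        using norm_triangle_ineq[of "u x - v n x" "v n x"] by simp
      with elim have "?e x \<le> norm (u x - v n x)" by simp
      then show ?case by (intro ennreal_leI power_mono) auto
    qed
  qed
  then have "(\<integral>\<^sup>+x. ennreal ((?e x)\<^sup>2) \<partial>lborel) \<le> 0"
    by (intro tendsto_lowerbound[OF lim]) (auto intro!: always_eventually)
  then have "AE x in lborel. ennreal ((?e x)\<^sup>2) = 0"
    by (subst (asm) le_zero_eq, subst (asm) nn_integral_0_iff_AE) auto
  then show ?thesis by eventually_elim (auto simp: ennreal_eq_0_iff max_def split: if_splits)
qed

text \<open>The operator is convolution with the kernel of \<open>m\<close>: the multiplication
  formula puts the transform on \<open>cis (\<xi> \<bullet> x) * m \<xi>\<close>, and its value at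
  \<open>y\<close> is the kernel at \<open>x - y\<close>. Each of the two transforms contributes one
  factor \<open>ft_const\<close>.\<close>

lemma norm_ft_mult_le:
  fixes f m :: "'a::euclidean_space \<Rightarrow> complex"
  assumes f: "integrable lborel f" and m: "integrable lborel m"
    and B: "\<And>z. norm (LBINT \<xi>. cis (\<xi> \<bullet> z) * m \<xi>) \<le> B"
  shows "norm (ft 1 (\<lambda>\<xi>. m \<xi> * ft (- 1) f \<xi>) x) \<le> (ft_const TYPE('a))\<^sup>2 * B * (LBINT x. norm (f x))"
proof -
  let ?c = "ft_const TYPE('a)"
  let ?g = "\<lambda>\<xi>. cis (\<xi> \<bullet> x) * m \<xi>"
  have g: "integrable lborel ?g" by (intro integrable_cis_mult m) measurable
  have "ft 1 (\<lambda>\<xi>. m \<xi> * ft (- 1) f \<xi>) x = of_real ?c * (LBINT \<xi>. ft (- 1) f \<xi> * ?g \<xi>)"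
    by (subst ft_def) (simp add: mult_ac)
  also have "\<dots> = of_real ?c * (LBINT y. f y * ft (- 1) ?g y)" by (simp only: ft_multiplication[OF f g])
  finally have "norm (ft 1 (\<lambda>\<xi>. m \<xi> * ft (- 1) f \<xi>) x) = ?c * norm (LBINT y. f y * ft (- 1) ?g y)"
    using ft_const_pos[where 'a='a] by (simp add: norm_mult)
  also have "\<dots> \<le> ?c * (LBINT y. norm (f y * ft (- 1) ?g y))"
    using ft_const_pos[where 'a='a] by (intro mult_left_mono integral_norm_bound) auto
  also have "\<dots> \<le> ?c * (LBINT y. norm (f y) * (?c * B))"
  proof (intro mult_left_mono integral_mono')
    show "integrable lborel (\<lambda>y. norm (f y) * (?c * B))" using f by (intro integrable_mult_left) auto
    fix y
    have "ft (- 1) ?g y = of_real ?c * (LBINT \<xi>. cis (\<xi> \<bullet> (x - y)) * m \<xi>)"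
      unfolding ft_def by (simp add: mult.assoc[symmetric] cis_mult inner_diff_right)
    then have "norm (ft (- 1) ?g y) \<le> ?c * B"
      using B[of "x - y"] ft_const_pos[where 'a='a] by (simp add: norm_mult)
    then show "norm (f y * ft (- 1) ?g y) \<le> norm (f y) * (?c * B)" by (simp add: norm_mult mult_left_mono)
  qed (use ft_const_pos[where 'a='a] order_trans[OF norm_ge_zero B[of 0]] in auto)
  finally show ?thesis by (simp add: power2_eq_square mult_ac)
qed

lemma Lp_norm_1: "Lp_norm 1 f = (\<integral>\<^sup>+x. ennreal (norm (f x)) \<partial>lborel)"
  by (cases "(\<integral>\<^sup>+x. ennreal (norm (f x)) \<partial>lborel)") (simp_all add: Lp_norm_def ennpowr_def)

text \<open>The Gaussian factor makes the kernel of the multiplier an absolutely convergent integral; the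
  bound survives its removal because the truncated operators converge in \<open>L\<^sup>2\<close>.\<close>

theorem L1_Linf_norm_fourier_multiplier_comp:
  fixes m1 m2 :: "'a::euclidean_space \<Rightarrow> complex"
  assumes [measurable]: "m1 \<in> borel_measurable borel" "m2 \<in> borel_measurable borel"
    and m1: "\<And>\<xi>. norm (m1 \<xi>) \<le> 1" and m2: "\<And>\<xi>. norm (m2 \<xi>) \<le> 1"
    and B: "\<And>\<epsilon> z. 0 < \<epsilon> \<Longrightarrow> \<epsilon> \<le> 1 \<Longrightarrow>
      norm (LBINT \<xi>. cis (\<xi> \<bullet> z) * (of_real (exp (- (\<epsilon> * (norm \<xi>)\<^sup>2))) * (m2 \<xi> * m1 \<xi>))) \<le> B"
  shows "L1_Linf_norm (fourier_multiplier m2 \<circ> fourier_multiplier m1) \<le> ennreal ((ft_const TYPE('a))\<^sup>2 * B)"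
  unfolding L1_Linf_norm_def
proof (rule SUP_least)
  fix f :: "'a \<Rightarrow> complex"
  assume "f \<in> {f \<in> Lp_space 1 \<inter> Lp_space 2. Lp_norm 1 f \<le> 1}"
  then have f2: "f \<in> Lp_space 2" and f1: "(\<integral>\<^sup>+x. ennreal (norm (f x)) \<partial>lborel) \<le> 1"
    by (auto simp: Lp_norm_1)
  have [measurable]: "f \<in> borel_measurable borel" using f2 by (auto simp: Lp_space_2_iff)
  have f: "integrable lborel f" unfolding integrable_iff_bounded using f1 by (auto intro: le_less_trans)
  have "ennreal (LBINT x. norm (f x)) \<le> 1" using f1 f by (subst (asm) nn_integral_eq_integral) auto
  then have f_le: "(LBINT x. norm (f x)) \<le> 1" by simp
  have one: "(1::real)\<^sup>2 = 1" "(- 1 :: real)\<^sup>2 = 1" by simp_all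
  have ftf: "ft (- 1) f \<in> Lp_space 2" by (rule ft_Lp_space_2[OF one(2) f2 f])
  have F: "fourier f \<in> Lp_space 2" and Feq: "AE \<xi> in lborel. fourier f \<xi> = ft (- 1) f \<xi>"
    unfolding fourier_eq_L2_ft by (rule L2_ft_Lp_space_2[OF one(2) f2], rule L2_ft_eq_ft[OF one(2) f2 f])
  define G where "G = (\<lambda>\<xi>. m1 \<xi> * fourier f \<xi>)"
  have G: "G \<in> Lp_space 2" unfolding G_def by (intro Lp_space_2_mult_bounded F m1) measurable
  define v where "v = fourier_multiplier m1 f"
  have v: "v = L2_ft 1 G" by (simp add: v_def fourier_multiplier_def inv_fourier_eq_L2_ft G_def)
  have vL: "v \<in> Lp_space 2" unfolding v by (rule L2_ft_Lp_space_2[OF one(1) G])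
  \<comment> \<open>Inversion merges the two multipliers: the transform of the intermediate function
    is \<open>m1\<close> times that of \<open>f\<close>, so the composition acts with the single
    symbol \<open>m2 * m1\<close>.\<close>
  have Fv: "AE \<xi> in lborel. fourier v \<xi> = G \<xi>"
    unfolding v fourier_eq_L2_ft by (rule L2_ft_inversion[OF one(1) G])
  have FvL: "fourier v \<in> Lp_space 2" unfolding fourier_eq_L2_ft by (rule L2_ft_Lp_space_2[OF one(2) vL])
  define Q where "Q = (\<lambda>\<xi>. (m2 \<xi> * m1 \<xi>) * ft (- 1) f \<xi>)"
  have m21: "norm (m2 \<xi> * m1 \<xi>) \<le> 1" for \<xi>
    using m1[of \<xi>] m2[of \<xi>] by (simp add: norm_mult mult_le_one)
  have Q: "Q \<in> Lp_space 2" unfolding Q_def by (intro Lp_space_2_mult_bounded ftf m21) measurable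
  have Q': "(\<lambda>\<xi>. m2 \<xi> * fourier v \<xi>) \<in> Lp_space 2" by (intro Lp_space_2_mult_bounded FvL m2) measurable
  define u where "u = (fourier_multiplier m2 \<circ> fourier_multiplier m1) f"
  have u: "u = L2_ft 1 (\<lambda>\<xi>. m2 \<xi> * fourier v \<xi>)"
    by (simp add: u_def v_def[symmetric] fourier_multiplier_def[of m2] inv_fourier_eq_L2_ft)
  have [measurable]: "u \<in> borel_measurable borel" "L2_ft 1 Q \<in> borel_measurable borel"
    unfolding u by (rule measurable_L2_ft[OF one(1) Q'], rule measurable_L2_ft[OF one(1) Q])
  have uQ: "AE x in lborel. u x = L2_ft 1 Q x" unfolding u
  proof (rule L2_ft_cong_AE[OF one(1) Q' Q])
    show "AE \<xi> in lborel. m2 \<xi> * fourier v \<xi> = Q \<xi>"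
      using Fv Feq by eventually_elim (simp add: Q_def G_def)
  qed
  let ?M = "(ft_const TYPE('a))\<^sup>2 * B"
  have "AE x in lborel. norm (L2_ft 1 Q x) \<le> ?M"
  proof (rule AE_bounded_if_L2_sq_limit)
    \<comment> \<open>The parameter \<open>1 / real (Suc n)\<close> stays in \<open>(0, 1]\<close>,
      the range in which \<open>B\<close> is assumed to bound the regularized kernel.\<close>
    let ?e = "\<lambda>n (\<xi>::'a). complex_of_real (exp (- (1 / real (Suc n) * (norm \<xi>)\<^sup>2)))"
    let ?v = "\<lambda>n. L2_ft 1 (\<lambda>\<xi>. ?e n \<xi> * Q \<xi>)"
    have eQ: "(\<lambda>\<xi>. ?e n \<xi> * Q \<xi>) \<in> Lp_space 2" for n
      by (intro Lp_space_2_mult_bounded Q) auto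
    show "?v n \<in> borel_measurable borel" for n by (rule measurable_L2_ft[OF one(1) eQ])
    have "(\<lambda>n. 4 * L2_sq (\<lambda>\<xi>. Q \<xi> - ?e n \<xi> * Q \<xi>)) \<longlonglongrightarrow> 4 * 0"
      by (intro ennreal_tendsto_cmult L2_sq_gaussian_cutoff_tendsto Q) simp
    then show "(\<lambda>n. L2_sq (\<lambda>x. L2_ft 1 Q x - ?v n x)) \<longlonglongrightarrow> 0"
      using L2_sq_L2_ft_diff_le[OF one(1) Q eQ]
      by (intro tendsto_sandwich[of "\<lambda>_. 0" "\<lambda>n. L2_sq (\<lambda>x. L2_ft 1 Q x - ?v n x)", OF _ _ tendsto_const]) auto
    fix n
    have eint: "integrable lborel (?e n)" using integrable_gaussian[of "2 * (1 / real (Suc n))", where 'a='a]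
      by (intro integrable_of_real) (simp del: of_nat_Suc)
    have mint: "integrable lborel (\<lambda>\<xi>. ?e n \<xi> * (m2 \<xi> * m1 \<xi>))"
      using m21 by (intro Bochner_Integration.integrable_bound[OF eint]) (auto simp: norm_mult mult_left_le)
    have le: "norm (ft 1 (\<lambda>\<xi>. (?e n \<xi> * (m2 \<xi> * m1 \<xi>)) * ft (- 1) f \<xi>) x) \<le> ?M" for x
    proof -
      have "norm (ft 1 (\<lambda>\<xi>. (?e n \<xi> * (m2 \<xi> * m1 \<xi>)) * ft (- 1) f \<xi>) x) \<le> ?M * (LBINT x. norm (f x))"
        by (rule norm_ft_mult_le[OF f mint B]) auto
      also have "\<dots> \<le> ?M * 1"
        using f_le order_trans[OF norm_ge_zero B[of 1 0]] by (intro mult_left_mono) auto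
      finally show ?thesis by simp
    qed
    have "integrable lborel (\<lambda>\<xi>. ?e n \<xi> * Q \<xi>)"
    proof (rule Bochner_Integration.integrable_bound)
      show "integrable lborel (\<lambda>\<xi>. (ft_const TYPE('a) * (LBINT x. norm (f x))) * norm (?e n \<xi>))"
        using eint by (intro integrable_mult_right integrable_norm)
      have "norm (Q \<xi>) \<le> ft_const TYPE('a) * (LBINT x. norm (f x))" for \<xi>
        unfolding Q_def norm_mult[of "m2 \<xi> * m1 \<xi>"]
        using norm_ft_le[of "- 1" f \<xi>] mult_left_le_one_le[OF norm_ge_zero[of "ft (- 1) f \<xi>"] norm_ge_zero m21[of \<xi>]] by linarith
      then show "AE \<xi> in lborel. norm (?e n \<xi> * Q \<xi>) \<le> norm ((ft_const TYPE('a) * (LBINT x. norm (f x))) * norm (?e n \<xi>))"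
        using ft_const_pos[where 'a='a]
        by (intro AE_I2) (simp add: norm_mult abs_mult mult.commute mult_left_mono del: norm_of_real)
      show "(\<lambda>\<xi>. ?e n \<xi> * Q \<xi>) \<in> borel_measurable lborel" using eQ[of n] by (auto simp: Lp_space_2_iff)
    qed
    from L2_ft_eq_ft[OF one(1) eQ this]
    show "AE x in lborel. norm (?v n x) \<le> ?M"
    proof eventually_elim
      case (elim x)
      show ?case unfolding elim using le[of x] by (simp add: Q_def mult_ac)
    qed
  qed measurable
  with uQ have "AE x in lborel. ennreal (norm (u x)) \<le> ennreal ?M"
    by eventually_elim (simp add: ennreal_leI)
  then show "Linf_norm ((fourier_multiplier m2 \<circ> fourier_multiplier m1) f) \<le> ennreal ?M"
    unfolding Linf_norm_def u_def[symmetric] by (intro esssup_I) measurable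
qed

section \<open>Oscillatory integrals with a nondegenerate phase\<close>

text \<open>Integrating the derivative along \<open>x + s v\<close> over \<open>s\<close> in [0, 1]
  gives \<open>F (x + v) - F x\<close>, whose integral is 0 by translation invariance. By Fubini and
  translation invariance at each \<open>s\<close>, the same double integral is the left side, so
  boundary terms at infinity never have to be estimated.\<close>

lemma integral_directional_derivative_eq_0:
  fixes F :: "'a::euclidean_space \<Rightarrow> complex"
  assumes F: "integrable lborel F" and G: "integrable lborel (\<lambda>x. F' x v)"
    and cont: "continuous_on UNIV (\<lambda>x. F' x v)"
    and deriv: "\<And>x. (F has_derivative F' x) (at x)"
  shows "(LBINT x. F' x v) = 0"
proof -
  define G where "G x = F' x v" for x
  have [measurable]: "F \<in> borel_measurable borel" "G \<in> borel_measurable borel"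
    using F G by (auto simp: G_def[abs_def])
  have G': "integrable lborel G" using G by (simp add: G_def[abs_def])
  let ?h = "\<lambda>(s, x). indicator {0..1} s *\<^sub>R G (s *\<^sub>R v + 1 *\<^sub>R x)"
  have int: "integrable (lborel \<Otimes>\<^sub>M lborel) ?h"
  proof (rule lborel_pair.Fubini_integrable)
    show "?h \<in> borel_measurable (lborel \<Otimes>\<^sub>M lborel)" by measurable
    have eq: "(LBINT x. norm (?h (s, x))) = indicator {0..1} s * (LBINT x. norm (G x))" for s
    proof -
      have "(LBINT x. norm (G x)) = \<bar>1\<bar> ^ DIM('a) *\<^sub>R (LBINT x. norm (G (s *\<^sub>R v + 1 *\<^sub>R x)))"
        by (rule integral_lborel_affine) auto
      then show ?thesis by simp
    qed
    show "integrable lborel (\<lambda>s. \<integral>x. norm (?h (s, x)) \<partial>lborel)"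
      unfolding eq by (intro integrable_mult_left integrable_real_indicator) auto
    show "AE s in lborel. integrable lborel (\<lambda>x. ?h (s, x))"
      using G' by (intro AE_I2) (simp add: integrable_lborel_affine[of 1, simplified])
  qed
  have "(LBINT x. F' x v) = (LBINT s. indicator {0..1::real} s *\<^sub>R (LBINT x. G x))" by (simp add: G_def)
  also have "\<dots> = (LBINT s. (LBINT x. ?h (s, x)))"
  proof (rule Bochner_Integration.integral_cong[OF refl])
    fix s :: real
    have "(LBINT x. G x) = \<bar>1\<bar> ^ DIM('a) *\<^sub>R (LBINT x. G (s *\<^sub>R v + 1 *\<^sub>R x))"
      by (rule integral_lborel_affine) auto
    then show "indicator {0..1} s *\<^sub>R (LBINT x. G x) = (LBINT x. ?h (s, x))" by simp
  qed
  also have "\<dots> = (LBINT x. (LBINT s. ?h (s, x)))"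
    using lborel_pair.Fubini_integral[of "\<lambda>s x. ?h (s, x)"] int by simp
  also have "\<dots> = (LBINT x. F (v + 1 *\<^sub>R x) - F x)"
  proof (rule Bochner_Integration.integral_cong[OF refl])
    fix x :: 'a
    have "(LBINT s. indicator {0..1} s *\<^sub>R G (x + s *\<^sub>R v)) = F (x + 1 *\<^sub>R v) - F (x + 0 *\<^sub>R v)"
    proof (rule integral_FTC_Icc)
      fix s :: real
      have "((\<lambda>s. x + s *\<^sub>R v) has_derivative (\<lambda>t. t *\<^sub>R v)) (at s)"
        by (auto intro!: derivative_eq_intros)
      from has_derivative_compose[OF this deriv]
      have "((\<lambda>s. F (x + s *\<^sub>R v)) has_derivative (\<lambda>t. F' (x + s *\<^sub>R v) (t *\<^sub>R v))) (at s)" .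
      moreover have "F' y (t *\<^sub>R v) = t *\<^sub>R G y" for y t
        using has_derivative_bounded_linear[OF deriv[of y]] unfolding G_def by (rule linear_simps(5))
      ultimately show "((\<lambda>s. F (x + s *\<^sub>R v)) has_vector_derivative G (x + s *\<^sub>R v)) (at s within {0..1})"
        by (simp add: has_vector_derivative_def has_derivative_at_withinI)
    next
      have "continuous_on {0..1} (G \<circ> (\<lambda>s. x + s *\<^sub>R v))"
        using cont by (intro continuous_on_compose continuous_intros) (auto simp: G_def[abs_def] intro: continuous_on_subset)
      then show "continuous_on {0..1} (\<lambda>s. G (x + s *\<^sub>R v))" by (simp add: o_def)
    qed simp
    then show "(LBINT s. ?h (s, x)) = F (v + 1 *\<^sub>R x) - F x" by (simp add: add.commute)
  qed
  also have "\<dots> = (LBINT x. F (v + 1 *\<^sub>R x)) - (LBINT x. F x)"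
    using F by (intro Bochner_Integration.integral_diff) (simp_all add: integrable_lborel_affine[of 1, simplified])
  also have "(LBINT x. F (v + 1 *\<^sub>R x)) = (LBINT x. F x)"
    by (subst (2) integral_lborel_affine[where c=1 and t=v]) auto
  finally show ?thesis by simp
qed

text \<open>The phase is a perturbation of |x|^2 / 2 up to linear terms: \<open>p\<close> is its
  gradient and \<open>E\<close> the Hessian minus the identity. The bound 1/2 on \<open>E\<close>
  keeps \<open>p\<close> between the Lipschitz constants 1/2 and 3/2.\<close>

locale nondegenerate_phase =
  fixes \<phi> :: "'a::euclidean_space \<Rightarrow> real" and p :: "'a \<Rightarrow> 'a" and E :: "'a \<Rightarrow> 'a \<Rightarrow> 'a" and N :: "'a \<Rightarrow> real"
  assumes dim: "DIM('a) = 3"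
    and phase: "\<And>x. (\<phi> has_derivative (\<lambda>v. p x \<bullet> v)) (at x)"
    and p: "\<And>x. (p has_derivative (\<lambda>v. v + E x v)) (at x)"
    and E_cont: "\<And>v. continuous_on UNIV (\<lambda>x. E x v)"
    and E_le: "\<And>x v. norm (E x v) \<le> N x * norm v"
    and N_le: "\<And>x. N x \<le> 1 / 2"
begin

definition w :: "'a \<Rightarrow> real" where "w x = 1 / (1 + (norm (p x))\<^sup>2)"
definition e :: "'a \<Rightarrow> complex" where "e x = cis (- \<phi> x)"
definition Dw :: "'a \<Rightarrow> 'a \<Rightarrow> real" where "Dw x v = - 2 * (w x)\<^sup>2 * (p x \<bullet> (v + E x v))"
text \<open>The terms of the divergence of \<open>w p\<close> that involve \<open>E\<close>. They
  are only continuous, so they are separated from the terms that can be differentiated once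
  more.\<close>

definition r0 :: "'a \<Rightarrow> real"
  where "r0 x = w x * (\<Sum>i\<in>Basis. E x i \<bullet> i) - 2 * (w x)\<^sup>2 * (p x \<bullet> E x (p x))"

lemma den_pos: "1 + (norm (p x))\<^sup>2 > 0" by (simp add: add_pos_nonneg)
lemma w_pos: "w x > 0" by (simp add: w_def den_pos)
lemma w_le_1: "w x \<le> 1" unfolding w_def using den_pos[of x] by (subst divide_le_eq_1_pos) auto
lemma w_p_sq: "w x * (norm (p x))\<^sup>2 = 1 - w x"
proof -
  have "1 + (norm (p x))\<^sup>2 \<noteq> 0" using den_pos[of x] by simp
  then show ?thesis unfolding w_def by (simp add: field_simps)
qed
lemma w_p_le: "w x * norm (p x) \<le> 1 / 2"
proof -
  have "2 * norm (p x) \<le> 1 + (norm (p x))\<^sup>2" using sum_squares_bound[of 1 "norm (p x)"] by simp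
  then show ?thesis unfolding w_def using den_pos[of x] by (simp add: field_simps)
qed

lemma N_nonneg: "0 \<le> N x"
proof -
  obtain i :: 'a where i: "i \<in> Basis" using nonempty_Basis by blast
  show ?thesis using order_trans[OF norm_ge_zero E_le[of x i]] i by simp
qed

lemma norm_Dp_le: "norm (v + E x v) \<le> 3 / 2 * norm v"
  using norm_triangle_ineq[of v "E x v"] E_le[of x v] mult_right_mono[OF N_le norm_ge_zero, of x v] by linarith

lemma E_bounded_linear: "bounded_linear (E x)"
proof -
  have "bounded_linear (\<lambda>v. (v + E x v) - v)"
    by (intro bounded_linear_sub has_derivative_bounded_linear[OF p] bounded_linear_ident)
  then show ?thesis by simp
qed

lemma p_cont: "continuous_on UNIV p"
  using p by (intro has_derivative_continuous_on) (auto intro: has_derivative_at_withinI)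

lemma phase_cont: "continuous_on UNIV \<phi>"
  using phase by (intro has_derivative_continuous_on) (auto intro: has_derivative_at_withinI)

lemma e_cont: "continuous_on UNIV e" unfolding e_def[abs_def] by (intro continuous_intros phase_cont)

lemma w_cont: "continuous_on UNIV w"
proof -
  have "1 + (norm (p x))\<^sup>2 \<noteq> 0" for x using den_pos[of x] by simp
  then show ?thesis unfolding w_def[abs_def] by (intro continuous_intros p_cont) auto
qed

lemma E_cont': "continuous_on UNIV f \<Longrightarrow> continuous_on UNIV (\<lambda>x. E x (f x))"
proof -
  assume f: "continuous_on UNIV f"
  have "E x (f x) = (\<Sum>i\<in>Basis. (f x \<bullet> i) *\<^sub>R E x i)" for x
  proof -
    interpret bounded_linear "E x" by (rule E_bounded_linear)
    have "E x (f x) = E x (\<Sum>i\<in>Basis. (f x \<bullet> i) *\<^sub>R i)" by (simp add: euclidean_representation)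
    also have "\<dots> = (\<Sum>i\<in>Basis. (f x \<bullet> i) *\<^sub>R E x i)" by (simp add: sum scaleR)
    finally show ?thesis .
  qed
  then show ?thesis by (auto intro!: continuous_intros f E_cont)
qed

lemma norm_e [simp]: "norm (e x) = 1" by (simp add: e_def)

lemma w_deriv: "(w has_derivative Dw x) (at x)"
proof -
  have pos: "1 + p x \<bullet> p x \<noteq> 0" for x using den_pos[of x] by (simp add: power2_norm_eq_inner)
  have "((\<lambda>x. inverse (1 + p x \<bullet> p x)) has_derivative (\<lambda>v. - (inverse (1 + p x \<bullet> p x) * (p x \<bullet> (v + E x v) + (v + E x v) \<bullet> p x) * inverse (1 + p x \<bullet> p x)))) (at x)"
    using pos[of x] by (auto intro!: derivative_eq_intros p)
  then show ?thesis
    by (simp add: w_def[abs_def] Dw_def[abs_def] power2_norm_eq_inner[symmetric] divide_inverse power2_eq_square inner_commute algebra_simps)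
qed

lemma e_deriv: "(e has_derivative (\<lambda>v. of_real (- (p x \<bullet> v)) * (\<i> * e x))) (at x)"
  using has_derivative_cis[OF has_derivative_minus[OF phase[of x]]]
  unfolding e_def[abs_def] scaleR_conv_of_real .

text \<open>The factor 3 is twice the bound 3/2 on the derivative of \<open>p\<close>. In the
  direction \<open>p\<close> the extra powers of |p| are absorbed by \<open>w |p|^2 \<le> 1\<close>,
  so differentiating \<open>w\<close> along the vector field costs only a constant.\<close>

lemma Dw_p_le: "\<bar>Dw x (p x)\<bar> \<le> 3 * w x"
  and Dw_le: "\<bar>Dw x v\<bar> \<le> 3 * w x * norm v"
proof -
  have *: "\<bar>Dw x v\<bar> \<le> 3 * w x * (w x * norm (p x)) * norm v" for v
  proof -
    have "\<bar>Dw x v\<bar> = 2 * (w x)\<^sup>2 * \<bar>p x \<bullet> (v + E x v)\<bar>" by (simp add: Dw_def abs_mult)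
    also have "\<dots> \<le> 2 * (w x)\<^sup>2 * (norm (p x) * (3 / 2 * norm v))"
      by (intro mult_left_mono order_trans[OF Cauchy_Schwarz_ineq2] norm_Dp_le) auto
    finally show ?thesis by (simp add: power2_eq_square mult_ac)
  qed
  have "\<bar>Dw x (p x)\<bar> \<le> 3 * w x * (w x * (norm (p x))\<^sup>2)"
    using *[of "p x"] by (simp add: power2_eq_square mult_ac)
  also have "\<dots> \<le> 3 * w x * 1" using w_pos[of x] by (intro mult_left_mono) (auto simp: w_p_sq)
  finally show "\<bar>Dw x (p x)\<bar> \<le> 3 * w x" by simp
  have "3 * w x * (w x * norm (p x)) * norm v \<le> 3 * w x * 1 * norm v"
    using w_p_le[of x] w_pos[of x] by (intro mult_left_mono mult_right_mono) auto
  then show "\<bar>Dw x v\<bar> \<le> 3 * w x * norm v" using *[of v] by simp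
qed

text \<open>The trace contributes \<open>3 N\<close> in dimension 3, and the quadratic term
  contributes \<open>2 N\<close> because \<open>w |p|^2 \<le> 1\<close>.\<close>

lemma r0_le: "\<bar>r0 x\<bar> \<le> 5 * w x * N x"
proof -
  have "\<bar>\<Sum>i\<in>Basis. E x i \<bullet> i\<bar> \<le> (\<Sum>i\<in>(Basis::'a set). N x)"
  proof (rule order_trans[OF sum_abs sum_mono])
    fix i :: 'a assume "i \<in> Basis"
    then show "\<bar>E x i \<bullet> i\<bar> \<le> N x"
      using Cauchy_Schwarz_ineq2[of "E x i" i] E_le[of x i] by simp
  qed
  also have "\<dots> = 3 * N x" using dim by simp
  finally have 1: "w x * \<bar>\<Sum>i\<in>Basis. E x i \<bullet> i\<bar> \<le> w x * (3 * N x)"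
    using w_pos[of x] by (intro mult_left_mono) auto
  have "\<bar>p x \<bullet> E x (p x)\<bar> \<le> norm (p x) * (N x * norm (p x))"
    by (rule order_trans[OF Cauchy_Schwarz_ineq2]) (intro mult_left_mono E_le norm_ge_zero)
  then have "2 * (w x)\<^sup>2 * \<bar>p x \<bullet> E x (p x)\<bar> \<le> 2 * (w x)\<^sup>2 * (norm (p x) * (N x * norm (p x)))"
    by (intro mult_left_mono) auto
  also have "\<dots> = 2 * w x * N x * (w x * (norm (p x))\<^sup>2)" by (simp add: power2_eq_square)
  also have "\<dots> \<le> 2 * w x * N x * 1"
    using w_pos[of x] N_nonneg[of x] by (intro mult_left_mono) (auto simp: w_p_sq)
  finally have 2: "2 * (w x)\<^sup>2 * \<bar>p x \<bullet> E x (p x)\<bar> \<le> 2 * w x * N x" by simp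
  have "\<bar>r0 x\<bar> \<le> w x * \<bar>\<Sum>i\<in>Basis. E x i \<bullet> i\<bar> + 2 * (w x)\<^sup>2 * \<bar>p x \<bullet> E x (p x)\<bar>"
    unfolding r0_def using w_pos[of x] by (intro order_trans[OF abs_triangle_ineq4]) (simp add: abs_mult)
  with 1 2 show ?thesis by simp
qed

text \<open>Since \<open>e = w (e + |p|\<^sup>2 e) = w e + \<i> w (p \<bullet> \<nabla> e)\<close>, integrating by parts gains a factor \<open>w\<close> without
  a cutoff near the critical point.  The divergence of \<open>w p\<close> is \<open>w + 2 w\<^sup>2 + r0\<close> in dimension 3.\<close>

lemma integration_by_parts:
  fixes b :: "'a \<Rightarrow> complex"
  assumes b: "\<And>x. (b has_derivative Db x) (at x)" and Db_cont: "\<And>v. continuous_on UNIV (\<lambda>x. Db x v)"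
    and \<delta>: "\<delta> > 0"
    and b_le: "\<And>x. norm (b x) \<le> C * exp (- (\<delta> * (norm x)\<^sup>2 / 2))"
    and Db_le: "\<And>x v. norm (Db x v) \<le> C * exp (- (\<delta> * (norm x)\<^sup>2 / 2)) * norm v"
  shows "(LBINT x. b x * e x)
    = (LBINT x. (b x * of_real (w x) - \<i> * of_real (w x) * Db x (p x)
         - \<i> * b x * of_real (w x + 2 * (w x)\<^sup>2 + r0 x)) * e x)"
proof -
  let ?g = "\<lambda>x::'a. C * exp (- (\<delta> * (norm x)\<^sup>2 / 2))"
  have g: "integrable lborel (\<lambda>x. K * ?g x)" for K
    using \<delta> by (intro integrable_mult_right integrable_gaussian)
  have g0: "?g x \<ge> 0" for x using order_trans[OF norm_ge_zero b_le] .
  have b_cont: "continuous_on UNIV b"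
    using b by (intro has_derivative_continuous_on) (auto intro: has_derivative_at_withinI)
  have integrableI: "integrable lborel f" if "continuous_on UNIV f" "\<And>x. norm (f x) \<le> K * ?g x" for f :: "'a \<Rightarrow> complex" and K
    by (rule Bochner_Integration.integrable_bound[OF g[of K]])
      (use that borel_measurable_continuous_onI[OF that(1)] order_trans[OF that(2) abs_ge_self] in auto)
  have w: "0 < w x" "w x \<le> 1" "w x * norm (p x) \<le> 1" for x
    using w_pos[of x] w_le_1[of x] w_p_le[of x] by auto
  \<comment> \<open>\<open>F i\<close> is the component along \<open>i\<close> of the field
    \<open>w p\<close> times \<open>b e\<close>. The sum of the \<open>F' i x i\<close> is its
    divergence, which integrates to 0.\<close>
  define F where "F i x = of_real (w x * (p x \<bullet> i)) * (b x * e x)" for i x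
  define F' where "F' i x v = of_real (Dw x v * (p x \<bullet> i) + w x * ((v + E x v) \<bullet> i)) * (b x * e x)
     + of_real (w x * (p x \<bullet> i)) * (Db x v * e x + b x * (of_real (- (p x \<bullet> v)) * (\<i> * e x)))" for i x v
  have F_deriv: "(F i has_derivative F' i x) (at x)" for i x unfolding F_def[abs_def] F'_def[abs_def]
    by (rule derivative_eq_intros w_deriv p b e_deriv refl | simp add: algebra_simps)+
  have zero: "integrable lborel (\<lambda>x. F' i x i) \<and> (LBINT x. F' i x i) = 0" if i: "i \<in> Basis" for i
  proof -
    have pi: "\<bar>p x \<bullet> i\<bar> \<le> norm (p x)" for x using Basis_le_norm[OF i] .
    have wpi: "w x * \<bar>p x \<bullet> i\<bar> \<le> 1" for x
      using mult_left_mono[OF pi[of x], of "w x"] w[of x] by linarith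
    have cont: "continuous_on UNIV (F i)"
      unfolding F_def[abs_def] by (intro continuous_intros w_cont p_cont b_cont e_cont)
    have cont': "continuous_on UNIV (\<lambda>x. F' i x i)"
      unfolding F'_def[abs_def] Dw_def[abs_def] by (intro continuous_intros w_cont p_cont b_cont e_cont E_cont Db_cont)
    have wpi': "\<bar>w x * (p x \<bullet> i)\<bar> \<le> 1" for x
      using wpi[of x] w[of x] by (simp add: abs_mult)
    have "norm (F i x) \<le> 1 * ?g x" for x
    proof -
      have "norm (F i x) = \<bar>w x * (p x \<bullet> i)\<bar> * norm (b x)"
        unfolding F_def norm_mult norm_of_real norm_e by simp
      also have "\<dots> \<le> 1 * ?g x" by (rule mult_mono[OF wpi' b_le]) auto
      finally show ?thesis .
    qed
    then have int: "integrable lborel (F i)" by (rule integrableI[OF cont])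
    \<comment> \<open>Only integrability is at stake here; 7 rounds up \<open>9 / 2 + 1 + 1\<close>.
      The critical term contains two factors \<open>p\<close>, which \<open>w |p|^2 \<le> 1\<close>
      compensates.\<close>
    have "norm (F' i x i) \<le> 7 * ?g x" for x
    proof -
      have "\<bar>Dw x i * (p x \<bullet> i)\<bar> \<le> 3 * w x * \<bar>p x \<bullet> i\<bar>"
        unfolding abs_mult using Dw_le[of x i] i by (intro mult_right_mono) auto
      moreover have "\<bar>w x * ((i + E x i) \<bullet> i)\<bar> \<le> 1 * (3 / 2)"
      proof -
        have "\<bar>(i + E x i) \<bullet> i\<bar> \<le> 3 / 2"
          using Cauchy_Schwarz_ineq2[of "i + E x i" i] norm_Dp_le[of i x] i by simp
        then show ?thesis unfolding abs_mult using w[of x] by (intro mult_mono) auto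
      qed
      ultimately have 1: "\<bar>Dw x i * (p x \<bullet> i) + w x * ((i + E x i) \<bullet> i)\<bar> \<le> 9 / 2"
        using wpi[of x] by linarith
      have "norm (F' i x i) \<le> \<bar>Dw x i * (p x \<bullet> i) + w x * ((i + E x i) \<bullet> i)\<bar> * norm (b x)
         + (\<bar>w x * (p x \<bullet> i)\<bar> * norm (Db x i) + \<bar>w x * (p x \<bullet> i)\<bar> * (norm (b x) * \<bar>p x \<bullet> i\<bar>))"
        unfolding F'_def
        by (rule order_trans[OF norm_triangle_ineq add_mono], simp only: norm_mult norm_of_real norm_e mult_1_right order_refl,
            unfold norm_mult norm_of_real distrib_left[symmetric], intro mult_left_mono order_trans[OF norm_triangle_ineq])
          (simp_all add: norm_mult)
      moreover have "\<bar>Dw x i * (p x \<bullet> i) + w x * ((i + E x i) \<bullet> i)\<bar> * norm (b x) \<le> 9 / 2 * ?g x"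
        by (intro mult_mono 1 b_le) auto
      moreover have "\<bar>w x * (p x \<bullet> i)\<bar> * norm (Db x i) \<le> 1 * ?g x"
        using Db_le[of x i] i by (intro mult_mono[OF wpi']) auto
      moreover have "\<bar>w x * (p x \<bullet> i)\<bar> * (norm (b x) * \<bar>p x \<bullet> i\<bar>) \<le> 1 * ?g x"
      proof -
        have "\<bar>w x * (p x \<bullet> i)\<bar> * \<bar>p x \<bullet> i\<bar> = w x * (\<bar>p x \<bullet> i\<bar> * \<bar>p x \<bullet> i\<bar>)"
          using w[of x] by (simp add: abs_mult)
        also have "\<dots> \<le> w x * (norm (p x) * norm (p x))"
          using w[of x] by (intro mult_left_mono mult_mono pi) auto
        also have "\<dots> \<le> 1" using w_p_sq[of x] w[of x] by (simp add: power2_eq_square)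
        finally have "(\<bar>w x * (p x \<bullet> i)\<bar> * \<bar>p x \<bullet> i\<bar>) * norm (b x) \<le> 1 * ?g x"
          by (intro mult_mono b_le) auto
        then show ?thesis by (simp add: mult_ac)
      qed
      ultimately show ?thesis using g0[of x] by linarith
    qed
    then have int': "integrable lborel (\<lambda>x. F' i x i)" by (rule integrableI[OF cont'])
    show ?thesis using integral_directional_derivative_eq_0[OF int int' cont' F_deriv] int' by simp
  qed
  let ?R = "\<lambda>x. b x * of_real (w x) - \<i> * of_real (w x) * Db x (p x) - \<i> * b x * of_real (w x + 2 * (w x)\<^sup>2 + r0 x)"
  \<comment> \<open>The derivative of \<open>e\<close> contributes
    \<open>- \<i> w |p|^2 b e\<close>, which equals \<open>- \<i> (1 - w) b e\<close>. This releases
    one full copy of \<open>b e\<close>, while every other term carries a factor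
    \<open>w\<close>.\<close>
  have sum: "(\<Sum>i\<in>Basis. F' i x i) = \<i> * (?R x * e x) - \<i> * (b x * e x)" for x
  proof -
    interpret Db: bounded_linear "Db x" using b by (rule has_derivative_bounded_linear)
    interpret E: bounded_linear "E x" by (rule E_bounded_linear)
    have s1: "(\<Sum>i\<in>Basis. (p x \<bullet> i) *\<^sub>R Db x i) = Db x (p x)"
      by (simp add: Db.scaleR[symmetric] Db.sum[symmetric] euclidean_representation)
    have s2: "(\<Sum>i\<in>Basis. (p x \<bullet> i) *\<^sub>R E x i) = E x (p x)"
      by (simp add: E.scaleR[symmetric] E.sum[symmetric] euclidean_representation)
    have s3: "(\<Sum>i\<in>Basis. (p x \<bullet> i) * (p x \<bullet> i)) = (norm (p x))\<^sup>2"
      unfolding power2_norm_eq_inner by (subst (3) euclidean_inner) simp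
    have s4: "(\<Sum>i\<in>Basis. (p x \<bullet> i) * (p x \<bullet> E x i)) = p x \<bullet> E x (p x)"
      by (simp add: s2[symmetric] inner_sum_right)
    have s5: "(\<Sum>i\<in>(Basis::'a set). i \<bullet> i) = 3" using dim by (simp add: inner_Basis)
    have D: "(\<Sum>i\<in>Basis. Dw x i * (p x \<bullet> i) + w x * ((i + E x i) \<bullet> i))
       = w x + 2 * (w x)\<^sup>2 + r0 x"
    proof -
      have "(\<Sum>i\<in>Basis. Dw x i * (p x \<bullet> i) + w x * ((i + E x i) \<bullet> i))
        = - 2 * (w x)\<^sup>2 * ((\<Sum>i\<in>Basis. (p x \<bullet> i) * (p x \<bullet> i)) + (\<Sum>i\<in>Basis. (p x \<bullet> i) * (p x \<bullet> E x i)))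
          + w x * ((\<Sum>i\<in>(Basis::'a set). i \<bullet> i) + (\<Sum>i\<in>Basis. E x i \<bullet> i))"
        unfolding sum.distrib[symmetric] sum_distrib_left Dw_def inner_add_left inner_add_right
        by (intro sum.cong refl) (simp add: algebra_simps)
      also have "\<dots> = - 2 * w x * (w x * (norm (p x))\<^sup>2) + 3 * w x + r0 x"
        unfolding s3 s4 s5 r0_def by (simp add: algebra_simps power2_eq_square)
      finally show ?thesis unfolding w_p_sq by (simp add: algebra_simps power2_eq_square)
    qed
    have "(\<Sum>i\<in>Basis. F' i x i) = of_real (\<Sum>i\<in>Basis. Dw x i * (p x \<bullet> i) + w x * ((i + E x i) \<bullet> i)) * (b x * e x)
       + of_real (w x) * ((\<Sum>i\<in>Basis. (p x \<bullet> i) *\<^sub>R Db x i) * e x - b x * \<i> * of_real (\<Sum>i\<in>Basis. (p x \<bullet> i) * (p x \<bullet> i)) * e x)"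
      unfolding F'_def of_real_sum sum_distrib_left sum_distrib_right sum_subtractf[symmetric] sum.distrib[symmetric]
      by (intro sum.cong refl) (simp add: scaleR_conv_of_real algebra_simps)
    also have "\<dots> = of_real (w x + 2 * (w x)\<^sup>2 + r0 x) * (b x * e x)
       + of_real (w x) * (Db x (p x) * e x) - b x * \<i> * of_real (w x * (norm (p x))\<^sup>2) * e x"
      unfolding D s1 s3 by (simp add: algebra_simps)
    also have "\<dots> = \<i> * (?R x * e x) - \<i> * (b x * e x)"
      unfolding w_p_sq by (simp add: algebra_simps)
    finally show ?thesis .
  qed
  have be: "integrable lborel (\<lambda>x. b x * e x)"
    by (rule integrableI[of _ 1]) (use b_le in \<open>auto intro!: continuous_intros b_cont e_cont simp: norm_mult\<close>)
  have int_sum: "integrable lborel (\<lambda>x. \<Sum>i\<in>Basis. F' i x i)"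
    using zero by (intro Bochner_Integration.integrable_sum) auto
  have "(LBINT x. (\<Sum>i\<in>Basis. F' i x i)) = 0"
    using zero by (subst Bochner_Integration.integral_sum) auto
  have R: "?R x * e x = b x * e x - \<i> * (\<Sum>i\<in>Basis. F' i x i)" for x
    unfolding sum by (simp add: algebra_simps)
  have "(LBINT x. ?R x * e x) = (LBINT x. b x * e x) - \<i> * (LBINT x. (\<Sum>i\<in>Basis. F' i x i))"
    unfolding R using be int_sum by (subst Bochner_Integration.integral_diff) auto
  then show ?thesis using \<open>(LBINT x. (\<Sum>i\<in>Basis. F' i x i)) = 0\<close> by simp
qed

end

section \<open>The second integration by parts: amplitude bounds uniform in the
  regularization\<close>

lemma gauss_deriv:
  fixes x :: "'a::real_inner"
  shows "((\<lambda>x. exp (- (\<epsilon> * (norm x)\<^sup>2))) has_derivative (\<lambda>v. - 2 * \<epsilon> * (x \<bullet> v) * exp (- (\<epsilon> * (norm x)\<^sup>2)))) (at x)"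
proof -
  have "((\<lambda>x. x \<bullet> x) has_derivative (\<lambda>v. x \<bullet> v + v \<bullet> x)) (at x)"
    by (intro has_derivative_inner has_derivative_ident)
  from has_derivative_exp[OF has_derivative_minus[OF has_derivative_mult_right[OF this]]]
  show ?thesis
    unfolding power2_norm_eq_inner by (rule has_derivative_eq_rhs) (auto simp: fun_eq_iff inner_commute)
qed

text \<open>A consequence of \<open>1 + y \<le> exp y\<close>. It lets half of the Gaussian exponent
  absorb a quadratic polynomial in \<open>X = sqrt \<epsilon> |x|\<close>.\<close>

lemma one_add_sq_mult_gauss_le: "(1 + X)\<^sup>2 * exp (- (X\<^sup>2 / 2)) \<le> 4" for X :: real
proof -
  have "(1 + X)\<^sup>2 \<le> 4 * (1 + X\<^sup>2 / 2)"
    using zero_le_power2[of "X - 1"] by (simp add: power2_sum power2_diff)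
  also have "\<dots> \<le> 4 * exp (X\<^sup>2 / 2)" by (intro mult_left_mono exp_ge_add_one_self) auto
  finally show ?thesis by (simp add: exp_minus field_simps)
qed

context nondegenerate_phase
begin

lemma r0_cont: "continuous_on UNIV r0"
  unfolding r0_def[abs_def] by (intro continuous_intros w_cont p_cont E_cont E_cont')

text \<open>The amplitude left by the first integration by parts of \<open>exp (- \<epsilon> |x|\<^sup>2)\<close>, without its \<open>r0\<close> part.
  It contains no second derivative of the phase.\<close>

definition b1 :: "real \<Rightarrow> 'a \<Rightarrow> complex"
  where "b1 \<epsilon> x = of_real (exp (- (\<epsilon> * (norm x)\<^sup>2)) * w x) *
    ((1 - \<i>) + \<i> * of_real (2 * \<epsilon> * (x \<bullet> p x) - 2 * w x))"

definition Db1 :: "real \<Rightarrow> 'a \<Rightarrow> 'a \<Rightarrow> complex"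
  where "Db1 \<epsilon> x v =
    of_real (- 2 * \<epsilon> * (x \<bullet> v) * exp (- (\<epsilon> * (norm x)\<^sup>2)) * w x + exp (- (\<epsilon> * (norm x)\<^sup>2)) * Dw x v) *
      ((1 - \<i>) + \<i> * of_real (2 * \<epsilon> * (x \<bullet> p x) - 2 * w x))
    + of_real (exp (- (\<epsilon> * (norm x)\<^sup>2)) * w x) *
      (\<i> * of_real (2 * \<epsilon> * (v \<bullet> p x + x \<bullet> (v + E x v)) - 2 * Dw x v))"

lemma b1_deriv: "(b1 \<epsilon> has_derivative Db1 \<epsilon> x) (at x)"
  unfolding b1_def[abs_def] Db1_def[abs_def]
  by (rule derivative_eq_intros gauss_deriv w_deriv p refl | simp add: algebra_simps)+

lemma Db1_cont: "continuous_on UNIV (\<lambda>x. Db1 \<epsilon> x v)"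
  unfolding Db1_def Dw_def by (intro continuous_intros w_cont p_cont E_cont)

lemma norm_B_le:
  assumes "\<epsilon> > 0"
  shows "norm ((1 - \<i>) + \<i> * of_real (2 * \<epsilon> * (x \<bullet> p x) - 2 * w x)) \<le> 4 + 2 * \<epsilon> * (norm x * norm (p x))"
proof -
  have "norm (1 - \<i>) \<le> 2" using norm_triangle_ineq4[of 1 \<i>] by simp
  moreover have "norm (\<i> * of_real (2 * \<epsilon> * (x \<bullet> p x) - 2 * w x)) \<le> 2 * \<epsilon> * (norm x * norm (p x)) + 2"
  proof -
    have "\<bar>2 * \<epsilon> * (x \<bullet> p x) - 2 * w x\<bar> \<le> 2 * \<epsilon> * \<bar>x \<bullet> p x\<bar> + 2 * w x"
      using assms w_pos[of x] abs_triangle_ineq4[of "2 * \<epsilon> * (x \<bullet> p x)" "2 * w x"] by (simp add: abs_mult)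
    moreover have "2 * \<epsilon> * \<bar>x \<bullet> p x\<bar> \<le> 2 * \<epsilon> * (norm x * norm (p x))"
      using assms by (intro mult_left_mono Cauchy_Schwarz_ineq2) auto
    ultimately show ?thesis using w_le_1[of x] by (simp add: norm_mult del: of_real_diff of_real_mult)
  qed
  ultimately show ?thesis using norm_triangle_ineq[of "1 - \<i>" "\<i> * of_real (2 * \<epsilon> * (x \<bullet> p x) - 2 * w x)"] by linarith
qed

end

text \<open>In the application \<open>s = sqrt \<epsilon>\<close>, \<open>X = s |x|\<close>,
  \<open>q = |p|\<close>, \<open>a\<close> is the Gaussian and \<open>g\<close> its square root. The
  growing terms are collected in \<open>u = s (1 + X) q\<close>; then one factor \<open>w\<close>
  absorbs \<open>q^2\<close>, \<open>g\<close> absorbs \<open>(1 + X)^2\<close>, and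
  \<open>4 w s^2 g \<le> w^2 / 2 + 8 s^4 a\<close> splits the rest into the integrable weight
  \<open>w^2\<close> and a Gaussian error.\<close>

lemma second_step_bound:
  fixes a w s X q :: real
  assumes a: "a \<le> 1" "g\<^sup>2 = a" "0 \<le> g" "(1 + X)\<^sup>2 * g \<le> 4" and w: "0 < w" "w * q\<^sup>2 \<le> 1"
    and s: "0 \<le> s" and X: "0 \<le> X" and q: "0 \<le> q"
  shows "a * w\<^sup>2 * (44 + 30 * (s * X * q) + 4 * (s * X * q)\<^sup>2 + 2 * (s * q)\<^sup>2) \<le> 69 * w\<^sup>2 + 152 * s ^ 4 * a"
proof -
  define u where "u = s * (1 + X) * q"
  have a0: "0 \<le> a" using a(2) by auto
  have sXq: "0 \<le> s * X * q" "0 \<le> s * q" using s X q by auto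
  have u: "u = s * X * q + s * q" by (simp add: u_def algebra_simps)
  have u2: "4 * (s * X * q)\<^sup>2 + 2 * (s * q)\<^sup>2 \<le> 4 * u\<^sup>2"
  proof -
    have "u\<^sup>2 = (s * X * q)\<^sup>2 + (s * q)\<^sup>2 + 2 * ((s * X * q) * (s * q))"
      unfolding u by (simp only: power2_sum mult.assoc)
    moreover have "0 \<le> (s * X * q) * (s * q)" using sXq by (rule mult_nonneg_nonneg)
    ultimately show ?thesis using zero_le_power2[of "s * q"] by linarith
  qed
  have "30 * (s * X * q) \<le> 15 + 15 * u\<^sup>2" using sum_squares_bound[of 1 u] sXq unfolding u by simp
  with u2 have "a * w\<^sup>2 * (44 + 30 * (s * X * q) + 4 * (s * X * q)\<^sup>2 + 2 * (s * q)\<^sup>2) \<le> a * w\<^sup>2 * (59 + 19 * u\<^sup>2)"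
    using a0 by (intro mult_left_mono) auto
  also have "\<dots> = 59 * (a * w\<^sup>2) + 19 * (a * w\<^sup>2 * u\<^sup>2)" by (simp add: algebra_simps)
  also have "\<dots> \<le> 59 * (1 * w\<^sup>2) + 19 * (w\<^sup>2 / 2 + 8 * s ^ 4 * a)"
  proof (intro add_mono mult_left_mono mult_right_mono a)
    have "a * w\<^sup>2 * u\<^sup>2 = (w * q\<^sup>2) * (w * s\<^sup>2 * g * ((1 + X)\<^sup>2 * g))"
      unfolding u_def a(2)[symmetric] by (simp add: power2_eq_square mult_ac)
    also have "\<dots> \<le> 1 * (w * s\<^sup>2 * g * 4)" using w a by (intro mult_mono mult_left_mono) auto
    also have "\<dots> \<le> w\<^sup>2 / 2 + 8 * s ^ 4 * a"
      using sum_squares_bound[of w "4 * s\<^sup>2 * g"] unfolding a(2)[symmetric]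
      by (simp add: power_mult_distrib power_mult[symmetric] mult_ac)
    finally show "a * w\<^sup>2 * u\<^sup>2 \<le> w\<^sup>2 / 2 + 8 * s ^ 4 * a" .
  qed auto
  also have "\<dots> = 69 * w\<^sup>2 + 152 * s ^ 4 * a - w\<^sup>2 / 2" by (simp add: algebra_simps)
  also have "\<dots> \<le> 69 * w\<^sup>2 + 152 * s ^ 4 * a" by simp
  finally show ?thesis .
qed

context nondegenerate_phase
begin

context
  fixes \<epsilon> :: real
  assumes \<epsilon>: "0 < \<epsilon>" "\<epsilon> \<le> 1"
begin

text \<open>The first two bounds only license the next integration by parts; the third estimates its
  integrand and carries the uniformity in \<epsilon>. Everything is measured in
  \<open>X = sqrt \<epsilon> |x|\<close> and \<open>Z = \<epsilon> |x| |p|\<close>, whose powers the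
  Gaussian and \<open>w\<close> can absorb.\<close>

lemma pointwise_bounds:
  shows norm_b1_le: "norm (b1 \<epsilon> x) \<le> 76 * exp (- (\<epsilon> * (norm x)\<^sup>2 / 2))"
    and norm_Db1_le: "norm (Db1 \<epsilon> x v) \<le> 76 * exp (- (\<epsilon> * (norm x)\<^sup>2 / 2)) * norm v"
    and norm_step_le: "norm (b1 \<epsilon> x * of_real (w x) - \<i> * of_real (w x) * Db1 \<epsilon> x (p x)
         - \<i> * b1 \<epsilon> x * of_real (w x + 2 * (w x)\<^sup>2 + r0 x))
       \<le> 69 * (w x)\<^sup>2 + 152 * \<epsilon>\<^sup>2 * exp (- (\<epsilon> * (norm x)\<^sup>2))"
proof -
  let ?c = "\<lambda>v. \<bar>w x * (2 * \<epsilon> * (x \<bullet> v)) - Dw x v\<bar>"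
  let ?d = "\<lambda>v. \<bar>2 * \<epsilon> * (v \<bullet> p x + x \<bullet> (v + E x v)) - 2 * Dw x v\<bar>"
  define s X q a g where "s = sqrt \<epsilon>" and "X = s * norm x" and "q = norm (p x)"
    and "a = exp (- (\<epsilon> * (norm x)\<^sup>2))" and "g = exp (- (\<epsilon> * (norm x)\<^sup>2 / 2))"
  define Z where "Z = s * X * q"
  let ?w = "w x" and ?B = "(1 - \<i>) + \<i> * of_real (2 * \<epsilon> * (x \<bullet> p x) - 2 * w x)"
  have s: "0 \<le> s" "s \<le> 1" "s * s = \<epsilon>" using \<epsilon> by (auto simp: s_def)
  have X: "0 \<le> X" "X\<^sup>2 = \<epsilon> * (norm x)\<^sup>2" using s \<epsilon> by (auto simp: X_def power_mult_distrib s_def)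
  have sq: "(1 + X)\<^sup>2 = 1 + 2 * X + X\<^sup>2" by (simp add: power2_sum)
  \<comment> \<open>The number 19 is dictated by \<open>X19\<close>, whose left side is what the
    derivative produces: \<open>(2 X + 3) (4 + X) + (7 + 3 X)\<close>. Together with the 4 of
    \<open>aX\<close> it becomes 76.\<close>
  have X4: "4 + X \<le> 19 * (1 + X)\<^sup>2"
  proof -
    have "0 \<le> 15 + 37 * X + 19 * X\<^sup>2" using X(1) by (intro add_nonneg_nonneg) auto
    then show ?thesis unfolding sq by (simp add: distrib_left)
  qed
  have X19: "2 * X\<^sup>2 + 14 * X + 19 \<le> 19 * (1 + X)\<^sup>2"
  proof -
    have "0 \<le> 24 * X + 17 * X\<^sup>2" using X(1) by (intro add_nonneg_nonneg) auto
    then show ?thesis unfolding sq by (simp add: distrib_left)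
  qed
  have q: "0 \<le> q" by (simp add: q_def)
  have w: "0 < ?w" "?w \<le> 1" "?w * q \<le> 1 / 2" "?w * q\<^sup>2 \<le> 1"
    using w_pos[of x] w_le_1[of x] w_p_le[of x] w_p_sq[of x] by (auto simp: q_def)
  have Z: "0 \<le> Z" "\<epsilon> * (norm x * q) = Z" using s X q by (auto simp: Z_def X_def mult_ac)
  have wZ: "?w * Z \<le> X / 2"
  proof -
    have "?w * Z = (s * X) * (?w * q)" by (simp add: Z_def mult_ac)
    also have "\<dots> \<le> (1 * X) * (1 / 2)" using s X w q by (intro mult_mono) auto
    finally show ?thesis by simp
  qed
  have \<epsilon>x: "\<epsilon> * norm x \<le> X"
  proof -
    have "\<epsilon> * norm x = s * X" by (simp add: X_def s(3)[symmetric])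
    also have "\<dots> \<le> 1 * X" using s X by (intro mult_right_mono) auto
    finally show ?thesis by simp
  qed
  have g: "g\<^sup>2 = a" "0 \<le> g" "0 \<le> a" "a \<le> 1" "(1 + X)\<^sup>2 * g \<le> 4"
    using one_add_sq_mult_gauss_le[of X] \<epsilon> by (auto simp: g_def a_def X exp_double[symmetric])
  have aX: "a * (1 + X)\<^sup>2 \<le> 4 * g"
  proof -
    have "a * (1 + X)\<^sup>2 = g * ((1 + X)\<^sup>2 * g)" unfolding g(1)[symmetric] by (simp add: power2_eq_square mult_ac)
    also have "\<dots> \<le> g * 4" using g by (intro mult_left_mono) auto
    finally show ?thesis by simp
  qed
  have B: "norm ?B \<le> 4 + 2 * Z" using norm_B_le[OF \<epsilon>(1), of x] Z(2) by (simp add: q_def[symmetric])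
  have wB: "?w * norm ?B \<le> 4 + X"
  proof -
    have "?w * norm ?B \<le> ?w * (4 + 2 * Z)" using B w by (intro mult_left_mono) auto
    also have "\<dots> \<le> 4 + X" using w wZ by (simp add: algebra_simps)
    finally show ?thesis .
  qed
  have b1_eq: "norm (b1 \<epsilon> x) = a * (?w * norm ?B)"
    unfolding b1_def norm_mult norm_of_real a_def[symmetric] using g w by simp
  have "norm (b1 \<epsilon> x) \<le> a * (4 + X)" unfolding b1_eq using wB g by (intro mult_left_mono) auto
  also have "\<dots> \<le> a * (19 * (1 + X)\<^sup>2)" by (intro mult_left_mono X4 g)
  finally show "norm (b1 \<epsilon> x) \<le> 76 * exp (- (\<epsilon> * (norm x)\<^sup>2 / 2))"
    using aX by (simp add: g_def[symmetric])
  have Db1_eq: "norm (Db1 \<epsilon> x v) \<le> a * (?c v) * norm ?B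
      + a * (?w * (?d v))" for v
  proof -
    have "\<bar>- 2 * \<epsilon> * (x \<bullet> v) * a * ?w + a * Dw x v\<bar> = a * (?c v)"
    proof -
      have "- 2 * \<epsilon> * (x \<bullet> v) * a * ?w + a * Dw x v = - (a * (?w * (2 * \<epsilon> * (x \<bullet> v)) - Dw x v))"
        by (simp add: algebra_simps)
      then show ?thesis using g by (simp add: abs_mult)
    qed
    then show ?thesis unfolding Db1_def a_def[symmetric]
      by (intro order_trans[OF norm_triangle_ineq]) (use g w in \<open>simp add: norm_mult abs_mult del: of_real_add of_real_diff of_real_mult\<close>)
  qed
  have v2: "\<bar>x \<bullet> (v + E x v)\<bar> \<le> norm x * (3 / 2 * norm v)" for v
    by (rule order_trans[OF Cauchy_Schwarz_ineq2]) (intro mult_left_mono norm_Dp_le norm_ge_zero)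
  have Ev: "\<epsilon> * (norm x * (3 / 2 * norm v)) \<le> 3 / 2 * X * norm v" for v :: 'a
    using mult_right_mono[OF \<epsilon>x norm_ge_zero[of v]] by (simp add: mult_ac)
  have "norm (Db1 \<epsilon> x v) \<le> a * (19 * (1 + X)\<^sup>2) * norm v"
  proof -
    have 1: "(?c v) \<le> ?w * ((2 * X + 3) * norm v)"
    proof -
      have "\<epsilon> * \<bar>x \<bullet> v\<bar> \<le> X * norm v"
      proof -
        have "\<epsilon> * \<bar>x \<bullet> v\<bar> \<le> \<epsilon> * (norm x * norm v)"
          using \<epsilon> by (intro mult_left_mono Cauchy_Schwarz_ineq2) auto
        also have "\<dots> \<le> X * norm v"
          using mult_right_mono[OF \<epsilon>x norm_ge_zero[of v]] by (simp add: mult.assoc)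
        finally show ?thesis .
      qed
      then have "?w * (\<epsilon> * \<bar>x \<bullet> v\<bar>) \<le> ?w * (X * norm v)" using w by (intro mult_left_mono) auto
      moreover have "(?c v) \<le> 2 * (?w * (\<epsilon> * \<bar>x \<bullet> v\<bar>)) + 3 * ?w * norm v"
        using Dw_le[of x v] w \<epsilon> by (intro order_trans[OF abs_triangle_ineq4]) (simp add: abs_mult)
      ultimately show ?thesis by (simp add: algebra_simps)
    qed
    have "(?c v) * norm ?B \<le> ?w * ((2 * X + 3) * norm v) * norm ?B" by (rule mult_right_mono[OF 1]) simp
    also have "\<dots> = (2 * X + 3) * norm v * (?w * norm ?B)" by (simp add: mult_ac)
    also have "\<dots> \<le> (2 * X + 3) * norm v * (4 + X)" using X wB by (intro mult_left_mono) auto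
    finally have 2: "(?c v) * norm ?B \<le> ((2 * X + 3) * (4 + X)) * norm v" by (simp add: mult_ac)
    have 3: "?w * (?d v) \<le> (7 + 3 * X) * norm v"
    proof -
      have "?w * (\<epsilon> * \<bar>v \<bullet> p x\<bar>) \<le> 1 / 2 * norm v"
      proof -
        have "?w * (\<epsilon> * \<bar>v \<bullet> p x\<bar>) \<le> ?w * (1 * (norm v * q))"
          using w \<epsilon> Cauchy_Schwarz_ineq2[of v "p x"] by (intro mult_left_mono mult_mono) (auto simp: q_def)
        also have "\<dots> = (?w * q) * norm v" by simp
        also have "\<dots> \<le> 1 / 2 * norm v" using w by (intro mult_right_mono) auto
        finally show ?thesis .
      qed
      moreover have "?w * (\<epsilon> * \<bar>x \<bullet> (v + E x v)\<bar>) \<le> 1 * (3 / 2 * X * norm v)"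
        by (rule mult_mono[OF w(2) order_trans[OF mult_left_mono[OF v2[of v]] Ev[of v]]]) (use \<epsilon> in auto)
      moreover have "?w * \<bar>Dw x v\<bar> \<le> 1 * (3 * norm v)"
      proof -
        have "3 * ?w * norm v \<le> 3 * 1 * norm v" using w by (intro mult_left_mono mult_right_mono) auto
        then have "\<bar>Dw x v\<bar> \<le> 3 * norm v" using Dw_le[of x v] by linarith
        then show ?thesis using w by (intro mult_mono) auto
      qed
      moreover have "(?d v)
          \<le> 2 * (\<epsilon> * \<bar>v \<bullet> p x\<bar>) + 2 * (\<epsilon> * \<bar>x \<bullet> (v + E x v)\<bar>) + 2 * \<bar>Dw x v\<bar>"
      proof -
        have "\<bar>2 * \<epsilon> * (v \<bullet> p x + x \<bullet> (v + E x v))\<bar> \<le> 2 * \<epsilon> * (\<bar>v \<bullet> p x\<bar> + \<bar>x \<bullet> (v + E x v)\<bar>)"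
          unfolding abs_mult[of "2 * \<epsilon>"] using \<epsilon> by (intro mult_mono abs_triangle_ineq) auto
        then show ?thesis using abs_triangle_ineq4[of "2 * \<epsilon> * (v \<bullet> p x + x \<bullet> (v + E x v))" "2 * Dw x v"]
          by (simp add: distrib_left mult.assoc abs_mult[of 2 "Dw _ _"])
      qed
      from mult_left_mono[OF this, of ?w]
      have "?w * (?d v)
          \<le> 2 * (?w * (\<epsilon> * \<bar>v \<bullet> p x\<bar>)) + 2 * (?w * (\<epsilon> * \<bar>x \<bullet> (v + E x v)\<bar>)) + 2 * (?w * \<bar>Dw x v\<bar>)"
        using w by (simp add: distrib_left mult.left_commute)
      ultimately show ?thesis by (simp add: distrib_right)
    qed
    have "norm (Db1 \<epsilon> x v) \<le> a * (((2 * X + 3) * (4 + X)) * norm v) + a * ((7 + 3 * X) * norm v)"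
      by (rule order_trans[OF Db1_eq]) (unfold mult.assoc[of a], intro add_mono mult_left_mono 2 3 g)
    also have "\<dots> = a * (2 * X\<^sup>2 + 14 * X + 19) * norm v" by (simp add: algebra_simps power2_eq_square)
    also have "\<dots> \<le> a * (19 * (1 + X)\<^sup>2) * norm v"
      by (intro mult_left_mono mult_right_mono X19 g norm_ge_zero)
    finally show ?thesis .
  qed
  also have "\<dots> \<le> 76 * g * norm v" using aX by (intro mult_right_mono) auto
  finally show "norm (Db1 \<epsilon> x v) \<le> 76 * exp (- (\<epsilon> * (norm x)\<^sup>2 / 2)) * norm v"
    by (simp add: g_def)
  \<comment> \<open>In the direction \<open>p\<close> a factor \<open>w\<close> survives, because
    \<open>Dw x (p x)\<close> is bounded by \<open>3 w\<close>; the general bound for direction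
    \<open>v\<close> has lost it. The term \<open>(s q)^2\<close>, that is \<epsilon> |p|^2, comes
    from differentiating the factor \<open>x\<close> in \<open>x \<bullet> p x\<close>.\<close>
  have Db1p: "norm (Db1 \<epsilon> x (p x)) \<le> a * ?w * (18 + 17 * Z + 4 * Z\<^sup>2 + 2 * (s * q)\<^sup>2)"
  proof -
    have xp: "\<epsilon> * \<bar>x \<bullet> p x\<bar> \<le> Z"
    proof -
      have "\<epsilon> * \<bar>x \<bullet> p x\<bar> \<le> \<epsilon> * (norm x * q)"
        unfolding q_def using \<epsilon> by (intro mult_left_mono Cauchy_Schwarz_ineq2) auto
      then show ?thesis unfolding Z(2) .
    qed
    have "?c (p x) \<le> 2 * (?w * (\<epsilon> * \<bar>x \<bullet> p x\<bar>)) + 3 * ?w"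
      using Dw_p_le[of x] w \<epsilon> by (intro order_trans[OF abs_triangle_ineq4]) (simp add: abs_mult)
    also have "\<dots> \<le> 2 * (?w * Z) + 3 * ?w" using xp w by (intro add_mono mult_left_mono) auto
    finally have "?c (p x) * norm ?B \<le> (2 * (?w * Z) + 3 * ?w) * (4 + 2 * Z)"
      using B w Z by (intro mult_mono) auto
    then have 1: "?c (p x) * norm ?B \<le> ?w * ((2 * Z + 3) * (4 + 2 * Z))" by (simp add: algebra_simps)
    have 2: "?d (p x) \<le> 2 * (s * q)\<^sup>2 + 3 * Z + 6"
    proof -
      have "\<epsilon> * \<bar>x \<bullet> (p x + E x (p x))\<bar> \<le> 3 / 2 * Z"
      proof -
        have "\<epsilon> * \<bar>x \<bullet> (p x + E x (p x))\<bar> \<le> \<epsilon> * (norm x * (3 / 2 * q))"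
          unfolding q_def using \<epsilon> by (intro mult_left_mono v2) auto
        also have "\<dots> = 3 / 2 * (\<epsilon> * (norm x * q))" by (simp only: mult_ac)
        finally show ?thesis unfolding Z(2) .
      qed
      moreover have "\<epsilon> * (p x \<bullet> p x) = (s * q)\<^sup>2"
        by (simp add: q_def power_mult_distrib power2_norm_eq_inner) (simp add: s(3)[symmetric] power2_eq_square)
      moreover have "\<bar>Dw x (p x)\<bar> \<le> 3" using Dw_p_le[of x] w by linarith
      moreover have "?d (p x)
          \<le> 2 * (\<epsilon> * (p x \<bullet> p x)) + 2 * (\<epsilon> * \<bar>x \<bullet> (p x + E x (p x))\<bar>) + 2 * \<bar>Dw x (p x)\<bar>"
      proof -
        have "\<bar>2 * \<epsilon> * (p x \<bullet> p x + x \<bullet> (p x + E x (p x)))\<bar> \<le> 2 * \<epsilon> * (\<bar>p x \<bullet> p x\<bar> + \<bar>x \<bullet> (p x + E x (p x))\<bar>)"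
          unfolding abs_mult[of "2 * \<epsilon>"] using \<epsilon> by (intro mult_mono abs_triangle_ineq) auto
        then show ?thesis using abs_triangle_ineq4[of "2 * \<epsilon> * (p x \<bullet> p x + x \<bullet> (p x + E x (p x)))" "2 * Dw x (p x)"]
          by (simp add: distrib_left mult.assoc abs_mult[of 2 "Dw _ _"])
      qed
      ultimately show ?thesis by linarith
    qed
    have "norm (Db1 \<epsilon> x (p x)) \<le> a * (?w * ((2 * Z + 3) * (4 + 2 * Z))) + a * (?w * (2 * (s * q)\<^sup>2 + 3 * Z + 6))"
      by (rule order_trans[OF Db1_eq], unfold mult.assoc[of a], intro add_mono mult_left_mono 1 2) (use g w in auto)
    also have "\<dots> = a * ?w * (18 + 17 * Z + 4 * Z\<^sup>2 + 2 * (s * q)\<^sup>2)"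
      by (simp add: algebra_simps power2_eq_square)
    finally show ?thesis .
  qed
  \<comment> \<open>Here \<open>11 / 2 = 1 + 2 + 5 / 2\<close>, the last summand from
    \<open>r0_le\<close> with \<open>N \<le> 1 / 2\<close>.\<close>
  have r: "\<bar>?w + 2 * ?w\<^sup>2 + r0 x\<bar> \<le> 11 / 2 * ?w"
  proof -
    have "5 * ?w * N x \<le> 5 * ?w * (1 / 2)" using w N_le[of x] by (intro mult_left_mono) auto
    moreover have "?w\<^sup>2 \<le> ?w" using w by (simp add: power2_eq_square mult_left_le)
    ultimately show ?thesis using r0_le[of x] w zero_le_power2[of ?w] unfolding abs_le_iff by linarith
  qed
  have b1': "norm (b1 \<epsilon> x) \<le> a * ?w * (4 + 2 * Z)"
    unfolding b1_eq mult.assoc[symmetric] by (rule mult_left_mono[OF B]) (use w g in auto)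
  have "norm (b1 \<epsilon> x * of_real ?w - \<i> * of_real ?w * Db1 \<epsilon> x (p x) - \<i> * b1 \<epsilon> x * of_real (?w + 2 * ?w\<^sup>2 + r0 x))
     \<le> norm (b1 \<epsilon> x) * ?w + ?w * norm (Db1 \<epsilon> x (p x)) + norm (b1 \<epsilon> x) * \<bar>?w + 2 * ?w\<^sup>2 + r0 x\<bar>"
    by (intro order_trans[OF norm_triangle_ineq4] add_mono)
      (use w in \<open>simp_all add: norm_mult del: of_real_add of_real_mult\<close>)
  also have "\<dots> \<le> (a * ?w * (4 + 2 * Z)) * ?w + ?w * (a * ?w * (18 + 17 * Z + 4 * Z\<^sup>2 + 2 * (s * q)\<^sup>2))
      + (a * ?w * (4 + 2 * Z)) * (11 / 2 * ?w)"
    using w g Z by (intro add_mono mult_mono b1' Db1p r order_refl) auto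
  \<comment> \<open>The coefficients add up as \<open>44 = 4 + 18 + 22\<close> and
    \<open>30 = 2 + 17 + 11\<close>.\<close>
  also have "\<dots> = a * ?w\<^sup>2 * (44 + 30 * Z + 4 * Z\<^sup>2 + 2 * (s * q)\<^sup>2)"
    by (simp add: algebra_simps power2_eq_square)
  also have "\<dots> \<le> 69 * ?w\<^sup>2 + 152 * s ^ 4 * a"
    unfolding Z_def using g w s X q by (intro second_step_bound[of a g]) auto
  also have "s ^ 4 = \<epsilon>\<^sup>2" unfolding s(3)[symmetric] by (simp add: power2_eq_square power4_eq_xxxx)
  finally show "norm (b1 \<epsilon> x * of_real (w x) - \<i> * of_real (w x) * Db1 \<epsilon> x (p x)
         - \<i> * b1 \<epsilon> x * of_real (w x + 2 * (w x)\<^sup>2 + r0 x))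
       \<le> 69 * (w x)\<^sup>2 + 152 * \<epsilon>\<^sup>2 * exp (- (\<epsilon> * (norm x)\<^sup>2))"
    by (simp add: a_def)
qed

end


text \<open>The exact value is \<open>sqrt \<epsilon>\<close> times \<open>sqrt pi ^ 3\<close>: the
  factor \<open>\<epsilon>^2\<close> left by the second step outweighs the
  \<open>\<epsilon> powr (- 3 / 2)\<close> of the Gaussian integral in dimension 3.\<close>

lemma integral_gaussian_weight:
  assumes \<epsilon>: "0 < \<epsilon>" "\<epsilon> \<le> 1"
  shows "(LBINT x. \<epsilon>\<^sup>2 * exp (- (\<epsilon> * (norm (x :: 'a))\<^sup>2))) \<le> sqrt pi ^ 3"
proof -
  have "(LBINT x. \<epsilon>\<^sup>2 * exp (- (\<epsilon> * (norm (x :: 'a))\<^sup>2))) = \<epsilon>\<^sup>2 * sqrt (pi / \<epsilon>) ^ 3"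
    using integral_gaussian[of "2 * \<epsilon>", where 'a='a] \<epsilon> dim by simp
  also have "\<dots> = sqrt \<epsilon> * sqrt pi ^ 3"
  proof -
    have "\<epsilon>\<^sup>2 = sqrt \<epsilon> ^ 4" using \<epsilon> by (simp add: power4_eq_xxxx power2_eq_square)
    moreover have "sqrt \<epsilon> ^ 4 * (sqrt pi / sqrt \<epsilon>) ^ 3 = sqrt \<epsilon> * sqrt pi ^ 3"
      using \<epsilon> by (simp add: power_divide eval_nat_numeral)
    ultimately show ?thesis by (simp add: real_sqrt_divide)
  qed
  also have "\<dots> \<le> 1 * sqrt pi ^ 3" using \<epsilon> by (intro mult_right_mono) auto
  finally show ?thesis by simp
qed

text \<open>After the first integration by parts the Hessian part is taken in absolute value, which
  gives \<open>5 R\<close> by \<open>r0_le\<close>. Only \<open>b1\<close> is integrated by parts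
  again, and \<open>norm_step_le\<close> bounds the outcome by \<open>w^2\<close> plus the Gaussian
  error.\<close>

theorem oscillatory_integral_bound:
  assumes \<epsilon>: "0 < \<epsilon>" "\<epsilon> \<le> 1"
    and w2: "integrable lborel (\<lambda>x. (w x)\<^sup>2)" "(LBINT x. (w x)\<^sup>2) \<le> I"
    and Nm: "N \<in> borel_measurable borel" and wN: "(\<integral>\<^sup>+x. ennreal (w x * N x) \<partial>lborel) \<le> ennreal R" and R: "R \<ge> 0"
  shows "norm (LBINT x. of_real (exp (- (\<epsilon> * (norm x)\<^sup>2))) * e x) \<le> 69 * I + 152 * sqrt pi ^ 3 + 5 * R"
proof -
  let ?a = "\<lambda>x::'a. exp (- (\<epsilon> * (norm x)\<^sup>2))" and ?g = "\<lambda>x::'a. exp (- (\<epsilon> * (norm x)\<^sup>2 / 2))"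
  have ag: "?a x = ?g x * ?g x" for x by (simp flip: exp_add)
  have g1: "?g x \<le> 1" for x using \<epsilon> by simp
  have g_int: "integrable lborel (\<lambda>x. K * ?g x)" for K
    using \<epsilon> by (intro integrable_mult_right integrable_gaussian)
  have integrableI: "integrable lborel f" if "continuous_on UNIV f" "\<And>x. norm (f x) \<le> K * ?g x" for f :: "'a \<Rightarrow> complex" and K
    by (rule Bochner_Integration.integrable_bound[OF g_int[of K]])
      (use that borel_measurable_continuous_onI[OF that(1)] order_trans[OF that(2) abs_ge_self] in auto)
  let ?Da = "\<lambda>x v. complex_of_real (- 2 * \<epsilon> * (x \<bullet> v) * ?a x)"
  have "(LBINT x. of_real (?a x) * e x) = (LBINT x. (of_real (?a x) * of_real (w x) - \<i> * of_real (w x) * ?Da x (p x)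
       - \<i> * of_real (?a x) * of_real (w x + 2 * (w x)\<^sup>2 + r0 x)) * e x)"
  \<comment> \<open>The constant 2 serves only the decay required to integrate by parts and does not
    enter the final bound. Half of the exponent is spent on the factor \<open>\<epsilon> |x|\<close>
    of the derivative.\<close>
  proof (rule integration_by_parts[where C=2, OF _ _ \<epsilon>(1)])
    show "((\<lambda>x. complex_of_real (?a x)) has_derivative ?Da x) (at x)" for x
      by (intro has_derivative_of_real gauss_deriv)
    show "continuous_on UNIV (\<lambda>x. ?Da x v)" for v by (intro continuous_intros)
    show "norm (complex_of_real (?a x)) \<le> 2 * ?g x" for x
    proof -
      have "?a x \<le> 2 * ?g x" unfolding ag by (intro mult_right_mono order_trans[OF g1]) auto
      then show ?thesis by simp
    qed
    show "norm (?Da x v) \<le> 2 * ?g x * norm v" for x v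
    proof -
      define X where "X = sqrt \<epsilon> * norm x"
      have X: "0 \<le> X" "X\<^sup>2 = \<epsilon> * (norm x)\<^sup>2" using \<epsilon> by (auto simp: X_def power_mult_distrib)
      have "\<epsilon> * norm x = sqrt \<epsilon> * X" using \<epsilon> by (simp add: X_def)
      also have "\<dots> \<le> 1 * X" using \<epsilon> X by (intro mult_right_mono) auto
      finally have 1: "\<epsilon> * norm x \<le> X" by simp
      have "X \<le> 1 + X\<^sup>2 / 2" using zero_le_power2[of "X - 1"] by (simp add: power2_diff)
      also have "\<dots> \<le> exp (X\<^sup>2 / 2)" by (rule exp_ge_add_one_self)
      finally have 3: "X * ?g x \<le> 1" unfolding X(2) by (simp add: exp_minus field_simps)
      have 2: "(\<epsilon> * norm x) * ?g x \<le> 1" by (rule order_trans[OF mult_right_mono[OF 1] 3]) simp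
      have "norm (?Da x v) = 2 * \<epsilon> * \<bar>x \<bullet> v\<bar> * ?a x" using \<epsilon> by (simp add: norm_mult abs_mult)
      also have "\<dots> \<le> 2 * \<epsilon> * (norm x * norm v) * ?a x"
        using \<epsilon> by (intro mult_right_mono mult_left_mono Cauchy_Schwarz_ineq2) auto
      also have "\<dots> = 2 * ?g x * norm v * ((\<epsilon> * norm x) * ?g x)" unfolding ag by (simp add: mult_ac)
      also have "\<dots> \<le> 2 * ?g x * norm v * 1" by (intro mult_left_mono 2) auto
      finally show ?thesis by simp
    qed
  qed
  also have "(\<lambda>x. (of_real (?a x) * of_real (w x) - \<i> * of_real (w x) * ?Da x (p x)
       - \<i> * of_real (?a x) * of_real (w x + 2 * (w x)\<^sup>2 + r0 x)) * e x)
     = (\<lambda>x. b1 \<epsilon> x * e x - \<i> * of_real (?a x * r0 x) * e x)"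
    by (rule ext) (simp add: b1_def algebra_simps power2_eq_square)
  also have "(LBINT x. b1 \<epsilon> x * e x - \<i> * of_real (?a x * r0 x) * e x)
     = (LBINT x. b1 \<epsilon> x * e x) - (LBINT x. \<i> * of_real (?a x * r0 x) * e x)"
  proof (rule Bochner_Integration.integral_diff)
    have "continuous_on UNIV (b1 \<epsilon>)"
      unfolding b1_def[abs_def] by (intro continuous_intros w_cont p_cont)
    then show "integrable lborel (\<lambda>x. b1 \<epsilon> x * e x)"
      using norm_b1_le[OF \<epsilon>] by (intro integrableI[of _ 76] continuous_intros e_cont) (auto simp: norm_mult)
    show "integrable lborel (\<lambda>x. \<i> * of_real (?a x * r0 x) * e x)"
    proof (rule integrableI[of _ 3])
      show "continuous_on UNIV (\<lambda>x. \<i> * of_real (?a x * r0 x) * e x)"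
        by (intro continuous_intros r0_cont e_cont)
      fix x
      have "5 * w x * N x \<le> 5 * 1 * (1 / 2)"
        using w_pos[of x] w_le_1[of x] N_nonneg[of x] N_le[of x] by (intro mult_mono) auto
      then have "\<bar>r0 x\<bar> \<le> 3" using r0_le[of x] by linarith
      then have "?g x * (?g x * \<bar>r0 x\<bar>) \<le> ?g x * (1 * 3)" by (intro mult_left_mono mult_mono g1) auto
      then show "norm (\<i> * of_real (?a x * r0 x) * e x) \<le> 3 * ?g x"
        unfolding ag by (simp add: norm_mult abs_mult mult_ac)
    qed
  qed
  finally have split: "(LBINT x. of_real (?a x) * e x)
     = (LBINT x. b1 \<epsilon> x * e x) - (LBINT x. \<i> * of_real (?a x * r0 x) * e x)" .
  have "norm (LBINT x. b1 \<epsilon> x * e x) \<le> 69 * I + 152 * sqrt pi ^ 3"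
  proof -
    let ?T = "\<lambda>x. (b1 \<epsilon> x * of_real (w x) - \<i> * of_real (w x) * Db1 \<epsilon> x (p x)
         - \<i> * b1 \<epsilon> x * of_real (w x + 2 * (w x)\<^sup>2 + r0 x))"
    have "(LBINT x. b1 \<epsilon> x * e x) = (LBINT x. ?T x * e x)"
      by (rule integration_by_parts[OF b1_deriv Db1_cont \<epsilon>(1) norm_b1_le[OF \<epsilon>] norm_Db1_le[OF \<epsilon>]])
    then have "norm (LBINT x. b1 \<epsilon> x * e x) \<le> (LBINT x. norm (?T x * e x))"
      using integral_norm_bound by simp
    also have "\<dots> \<le> (LBINT x. 69 * (w x)\<^sup>2 + 152 * (\<epsilon>\<^sup>2 * ?a x))"
    proof (rule integral_mono')
      show "integrable lborel (\<lambda>x. 69 * (w x)\<^sup>2 + 152 * (\<epsilon>\<^sup>2 * ?a x))"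
        using integrable_gaussian[of "2 * \<epsilon>", where 'a='a] \<epsilon>
        by (intro Bochner_Integration.integrable_add integrable_mult_right w2) auto
      show "norm (?T x * e x) \<le> 69 * (w x)\<^sup>2 + 152 * (\<epsilon>\<^sup>2 * ?a x)" for x
        using norm_step_le[OF \<epsilon>, of x] unfolding norm_mult[of _ "e x"] norm_e mult_1_right mult.assoc[of 152] .
    qed (auto simp: norm_mult)
    also have "\<dots> = 69 * (LBINT x. (w x)\<^sup>2) + 152 * (LBINT x. \<epsilon>\<^sup>2 * ?a x)"
      using integrable_gaussian[of "2 * \<epsilon>", where 'a='a] \<epsilon> w2
      by (subst Bochner_Integration.integral_add) auto
    also have "\<dots> \<le> 69 * I + 152 * sqrt pi ^ 3"
      using integral_gaussian_weight[OF \<epsilon>] w2 by (intro add_mono mult_left_mono) auto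
    finally show ?thesis .
  qed
  moreover have "norm (LBINT x. \<i> * of_real (?a x * r0 x) * e x) \<le> 5 * R"
  proof -
    have "ennreal (norm (LBINT x. \<i> * of_real (?a x * r0 x) * e x)) \<le> ennreal (LBINT x. norm (\<i> * of_real (?a x * r0 x) * e x))"
      by (intro ennreal_leI integral_norm_bound)
    also have "\<dots> \<le> (\<integral>\<^sup>+x. ennreal (norm (\<i> * of_real (?a x * r0 x) * e x)) \<partial>lborel)"
      by (rule ennreal_integral_le_nn_integral) simp
    also have "\<dots> \<le> (\<integral>\<^sup>+x. 5 * ennreal (w x * N x) \<partial>lborel)"
    proof (rule nn_integral_mono)
      fix x
      have "?a x * \<bar>r0 x\<bar> \<le> 1 * (5 * (w x * N x))"
        using r0_le[of x] \<epsilon> by (intro mult_mono) (auto simp: mult.assoc)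
      then have "ennreal (?a x * \<bar>r0 x\<bar>) \<le> ennreal (5 * (w x * N x))" by (intro ennreal_leI) simp
      then show "ennreal (norm (\<i> * of_real (?a x * r0 x) * e x)) \<le> 5 * ennreal (w x * N x)"
        using w_pos[of x] N_nonneg[of x] by (simp add: norm_mult abs_mult ennreal_mult)
    qed
    also have "\<dots> = 5 * (\<integral>\<^sup>+x. ennreal (w x * N x) \<partial>lborel)"
    proof (rule nn_integral_cmult)
      have [measurable]: "w \<in> borel_measurable lborel" "N \<in> borel_measurable lborel"
        using borel_measurable_continuous_onI[OF w_cont] Nm by simp_all
      show "(\<lambda>x. ennreal (w x * N x)) \<in> borel_measurable lborel" by measurable
    qed
    also have "\<dots> \<le> 5 * ennreal R" by (intro mult_left_mono wN) auto
    also have "\<dots> = ennreal (5 * R)" using R by (simp add: ennreal_mult)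
    finally show ?thesis using R by simp
  qed
  ultimately show ?thesis unfolding split using norm_triangle_ineq4 by (smt (verit))
qed

end

section \<open>Lorentz spaces and the weight $|x|^{-2}$\<close>

lemma Lorentz_norm_3_1:
  "Lorentz_norm 3 1 f = (\<integral>\<^sup>+s. ennreal (s powr (- 2 / 3)) * rearrangement f s * indicator {0<..} s \<partial>lborel)"
proof -
  have 1: "ennpowr x 1 = x" for x by (cases x) (auto simp: ennpowr_def)
  have "Lorentz_norm 3 1 f = (\<integral>\<^sup>+s. ennreal (s powr (1 / 3)) * rearrangement f s * ennreal (1 / s) * indicator {0<..} s \<partial>lborel)"
    by (simp add: Lorentz_norm_def 1)
  also have "\<dots> = (\<integral>\<^sup>+s. ennreal (s powr (- 2 / 3)) * rearrangement f s * indicator {0<..} s \<partial>lborel)"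
  proof (rule nn_integral_cong)
    fix s :: real
    show "ennreal (s powr (1 / 3)) * rearrangement f s * ennreal (1 / s) * indicator {0<..} s
        = ennreal (s powr (- 2 / 3)) * rearrangement f s * indicator {0<..} s"
    proof (cases "s > 0")
      case True
      have "s powr (- 2 / 3) = s powr (1 / 3 - 1)" by simp
      also have "\<dots> = s powr (1 / 3) * (1 / s)" using True by (simp only: powr_diff powr_one) simp
      finally have eq: "s powr (- 2 / 3) = s powr (1 / 3) * (1 / s)" .
      have "ennreal (s powr (- 2 / 3)) = ennreal (s powr (1 / 3)) * ennreal (1 / s)"
        unfolding eq using True by (intro ennreal_mult) auto
      then show ?thesis by (simp add: mult_ac)
    qed simp
  qed
  finally show ?thesis .
qed

lemma powr_int_cube: "(x powr (- 1 / 2)) ^ 3 = x powr (- 3 / 2)" if "x > 0" for x :: real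
  using that by (simp add: powr_power)

text \<open>Layer cake in the height \<open>u\<close> of the weight: its superlevel set lies in a
  ball of radius \<open>u powr (- 1 / 2)\<close> and volume \<open>V * u powr (- 3 / 2)\<close>, so
  its part in \<open>S\<close> has measure at most the smaller of \<open>m\<close> and that
  volume.\<close>

lemma nn_integral_inverse_square_on_set:
  fixes c :: "'a::euclidean_space"
  assumes dim: "DIM('a) = 3" and [measurable]: "S \<in> sets borel" and m: "emeasure lborel S = ennreal m" "m > 0"
  shows "(\<integral>\<^sup>+x. indicator S x * ennreal (1 / (norm (x - c))\<^sup>2) \<partial>lborel) \<le> ennreal ((1 + 2 * unit_ball_vol 3) * m powr (1 / 3))"
proof -
  let ?k = "\<lambda>x::'a. 1 / (norm (x - c))\<^sup>2" and ?V = "unit_ball_vol 3"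
  \<comment> \<open>At this height both bounds are of order \<open>m\<close>. Below it the
    contribution is \<open>m * U = m powr (1 / 3)\<close>, above it the tail is
    \<open>2 * V * U powr (- 1 / 2) = 2 * V * m powr (1 / 3)\<close>.\<close>
  define U where "U = m powr (- 2 / 3)"
  have U: "U > 0" using m by (simp add: U_def)
  have "(\<integral>\<^sup>+x. indicator S x * ennreal (?k x) \<partial>lborel) = (\<integral>\<^sup>+x. (\<integral>\<^sup>+u. indicator S x * indicator {0..<?k x} u \<partial>lborel) \<partial>lborel)"
    by (intro nn_integral_cong) (simp add: nn_integral_cmult)
  also have "\<dots> = (\<integral>\<^sup>+u. (\<integral>\<^sup>+x. indicator S x * indicator {0..<?k x} u \<partial>lborel) \<partial>lborel)"
  proof (rule lborel_pair.Fubini')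
    have "(\<lambda>(u, x). indicator S x * indicator {0..<?k x} u :: ennreal) = (\<lambda>(u::real, x::'a). indicator S x * (if 0 \<le> u \<and> u < ?k x then 1 else 0 :: ennreal))"
      by (auto simp: indicator_def)
    moreover have "(\<lambda>(u::real, x::'a). indicator S x * (if 0 \<le> u \<and> u < ?k x then 1 else 0 :: ennreal)) \<in> borel_measurable (lborel \<Otimes>\<^sub>M lborel)"
      by measurable
    ultimately show "(\<lambda>(u, x). indicator S x * indicator {0..<?k x} u :: ennreal) \<in> borel_measurable (lborel \<Otimes>\<^sub>M lborel)"
      by (simp only:)
  qed
  also have "\<dots> \<le> (\<integral>\<^sup>+u. ennreal m * indicator {0..U} u + ennreal (?V * u powr (- 3 / 2)) * indicator {U..} u \<partial>lborel)"
  proof (rule nn_integral_mono)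
    fix u :: real
    consider "u < 0" | "0 \<le> u" "u \<le> U" | "U < u" using U by linarith
    then show "(\<integral>\<^sup>+x. indicator S x * indicator {0..<?k x} u \<partial>lborel) \<le> ennreal m * indicator {0..U} u + ennreal (?V * u powr (- 3 / 2)) * indicator {U..} u"
    proof cases
      case 1
      then show ?thesis by simp
    next
      case 2
      have "(\<integral>\<^sup>+x. indicator S x * indicator {0..<?k x} u \<partial>lborel) \<le> (\<integral>\<^sup>+x. indicator S x \<partial>lborel)"
        by (intro nn_integral_mono) (auto simp: indicator_def)
      also have "\<dots> = ennreal m" using m by simp
      also have "\<dots> \<le> ennreal m * indicator {0..U} u + ennreal (?V * u powr (- 3 / 2)) * indicator {U..} u"
        using 2 by simp
      finally show ?thesis .
    next
      case 3
      then have u: "u > 0" using U by linarith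
      have "(\<integral>\<^sup>+x. indicator S x * indicator {0..<?k x} u \<partial>lborel) \<le> (\<integral>\<^sup>+x. indicator (cball c (u powr (- 1 / 2))) x \<partial>lborel)"
      proof (intro nn_integral_mono)
        fix x
        have "x \<in> cball c (u powr (- 1 / 2))" if "u < ?k x"
        proof -
          have "norm (x - c) \<noteq> 0" using that u by auto
          then have "0 < (norm (x - c))\<^sup>2" by simp
          with that have "u * (norm (x - c))\<^sup>2 < 1" by (simp add: field_simps)
          then have "(norm (x - c))\<^sup>2 < 1 / u" using u by (simp add: field_simps)
          also have "1 / u = (u powr (- 1 / 2))\<^sup>2" using u by (simp add: powr_power powr_neg_one)
          finally have "norm (x - c) < u powr (- 1 / 2)" by (rule power2_less_imp_less) simp
          then show ?thesis by (simp add: dist_norm norm_minus_commute)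
        qed
        then show "indicator S x * indicator {0..<?k x} u \<le> (indicator (cball c (u powr (- 1 / 2))) x :: ennreal)"
          by (auto simp: indicator_def)
      qed
      also have "\<dots> = ennreal (?V * u powr (- 3 / 2))"
        using u dim powr_int_cube[OF u] by (simp add: emeasure_cball)
      also have "\<dots> \<le> ennreal m * indicator {0..U} u + ennreal (?V * u powr (- 3 / 2)) * indicator {U..} u"
        using 3 by simp
      finally show ?thesis .
    qed
  qed
  also have "\<dots> = ennreal m * ennreal U + (\<integral>\<^sup>+u. ennreal (?V * u powr (- 3 / 2)) * indicator {U..} u \<partial>lborel)"
    using U by (subst nn_integral_add) (auto simp: nn_integral_cmult)
  also have "(\<integral>\<^sup>+u. ennreal (?V * u powr (- 3 / 2)) * indicator {U..} u \<partial>lborel) = ennreal (0 - ?V * (- 2 * U powr (- 1 / 2)))"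
  proof (rule nn_integral_FTC_atLeast)
    show "((\<lambda>u. ?V * (- 2 * u powr (- 1 / 2))) \<longlongrightarrow> 0) at_top"
    proof -
      have "((\<lambda>u::real. u powr (- 1 / 2)) \<longlongrightarrow> 0) at_top"
        by (rule tendsto_neg_powr) (auto intro: filterlim_ident)
      then have "((\<lambda>u. ?V * (- 2 * u powr (- 1 / 2))) \<longlongrightarrow> ?V * (- 2 * 0)) at_top"
        by (intro tendsto_mult tendsto_const)
      then show ?thesis by simp
    qed
    fix u assume "U \<le> u"
    then have u: "u > 0" using U by linarith
    show "((\<lambda>u. ?V * (- 2 * u powr (- 1 / 2))) has_real_derivative ?V * u powr (- 3 / 2)) (at u)"
      using u by (auto intro!: derivative_eq_intros simp: powr_diff)
  qed auto
  also have "U powr (- 1 / 2) = m powr (1 / 3)" using m by (simp add: U_def powr_powr)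
  also have "ennreal m * ennreal U = ennreal (m powr (1 / 3))"
  proof -
    have "m * U = m powr (1 + (- 2 / 3))" unfolding U_def powr_add using m by simp
    then show ?thesis using U m by (simp flip: ennreal_mult)
  qed
  finally show ?thesis by (simp add: algebra_simps flip: ennreal_plus)
qed

text \<open>The integrand decreases, so on an interval of length \<open>m\<close> it is at least its
  value at \<open>m\<close>. The condition \<open>ennreal s < ennreal m\<close> is written so that
  it also makes sense for an infinite measure.\<close>

lemma nn_integral_powr_ge:
  assumes "0 \<le> m"
  shows "ennreal (m powr (1 / 3)) \<le> (\<integral>\<^sup>+s. ennreal (s powr (- 2 / 3)) * indicator {s. 0 < s \<and> ennreal s < ennreal m} s \<partial>lborel)"
proof -
  have "ennreal (m powr (1 / 3)) = (\<integral>\<^sup>+s. ennreal (m powr (- 2 / 3)) * indicator {0<..<m} s \<partial>lborel)"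
  proof (cases "m = 0")
    case False
    have "m powr (- 2 / 3) * m = m powr (- 2 / 3 + 1)" unfolding powr_add using assms False by simp
    then show ?thesis using assms False by (simp add: nn_integral_cmult flip: ennreal_mult)
  qed simp
  also have "\<dots> \<le> (\<integral>\<^sup>+s. ennreal (s powr (- 2 / 3)) * indicator {s. 0 < s \<and> ennreal s < ennreal m} s \<partial>lborel)"
  proof (rule nn_integral_mono)
    fix s :: real
    show "ennreal (m powr (- 2 / 3)) * indicator {0<..<m} s \<le> ennreal (s powr (- 2 / 3)) * indicator {s. 0 < s \<and> ennreal s < ennreal m} s"
    proof (cases "0 < s \<and> s < m")
      case True
      have "m powr (- 2 / 3) \<le> s powr (- 2 / 3)" using True by (intro powr_mono2') auto
      then show ?thesis using True by (simp add: ennreal_leI ennreal_lessI)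
    qed auto
  qed
  finally show ?thesis .
qed

text \<open>The duality between \<open>L\<^bsup>3,1\<^esup>\<close> and the weak space \<open>L\<^bsup>3/2,\<infinity>\<^esup>\<close>, which contains \<open>|x|\<^sup>-\<^sup>2\<close>.\<close>

theorem nn_integral_inverse_square_le_Lorentz:
  fixes f :: "'a::euclidean_space \<Rightarrow> real" and c :: 'a
  assumes dim: "DIM('a) = 3" and [measurable]: "f \<in> borel_measurable borel" and f0: "\<And>x. 0 \<le> f x"
  shows "(\<integral>\<^sup>+x. ennreal (f x) * ennreal (1 / (norm (x - c))\<^sup>2) \<partial>lborel)
    \<le> ennreal (1 + 2 * unit_ball_vol 3) * Lorentz_norm 3 1 f"
proof -
  let ?k = "\<lambda>x::'a. 1 / (norm (x - c))\<^sup>2" and ?C = "1 + 2 * unit_ball_vol 3"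
  define \<mu> where "\<mu> r = emeasure lborel {x. f x > r}" for r
  have \<mu>_eq: "\<mu> r = (\<integral>\<^sup>+x. (if r < f x then 1 else 0) \<partial>lborel)" for r
  proof -
    have "\<mu> r = (\<integral>\<^sup>+x. indicator {x. f x > r} x \<partial>lborel)" unfolding \<mu>_def by (subst nn_integral_indicator) auto
    also have "\<dots> = (\<integral>\<^sup>+x. (if r < f x then 1 else 0) \<partial>lborel)" by (intro nn_integral_cong) (auto simp: indicator_def)
    finally show ?thesis .
  qed
  have [measurable]: "\<mu> \<in> borel_measurable borel" unfolding \<mu>_eq[abs_def] by measurable
  \<comment> \<open>\<open>J\<close> replaces the cube root of the measure by an integral that
    extends to infinite measure, where it is infinite, so superlevel sets of infinite measure are
    covered. It also introduces the weight \<open>s powr (- 2 / 3)\<close> of the Lorentz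
    norm.\<close>
  define J where "J m = (\<integral>\<^sup>+s. ennreal (s powr (- 2 / 3)) * indicator {s. 0 < s \<and> ennreal s < m} s \<partial>lborel)" for m
  have J: "ennreal (n powr (1 / 3)) \<le> J (ennreal n)" if "0 \<le> n" for n
    unfolding J_def using that by (rule nn_integral_powr_ge)
  have J_mono: "J a \<le> J b" if "a \<le> b" for a b
    unfolding J_def using that by (intro nn_integral_mono) (auto simp: indicator_def)
  have J_top: "J \<top> = \<top>"
  proof -
    have "ennreal B \<le> J \<top>" if "0 \<le> B" for B
    proof -
      have "ennreal B = ennreal ((B ^ 3) powr (1 / 3))"
        using that powr_powr[of B 3 "1 / 3"] by (cases "B = 0") simp_all
      also have "\<dots> \<le> J \<top>" using that by (intro order_trans[OF J J_mono]) auto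
      finally show ?thesis .
    qed
    note * = this
    show ?thesis
    proof (cases "J \<top>")
      case (real t)
      then show ?thesis using *[of "t + 1"] by (simp add: ennreal_le_iff)
    qed simp
  qed
  have inner: "(\<integral>\<^sup>+x. indicator {x. f x > r} x * ennreal (?k x) \<partial>lborel) \<le> ennreal ?C * J (\<mu> r)" for r
  proof (cases "\<mu> r")
    case (real m)
    show ?thesis
    proof (cases "m = 0")
      case True
      then have "AE x in lborel. x \<notin> {x. f x > r}"
        using real by (intro AE_not_in) (auto simp: null_sets_def \<mu>_def)
      then have "(\<integral>\<^sup>+x. indicator {x. f x > r} x * ennreal (?k x) \<partial>lborel) = (\<integral>\<^sup>+x. 0 \<partial>(lborel :: 'a measure))"
        by (intro nn_integral_cong_AE) auto
      then show ?thesis by simp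
    next
      case False
      then have "(\<integral>\<^sup>+x. indicator {x. f x > r} x * ennreal (?k x) \<partial>lborel) \<le> ennreal (?C * m powr (1 / 3))"
        using real by (intro nn_integral_inverse_square_on_set dim) (auto simp: \<mu>_def)
      also have "\<dots> = ennreal ?C * ennreal (m powr (1 / 3))" by (simp add: ennreal_mult)
      also have "\<dots> \<le> ennreal ?C * J (\<mu> r)"
        unfolding real(2) by (intro mult_left_mono J real(1)) auto
      finally show ?thesis .
    qed
  next
    case top
    have "?C > 0" using unit_ball_vol_pos[of 3] by linarith
    then show ?thesis unfolding top J_top by (simp add: ennreal_mult_top)
  qed
  have "(\<integral>\<^sup>+x. ennreal (f x) * ennreal (?k x) \<partial>lborel)
     = (\<integral>\<^sup>+x. (\<integral>\<^sup>+r. (if 0 \<le> r \<and> r < f x then 1 else 0) * ennreal (?k x) \<partial>lborel) \<partial>lborel)"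
  proof (rule nn_integral_cong)
    fix x :: 'a
    have "(\<integral>\<^sup>+r. (if 0 \<le> r \<and> r < f x then 1 else 0) \<partial>lborel) = (\<integral>\<^sup>+r. indicator {0..<f x} r \<partial>lborel)"
      by (intro nn_integral_cong) (auto simp: indicator_def)
    then show "ennreal (f x) * ennreal (?k x) = (\<integral>\<^sup>+r. (if 0 \<le> r \<and> r < f x then 1 else 0) * ennreal (?k x) \<partial>lborel)"
      using f0[of x] by (simp add: nn_integral_multc)
  qed
  also have "\<dots> = (\<integral>\<^sup>+r. (\<integral>\<^sup>+x. (if 0 \<le> r \<and> r < f x then 1 else 0) * ennreal (?k x) \<partial>lborel) \<partial>lborel)"
    by (rule lborel_pair.Fubini') measurable
  also have "\<dots> \<le> (\<integral>\<^sup>+r. indicator {0..} r * (ennreal ?C * J (\<mu> r)) \<partial>lborel)"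
  proof (rule nn_integral_mono)
    fix r :: real
    have "(\<integral>\<^sup>+x. (if 0 \<le> r \<and> r < f x then 1 else 0) * ennreal (?k x) \<partial>lborel)
       = indicator {0..} r * (\<integral>\<^sup>+x. indicator {x. f x > r} x * ennreal (?k x) \<partial>lborel)"
      by (cases "0 \<le> r") (auto simp: indicator_def intro!: nn_integral_cong)
    also have "\<dots> \<le> indicator {0..} r * (ennreal ?C * J (\<mu> r))" by (intro mult_left_mono inner) auto
    finally show "(\<integral>\<^sup>+x. (if 0 \<le> r \<and> r < f x then 1 else 0) * ennreal (?k x) \<partial>lborel) \<le> indicator {0..} r * (ennreal ?C * J (\<mu> r))" .
  qed
  also have "\<dots> = (\<integral>\<^sup>+r. (\<integral>\<^sup>+s. ennreal ?C * (ennreal (s powr (- 2 / 3)) * (if 0 \<le> r \<and> 0 < s \<and> ennreal s < \<mu> r then 1 else 0)) \<partial>lborel) \<partial>lborel)"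
  proof (rule nn_integral_cong)
    fix r :: real
    show "indicator {0..} r * (ennreal ?C * J (\<mu> r)) = (\<integral>\<^sup>+s. ennreal ?C * (ennreal (s powr (- 2 / 3)) * (if 0 \<le> r \<and> 0 < s \<and> ennreal s < \<mu> r then 1 else 0)) \<partial>lborel)"
      unfolding J_def by (subst nn_integral_cmult[symmetric], measurable) (cases "0 \<le> r", auto simp: indicator_def intro!: nn_integral_cong)
  qed
  \<comment> \<open>This exchange is the heart of the duality: for fixed \<open>s\<close> the levels
    \<open>r\<close> with \<open>ennreal s < \<mu> r\<close> do not exceed
    \<open>rearrangement f s\<close>, so integrating over \<open>r\<close> first gives at most that
    value.\<close>
  also have "\<dots> = (\<integral>\<^sup>+s. (\<integral>\<^sup>+r. ennreal ?C * (ennreal (s powr (- 2 / 3)) * (if 0 \<le> r \<and> 0 < s \<and> ennreal s < \<mu> r then 1 else 0)) \<partial>lborel) \<partial>lborel)"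
    by (rule lborel_pair.Fubini') measurable
  also have "\<dots> = ennreal ?C * (\<integral>\<^sup>+s. (\<integral>\<^sup>+r. (ennreal (s powr (- 2 / 3)) * (if 0 \<le> r \<and> 0 < s \<and> ennreal s < \<mu> r then 1 else 0)) \<partial>lborel) \<partial>lborel)"
    (is "(\<integral>\<^sup>+s. (\<integral>\<^sup>+r. _ * ?h s r \<partial>lborel) \<partial>lborel) = _")
  proof -
    have "(\<integral>\<^sup>+s. (\<integral>\<^sup>+r. ennreal ?C * ?h s r \<partial>lborel) \<partial>lborel) = (\<integral>\<^sup>+s. ennreal ?C * (\<integral>\<^sup>+r. ?h s r \<partial>lborel) \<partial>lborel)"
      by (intro nn_integral_cong nn_integral_cmult) measurable
    also have "\<dots> = ennreal ?C * (\<integral>\<^sup>+s. (\<integral>\<^sup>+r. ?h s r \<partial>lborel) \<partial>lborel)"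
      by (rule nn_integral_cmult) measurable
    finally show ?thesis .
  qed
  also have "\<dots> \<le> ennreal ?C * (\<integral>\<^sup>+s. ennreal (s powr (- 2 / 3)) * rearrangement f s * indicator {0<..} s \<partial>lborel)"
  proof (intro mult_left_mono nn_integral_mono)
    fix s :: real
    show "(\<integral>\<^sup>+r. (ennreal (s powr (- 2 / 3)) * (if 0 \<le> r \<and> 0 < s \<and> ennreal s < \<mu> r then 1 else 0)) \<partial>lborel)
       \<le> ennreal (s powr (- 2 / 3)) * rearrangement f s * indicator {0<..} s"
    proof (cases "0 < s")
      case True
      have le: "ennreal r \<le> rearrangement f s" if "0 \<le> r" "ennreal s < \<mu> r" for r
        unfolding rearrangement_def
      proof (rule Inf_greatest)
        fix z assume "z \<in> {ennreal r |r. 0 \<le> r \<and> emeasure lborel {x. r < norm (f x)} \<le> ennreal s}"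
        then obtain r' where r': "z = ennreal r'" "0 \<le> r'" "emeasure lborel {x. r' < norm (f x)} \<le> ennreal s" by blast
        have n: "norm (f x) = f x" for x using f0[of x] by simp
        have "r \<le> r'"
        proof (rule ccontr)
          assume "\<not> r \<le> r'"
          then have "\<mu> r \<le> \<mu> r'" unfolding \<mu>_def by (intro emeasure_mono) auto
          with r'(3) that(2) show False unfolding n \<mu>_def by simp
        qed
        then show "ennreal r \<le> z" using r' by (simp add: ennreal_leI)
      qed
      have "(\<integral>\<^sup>+r. (if 0 \<le> r \<and> 0 < s \<and> ennreal s < \<mu> r then 1 else 0) \<partial>lborel) \<le> rearrangement f s"
      proof (cases "rearrangement f s")
        case (real t)
        have "(\<integral>\<^sup>+r. (if 0 \<le> r \<and> 0 < s \<and> ennreal s < \<mu> r then 1 else 0) \<partial>lborel) \<le> (\<integral>\<^sup>+r. indicator {0..t} r \<partial>lborel)"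
          using le real by (intro nn_integral_mono) (auto simp: indicator_def)
        then show ?thesis using real by simp
      qed simp
      then show ?thesis using True by (subst nn_integral_cmult, measurable) (simp add: mult_left_mono)
    qed simp
  qed auto
  finally show ?thesis by (simp add: Lorentz_norm_3_1)
qed

section \<open>The uniform oscillatory integral bound\<close>

text \<open>On the dyadic shell ending at radius \<open>2 ^ Suc n\<close> the weight is at most
  \<open>16 * (1 / 16) ^ n\<close>, and the ball of that radius has volume
  \<open>8 * 8 ^ n * V\<close> in dimension 3. The sum is \<open>128 V\<close> times a geometric
  series of ratio 1/2.\<close>

lemma nn_integral_weight_le:
  assumes dim: "DIM('a::euclidean_space) = 3"
  shows "(\<integral>\<^sup>+x. ennreal ((1 / (1 + (norm (x :: 'a))\<^sup>2 / 4))\<^sup>2) \<partial>lborel) \<le> ennreal (256 * unit_ball_vol 3)"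
proof -
  let ?V = "unit_ball_vol 3"
  define c where "c n = ennreal (16 * (1 / 16) ^ n)" for n :: nat
  let ?B = "\<lambda>n. cball (0::'a) (2 ^ Suc n)"
  have pw: "ennreal ((1 / (1 + (norm x)\<^sup>2 / 4))\<^sup>2) \<le> (\<Sum>n. c n * indicator (?B n) x)" for x :: 'a
  proof -
    \<comment> \<open>The index of the first dyadic ball that contains \<open>x\<close>. Minimality
      gives \<open>2 ^ n \<le> norm x\<close>, except for \<open>n = 0\<close>, where the weight is
      at most 1.\<close>
    define n where "n = (LEAST n. norm x \<le> 2 ^ Suc n)"
    obtain k where "norm x < 2 ^ k" using real_arch_pow[of 2 "norm x"] by auto
    moreover have "(2::real) ^ k \<le> 2 ^ Suc k" by simp
    ultimately have "norm x \<le> 2 ^ Suc k" by linarith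
    then have n: "norm x \<le> 2 ^ Suc n" unfolding n_def by (rule LeastI)
    have "(1 / (1 + (norm x)\<^sup>2 / 4))\<^sup>2 \<le> 16 * (1 / 16) ^ n"
    proof (cases n)
      case 0
      have "0 < 1 + (norm x)\<^sup>2 / 4" by (simp add: add_pos_nonneg)
      then have "1 / (1 + (norm x)\<^sup>2 / 4) \<le> 1" by (subst divide_le_eq_1_pos) auto
      then have "(1 / (1 + (norm x)\<^sup>2 / 4))\<^sup>2 \<le> 1" by (intro power_le_one) auto
      then show ?thesis using 0 by simp
    next
      case (Suc m)
      then have "\<not> norm x \<le> 2 ^ Suc m" using not_less_Least[of m "\<lambda>n. norm x \<le> 2 ^ Suc n"] by (simp add: n_def)
      then have "2 ^ n \<le> norm x" using Suc by simp
      then have "(2 ^ n)\<^sup>2 \<le> (norm x)\<^sup>2" by (intro power_mono) auto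
      then have "4 ^ n / 4 \<le> 1 + (norm x)\<^sup>2 / 4"
        by (simp add: power2_eq_square flip: power_mult_distrib)
      then have "1 / (1 + (norm x)\<^sup>2 / 4) \<le> 1 / (4 ^ n / 4)"
        by (intro divide_left_mono) (auto intro!: mult_pos_pos add_pos_nonneg)
      then have "(1 / (1 + (norm x)\<^sup>2 / 4))\<^sup>2 \<le> (4 * (1 / 4) ^ n)\<^sup>2"
        by (intro power_mono) (auto simp: power_divide)
      also have "\<dots> = 16 * (1 / 16) ^ n"
        by (simp add: power_mult_distrib power2_eq_square flip: power_mult_distrib)
      finally show ?thesis .
    qed
    then have "ennreal ((1 / (1 + (norm x)\<^sup>2 / 4))\<^sup>2) \<le> c n * indicator (?B n) x"
      using n unfolding c_def by (simp add: ennreal_leI del: power_Suc)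
    also have "\<dots> \<le> (\<Sum>n. c n * indicator (?B n) x)"
    proof -
      have "f n \<le> suminf f" for f :: "nat \<Rightarrow> ennreal" using sum_le_suminf[of f "{n}"] by simp
      then show ?thesis .
    qed
    finally show ?thesis .
  qed
  have "(\<integral>\<^sup>+x. ennreal ((1 / (1 + (norm (x :: 'a))\<^sup>2 / 4))\<^sup>2) \<partial>lborel) \<le> (\<integral>\<^sup>+x. (\<Sum>n. c n * indicator (?B n) x) \<partial>lborel)"
    by (intro nn_integral_mono pw)
  also have "\<dots> = (\<Sum>n. c n * emeasure lborel (?B n))"
  proof (subst nn_integral_suminf)
    have [measurable]: "?B n \<in> sets borel" for n by simp
    show "(\<lambda>x. c n * indicator (?B n) x) \<in> borel_measurable lborel" for n by measurable
    show "(\<Sum>n. \<integral>\<^sup>+x. c n * indicator (?B n) x \<partial>lborel) = (\<Sum>n. c n * emeasure lborel (?B n))"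
      by (intro suminf_cong nn_integral_cmult_indicator) simp
  qed
  also have "\<dots> = (\<Sum>n. ennreal (128 * ?V * (1 / 2) ^ n))"
  proof (rule suminf_cong)
    fix n
    have eq: "16 * (1 / 16) ^ n * (?V * (2 ^ Suc n) ^ 3) = 128 * ?V * (1 / 2) ^ n"
    proof -
      have "((2::real) ^ Suc n) ^ 3 = 8 * 8 ^ n"
        by (simp add: power_mult_distrib) (simp add: eval_nat_numeral flip: power_mult_distrib)
      moreover have "(1 / 16 :: real) ^ n * 8 ^ n = (1 / 2) ^ n" by (simp flip: power_mult_distrib)
      ultimately show ?thesis by (simp del: power_Suc add: mult_ac)
    qed
    show "c n * emeasure lborel (?B n) = ennreal (128 * ?V * (1 / 2) ^ n)"
      unfolding c_def eq[symmetric] using dim by (subst emeasure_cball) (auto simp flip: ennreal_mult)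
  qed
  also have "\<dots> = ennreal (\<Sum>n. 128 * ?V * (1 / 2) ^ n)"
    by (rule suminf_ennreal2) (auto intro!: summable_mult summable_geometric)
  also have "(\<Sum>n. 128 * ?V * (1 / 2) ^ n) = 128 * ?V * (1 / (1 - 1 / 2))"
    by (subst suminf_mult) (auto simp: suminf_geometric)
  finally show ?thesis by simp
qed

context nondegenerate_phase
begin

text \<open>The map \<open>T = id - p\<close> contracts by 1/2, so it has a fixed point
  \<open>x0\<close>, which is a zero of \<open>p\<close>. Then
  \<open>|x - x0| \<le> |p x| + |x - x0| / 2\<close>.\<close>

lemma critical_point: "\<exists>x0. \<forall>x. norm (x - x0) / 2 \<le> norm (p x)"
proof -
  define T where "T x = x - p x" for x
  have T: "norm (T x - T y) \<le> 1 / 2 * norm (x - y)" for x y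
  proof (rule differentiable_bound[where S=UNIV])
    fix x
    have "(T has_derivative (\<lambda>v. v - (v + E x v))) (at x)"
      unfolding T_def[abs_def] by (intro has_derivative_diff has_derivative_ident p)
    then show "(T has_derivative (\<lambda>v. - E x v)) (at x within UNIV)" by simp
    show "onorm (\<lambda>v. - E x v) \<le> 1 / 2"
    proof (rule onorm_bound)
      fix v
      show "norm (- E x v) \<le> 1 / 2 * norm v"
        using order_trans[OF E_le mult_right_mono[OF N_le norm_ge_zero]] by simp
    qed simp
  qed auto
  have "\<exists>!x. T x = x"
    by (rule banach_fix_type[of "1/2"]) (use T in \<open>auto simp: dist_norm\<close>)
  then obtain x0 where "T x0 = x0" by blast
  then have 0: "p x0 = 0" by (simp add: T_def)
  have "norm (x - x0) / 2 \<le> norm (p x)" for x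
  proof -
    have "x - x0 = p x + (T x - T x0)" by (simp add: T_def 0)
    then have "norm (x - x0) \<le> norm (p x) + norm (T x - T x0)" by (metis norm_triangle_ineq)
    with T[of x x0] show ?thesis by linarith
  qed
  then show ?thesis by blast
qed

text \<open>Around the critical point, \<open>w\<close> is bounded by
  \<open>1 / (1 + |x - x0|^2 / 4)\<close>, which gives \<open>256 V\<close>, and by
  \<open>4 / |x - x0|^2\<close>, which gives \<open>4 A\<close>. The assumption \<open>NA\<close>
  runs over all centres because \<open>x0\<close> depends on the linear part of the phase. For
  \<epsilon> above 1 the Gaussian alone has integral at most \<open>sqrt pi ^ 3\<close>.\<close>

theorem oscillatory_integral_bound_uniform:
  assumes \<epsilon>: "0 < \<epsilon>" and Nm: "N \<in> borel_measurable borel" and A: "0 \<le> A"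
    and NA: "\<And>c. (\<integral>\<^sup>+x. ennreal (N x) * ennreal (1 / (norm (x - c))\<^sup>2) \<partial>lborel) \<le> ennreal A"
  shows "norm (LBINT x. of_real (exp (- (\<epsilon> * (norm x)\<^sup>2))) * e x)
    \<le> 69 * (256 * unit_ball_vol 3) + 152 * sqrt pi ^ 3 + 5 * (4 * A)"
proof (cases "\<epsilon> \<le> 1")
  case True
  obtain x0 where x0: "\<And>x. norm (x - x0) / 2 \<le> norm (p x)" using critical_point by blast
  have [measurable]: "w \<in> borel_measurable borel" using borel_measurable_continuous_onI[OF w_cont] .
  have w_le: "w x \<le> 1 / (1 + (norm (x - x0))\<^sup>2 / 4)" for x
  proof -
    have "(norm (x - x0) / 2)\<^sup>2 \<le> (norm (p x))\<^sup>2" by (intro power_mono x0) auto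
    then show ?thesis unfolding w_def
      by (intro divide_left_mono) (auto simp: power_divide intro!: mult_pos_pos add_pos_nonneg)
  qed
  have "(\<integral>\<^sup>+x. ennreal ((w x)\<^sup>2) \<partial>lborel) \<le> (\<integral>\<^sup>+x. ennreal ((1 / (1 + (norm (x - x0))\<^sup>2 / 4))\<^sup>2) \<partial>lborel)"
    using w_pos w_le by (intro nn_integral_mono ennreal_leI power_mono) (auto intro: less_imp_le)
  also have "\<dots> = (\<integral>\<^sup>+x. ennreal ((1 / (1 + (norm (x :: 'a))\<^sup>2 / 4))\<^sup>2) \<partial>lborel)"
    by (subst nn_integral_lborel_affine[where c=1 and t=x0]) auto
  also have "\<dots> \<le> ennreal (256 * unit_ball_vol 3)" by (rule nn_integral_weight_le[OF dim])
  finally have w2': "(\<integral>\<^sup>+x. ennreal ((w x)\<^sup>2) \<partial>lborel) \<le> ennreal (256 * unit_ball_vol 3)" .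
  have w2: "integrable lborel (\<lambda>x. (w x)\<^sup>2)"
    unfolding integrable_iff_bounded using le_less_trans[OF w2' ennreal_less_top] by simp
  have w2_le: "(LBINT x. (w x)\<^sup>2) \<le> 256 * unit_ball_vol 3"
    using w2' by (subst (asm) nn_integral_eq_integral[OF w2]) (auto simp: ennreal_le_iff)
  have "(\<integral>\<^sup>+x. ennreal (w x * N x) \<partial>lborel) \<le> (\<integral>\<^sup>+x. 4 * (ennreal (N x) * ennreal (1 / (norm (x - x0))\<^sup>2)) \<partial>lborel)"
  proof (rule nn_integral_mono_AE)
    show "AE x in lborel. ennreal (w x * N x) \<le> 4 * (ennreal (N x) * ennreal (1 / (norm (x - x0))\<^sup>2))"
      using AE_lborel_singleton[of x0]
    proof eventually_elim
      case (elim x)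
      have pos: "0 < (norm (x - x0))\<^sup>2" using elim by simp
      have "w x \<le> 1 / ((norm (x - x0))\<^sup>2 / 4)"
        by (rule order_trans[OF w_le frac_le]) (use pos in auto)
      then have "w x * N x \<le> 4 * (N x * (1 / (norm (x - x0))\<^sup>2))"
        using mult_right_mono[OF _ N_nonneg[of x]] by (fastforce simp: mult_ac)
      then have "ennreal (w x * N x) \<le> ennreal (4 * (N x * (1 / (norm (x - x0))\<^sup>2)))" by (rule ennreal_leI)
      also have "\<dots> = 4 * (ennreal (N x) * ennreal (1 / (norm (x - x0))\<^sup>2))"
      proof -
        have "ennreal (4 * (a * b)) = 4 * (ennreal a * ennreal b)" if "0 \<le> a" "0 \<le> b" for a b
          using that by (simp add: ennreal_mult)
        note * = this
        show ?thesis by (rule *[OF N_nonneg]) simp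
      qed
      finally show ?case .
    qed
  qed
  also have "\<dots> = 4 * (\<integral>\<^sup>+x. (ennreal (N x) * ennreal (1 / (norm (x - x0))\<^sup>2)) \<partial>lborel)"
  proof (rule nn_integral_cmult)
    have [measurable]: "N \<in> borel_measurable lborel" using Nm by simp
    show "(\<lambda>x. ennreal (N x) * ennreal (1 / (norm (x - x0))\<^sup>2)) \<in> borel_measurable lborel" by measurable
  qed
  also have "\<dots> \<le> 4 * ennreal A" by (intro mult_left_mono NA) auto
  also have "\<dots> = ennreal (4 * A)" using A by (simp add: ennreal_mult)
  finally show ?thesis using A by (intro oscillatory_integral_bound[OF \<epsilon> True w2 w2_le Nm]) auto
next
  case False
  have "norm (LBINT x. of_real (exp (- (\<epsilon> * (norm x)\<^sup>2))) * e x) \<le> (LBINT x. norm (of_real (exp (- (\<epsilon> * (norm x)\<^sup>2))) * e x))"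
    by (rule integral_norm_bound)
  also have "\<dots> = (LBINT x. exp (- (2 * \<epsilon>) * (norm (x :: 'a))\<^sup>2 / 2))"
    by (simp add: norm_mult)
  also have "\<dots> = sqrt (pi / \<epsilon>) ^ 3"
    using \<epsilon> by (subst integral_gaussian) (auto simp: dim)
  also have "\<dots> \<le> sqrt pi ^ 3" using False \<epsilon> by (intro power_mono) (auto simp: divide_le_eq)
  also have "\<dots> \<le> 69 * (256 * unit_ball_vol 3) + 152 * sqrt pi ^ 3 + 5 * (4 * A)"
    using A by (auto intro!: add_increasing add_increasing2)
  finally show ?thesis .
qed

end

section \<open>Hessians of $C^2$ functions\<close>

text \<open>Derivatives of the joint function in directions \<open>(0, v)\<close> are those of the
  slice at time \<open>t\<close>; expanding in the standard basis turns the derivative functionals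
  into vectors.\<close>

lemma C2_on_slice:
  fixes F :: "real \<Rightarrow> 'a::euclidean_space \<Rightarrow> real"
  assumes C2: "C2_on ({0<..} \<times> UNIV) (\<lambda>(t, x). F t x)" and t: "t > 0"
  obtains G H where "\<And>x. (F t has_derivative (\<lambda>v. G x \<bullet> v)) (at x)"
    and "\<And>x. (G has_derivative H x) (at x)"
    and "\<And>v. continuous_on UNIV (\<lambda>x. H x v)"
proof -
  obtain f' :: "real \<times> 'a \<Rightarrow> (real \<times> 'a) \<Rightarrow>\<^sub>L real" and f'' :: "real \<times> 'a \<Rightarrow> (real \<times> 'a) \<Rightarrow>\<^sub>L (real \<times> 'a) \<Rightarrow>\<^sub>L real"
    where f': "\<And>z. z \<in> {0<..} \<times> UNIV \<Longrightarrow> ((\<lambda>(t, x). F t x) has_derivative blinfun_apply (f' z)) (at z)"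
      and f'': "\<And>z. z \<in> {0<..} \<times> UNIV \<Longrightarrow> (f' has_derivative blinfun_apply (f'' z)) (at z)"
      and cont: "continuous_on ({0<..} \<times> UNIV) f''" using C2 unfolding C2_on_def by blast
  have pair: "((\<lambda>x. (t, x)) has_derivative (\<lambda>v. (0, v))) (at x)" for x :: 'a
    by (auto intro!: derivative_eq_intros)
  have mem: "(t, x) \<in> {0<..} \<times> UNIV" for x :: 'a using t by simp
  define G where "G x = (\<Sum>b\<in>Basis. f' (t, x) (0, b) *\<^sub>R b)" for x :: 'a
  define H where "H x v = (\<Sum>b\<in>Basis. f'' (t, x) (0, v) (0, b) *\<^sub>R b)" for x v :: 'a
  show ?thesis
  proof
    fix x :: 'a
    have "((\<lambda>x. F t x) has_derivative (\<lambda>v. f' (t, x) (0, v))) (at x)"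
      using has_derivative_compose[OF pair f'[OF mem]] by simp
    moreover have "f' (t, x) (0, v) = G x \<bullet> v" for v
    proof -
      have "bounded_linear (\<lambda>v. f' (t, x) (0, v))"
        by (intro bounded_linear_compose[OF blinfun.bounded_linear_right] bounded_linear_Pair bounded_linear_zero bounded_linear_ident)
      then interpret bounded_linear "\<lambda>v. f' (t, x) (0, v)" .
      have "f' (t, x) (0, v) = f' (t, x) (0, \<Sum>b\<in>Basis. (v \<bullet> b) *\<^sub>R b)" by (simp add: euclidean_representation)
      also have "\<dots> = (\<Sum>b\<in>Basis. (v \<bullet> b) * f' (t, x) (0, b))" by (simp only: sum scaleR real_scaleR_def)
      also have "\<dots> = G x \<bullet> v" by (simp add: G_def inner_sum_left inner_commute[of v] mult.commute)
      finally show ?thesis .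
    qed
    ultimately show "(F t has_derivative (\<lambda>v. G x \<bullet> v)) (at x)" by simp
    have "((\<lambda>x. f' (t, x)) has_derivative (\<lambda>v. f'' (t, x) (0, v))) (at x)"
      using has_derivative_compose[OF pair f''[OF mem]] by simp
    then have "((\<lambda>x. f' (t, x) (0, b)) has_derivative (\<lambda>v. f'' (t, x) (0, v) (0, b))) (at x)" for b
      by (rule bounded_linear.has_derivative[OF blinfun.bounded_linear_left])
    then show "(G has_derivative H x) (at x)"
      unfolding G_def[abs_def] H_def[abs_def] by (intro has_derivative_sum has_derivative_scaleR_left)
  next
    fix v :: 'a
    have "continuous_on UNIV (\<lambda>x::'a. f'' (t, x))"
      by (rule continuous_on_compose2[OF cont]) (use t in \<open>auto intro!: continuous_intros\<close>)
    then show "continuous_on UNIV (\<lambda>x. H x v)" unfolding H_def by (intro continuous_intros)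
  qed
qed

text \<open>This identifies the iterated one-dimensional derivatives in \<open>hessian\<close> with
  the derivative of the gradient. The row index is the direction of the outer derivative, so the
  matrix is the transpose of that of \<open>H x\<close>.\<close>

lemma hessian_component:
  fixes g :: "real ^ 'n \<Rightarrow> real"
  assumes g: "\<And>x. (g has_derivative (\<lambda>v. G x \<bullet> v)) (at x)" and G: "\<And>x. (G has_derivative H x) (at x)"
  shows "hessian g x $ i $ j = H x (axis i 1) $ j"
proof -
  have line: "((\<lambda>s. x + s *\<^sub>R axis i 1) has_derivative (\<lambda>s. s *\<^sub>R axis i 1)) (at 0)" for x :: "real ^ 'n" and i
    by (auto intro!: derivative_eq_intros)
  have "partial_deriv j g x = G x $ j" for x j
  proof -
    have "((\<lambda>s. g (x + s *\<^sub>R axis j 1)) has_derivative (\<lambda>s. G x \<bullet> (s *\<^sub>R axis j 1))) (at 0)"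
      using has_derivative_compose[OF line[of x j], of g "\<lambda>v. G x \<bullet> v"] g[of x] by simp
    then have "((\<lambda>s. g (x + s *\<^sub>R axis j 1)) has_real_derivative G x $ j) (at 0)"
      by (simp add: has_field_derivative_def inner_axis mult_commute_abs)
    then show ?thesis unfolding partial_deriv_def by (rule DERIV_imp_deriv)
  qed
  then have eq: "partial_deriv j g = (\<lambda>x. G x $ j)" by auto
  have "((\<lambda>s. G (x + s *\<^sub>R axis i 1) $ j) has_derivative (\<lambda>s. H x (s *\<^sub>R axis i 1) $ j)) (at 0)"
    using has_derivative_compose[OF line[of x i], of G "H x"] G[of x]
    by (intro bounded_linear.has_derivative[OF bounded_linear_vec_nth]) simp
  moreover have "H x (s *\<^sub>R axis i 1) = s *\<^sub>R H x (axis i 1)" for s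
    using has_derivative_bounded_linear[OF G[of x]] by (rule linear_simps(5))
  ultimately have "((\<lambda>s. G (x + s *\<^sub>R axis i 1) $ j) has_real_derivative H x (axis i 1) $ j) (at 0)"
    by (simp add: has_field_derivative_def mult_commute_abs)
  then have "partial_deriv i (\<lambda>x. G x $ j) x = H x (axis i 1) $ j"
    unfolding partial_deriv_def by (rule DERIV_imp_deriv)
  then show ?thesis by (simp add: hessian_def eq)
qed

text \<open>With \<open>A\<close> the Hessian matrix, which is the transpose of the matrix of
  \<open>H x\<close>, the bound comes by duality:
  \<open>|H x v|^2 = v \<bullet> (A *v H x v)\<close>, and one factor \<open>|H x v|\<close>
  cancels.\<close>

lemma norm_le_matrix_norm_hessian:
  fixes g :: "real ^ 'n \<Rightarrow> real"
  assumes g: "\<And>x. (g has_derivative (\<lambda>v. G x \<bullet> v)) (at x)" and G: "\<And>x. (G has_derivative H x) (at x)"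
  shows "norm (H x v) \<le> matrix_norm (hessian g x) * norm v"
proof (cases "H x v = 0")
  case True
  then show ?thesis by (simp add: matrix_norm_def onorm_pos_le matrix_vector_mul_bounded_linear)
next
  case False
  let ?A = "hessian g x"
  interpret H: bounded_linear "H x" using G by (rule has_derivative_bounded_linear)
  have "v \<bullet> (?A *v u) = H x v \<bullet> u" for u
  proof -
    have "v = (\<Sum>i\<in>UNIV. v $ i *\<^sub>R axis i 1)"
      by (simp add: vec_eq_iff axis_def if_distrib cong: if_cong)
    then have "H x v = (\<Sum>i\<in>UNIV. v $ i *\<^sub>R H x (axis i 1))"
      by (metis (no_types, lifting) H.scaleR H.sum sum.cong)
    then have "H x v \<bullet> u = (\<Sum>i\<in>UNIV. v $ i * (H x (axis i 1) \<bullet> u))"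
      by (simp only: inner_sum_left inner_scaleR_left)
    also have "\<dots> = (\<Sum>i\<in>UNIV. \<Sum>j\<in>UNIV. v $ i * (H x (axis i 1) $ j * u $ j))"
      by (simp add: inner_vec_def sum_distrib_left)
    also have "\<dots> = v \<bullet> (?A *v u)"
      by (simp add: inner_vec_def matrix_vector_mult_def hessian_component[OF g G] sum_distrib_left)
    finally show ?thesis by simp
  qed
  then have "norm (H x v) * norm (H x v) = v \<bullet> (?A *v H x v)"
    by (metis power2_eq_square power2_norm_eq_inner)
  also have "\<dots> \<le> norm v * norm (?A *v H x v)" by (rule norm_cauchy_schwarz)
  also have "\<dots> \<le> norm v * (matrix_norm ?A * norm (H x v))"
    unfolding matrix_norm_def by (intro mult_left_mono onorm matrix_vector_mul_bounded_linear) auto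
  finally have "norm (H x v) * norm (H x v) \<le> (matrix_norm ?A * norm v) * norm (H x v)"
    by (simp add: mult_ac)
  then show ?thesis using False by simp
qed

lemma continuous_on_matrix_norm: "continuous_on UNIV (matrix_norm :: real ^ 'n ^ 'm \<Rightarrow> real)"
proof -
  let ?L = "\<lambda>A :: real ^ 'n ^ 'm. Blinfun ((*v) A)"
  have ap: "blinfun_apply (?L A) = (*v) A" for A
    by (rule bounded_linear_Blinfun_apply) (rule matrix_vector_mul_bounded_linear)
  have "linear ?L"
    by (rule linearI) (auto intro!: blinfun_eqI simp: ap blinfun.bilinear_simps matrix_vector_mult_add_rdistrib scaleR_matrix_vector_assoc)
  then have "continuous_on UNIV (\<lambda>A. norm (?L A))"
    by (intro continuous_intros linear_continuous_on) (simp add: linear_conv_bounded_linear)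
  moreover have "norm (?L A) = matrix_norm A" for A unfolding norm_blinfun.rep_eq ap matrix_norm_def by simp
  ultimately show ?thesis by simp
qed

lemma continuous_on_hessian:
  fixes g :: "real ^ 'n \<Rightarrow> real"
  assumes g: "\<And>x. (g has_derivative (\<lambda>v. G x \<bullet> v)) (at x)" and G: "\<And>x. (G has_derivative H x) (at x)"
    and H: "\<And>v. continuous_on UNIV (\<lambda>x. H x v)"
  shows "continuous_on UNIV (hessian g)"
proof -
  have "hessian g = (\<lambda>x. \<chi> i j. H x (axis i 1) $ j)"
    by (auto simp: fun_eq_iff vec_eq_iff hessian_component[OF g G])
  moreover have "continuous_on UNIV (\<lambda>x. \<chi> i j. H x (axis i 1) $ j)"
    by (intro continuous_intros H)
  ultimately show ?thesis by simp
qed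

text \<open>A violation at one point would persist on a ball, which has positive measure. This turns
  the essential bound on the Hessian into the bound at every point that the contraction argument
  requires.\<close>

lemma continuous_AE_le_imp_le:
  fixes f :: "'a::euclidean_space \<Rightarrow> real"
  assumes f: "continuous_on UNIV f" and le: "AE x in lborel. f x \<le> c"
  shows "f x \<le> c"
proof (rule ccontr)
  assume "\<not> f x \<le> c"
  have op: "open {x. c < f x}" using open_Collect_less[OF continuous_on_const f] by simp
  then obtain r where r: "r > 0" "ball x r \<subseteq> {x. c < f x}"
    using \<open>\<not> f x \<le> c\<close> by (metis mem_Collect_eq not_le open_contains_ball)
  have "AE x in lborel. x \<notin> {x. c < f x}" using le by eventually_elim auto
  then have "{x. c < f x} \<in> null_sets lborel" using op by (subst AE_iff_null_sets) auto
  then have "emeasure lborel (ball x r) = 0"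
    using null_sets_subset[of "{x. c < f x}" lborel "ball x r"] r(2) by (simp add: null_sets_def)
  moreover have "unit_ball_vol (real DIM('a)) * r ^ DIM('a) > 0" using r(1) by (intro mult_pos_pos) auto
  ultimately show False using r(1) emeasure_ball[of r x] by (simp add: ennreal_eq_0_iff)
qed

section \<open>The kernel of the propagator\<close>

text \<open>The bound of \<open>oscillatory_integral_bound_uniform\<close> with
  \<open>(1 + 2 * unit_ball_vol 3) * A\<close> in place of its \<open>A\<close>; the first factor is
  the constant of the Lorentz duality.\<close>

definition kernel_const :: "real \<Rightarrow> real"
  where "kernel_const A = 69 * (256 * unit_ball_vol 3) + 152 * sqrt pi ^ 3 + 5 * (4 * ((1 + 2 * unit_ball_vol 3) * A))"

text \<open>The substitution \<open>\<xi> = x / \<kappa>\<close> with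
  \<open>\<kappa> = sqrt (t * h)\<close> turns the phase of the free propagator into |x|^2 / 2 and
  produces the Jacobian \<open>1 / \<kappa> ^ 3\<close>. The function \<open>g\<close> is evaluated
  at \<open>h \<xi> = l x\<close>, which explains the second scale \<open>l\<close>.\<close>

lemma kernel_bound:
  fixes g :: "real ^ 3 \<Rightarrow> real"
  assumes g: "\<And>x. (g has_derivative (\<lambda>v. G x \<bullet> v)) (at x)" and G: "\<And>x. (G has_derivative H x) (at x)"
    and H: "\<And>v. continuous_on UNIV (\<lambda>x. H x v)"
    and h: "h > 0" and t: "t > 0" and \<epsilon>: "\<epsilon> > 0" and A: "A \<ge> 0"
    and Linf: "Linf_norm (\<lambda>\<xi>. matrix_norm (hessian g \<xi>)) \<le> ennreal (1 / 2 * (t / h))"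
    and Lorentz: "Lorentz_norm 3 1 (\<lambda>\<xi>. matrix_norm (hessian g \<xi>)) \<le> ennreal (A * sqrt (t / h))"
  shows "norm (LBINT \<xi>. cis (\<xi> \<bullet> z) * (of_real (exp (- (\<epsilon> * (norm \<xi>)\<^sup>2))) *
      (exp (- \<i> * of_real (t * h * (norm \<xi>)\<^sup>2 / 2)) * exp (- \<i> * of_real (g (h *\<^sub>R \<xi>))))))
    \<le> kernel_const A / (t * h) powr (3 / 2)"
proof -
  define M where "M = (\<lambda>x. matrix_norm (hessian g x))"
  define \<kappa> where "\<kappa> = sqrt (t * h)"
  define l where "l = h / \<kappa>"
  have \<kappa>: "\<kappa> > 0" "\<kappa>\<^sup>2 = t * h" using t h by (auto simp: \<kappa>_def)
  have l: "l > 0" using \<kappa> h by (simp add: l_def)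
  have l2: "l\<^sup>2 * (t / h) = 1" using \<kappa>(2) t h by (simp add: l_def power_divide power2_eq_square)
  have M_cont: "continuous_on UNIV M"
    unfolding M_def by (intro continuous_on_compose2[OF continuous_on_matrix_norm continuous_on_hessian[OF g G H]]) auto
  then have [measurable]: "M \<in> borel_measurable borel" by (rule borel_measurable_continuous_onI)
  have M0: "M x \<ge> 0" for x
    unfolding M_def matrix_norm_def by (intro onorm_pos_le matrix_vector_mul_bounded_linear)
  have M_le: "M x \<le> 1 / 2 * (t / h)" for x
  proof (rule continuous_AE_le_imp_le[OF M_cont])
    have "AE x in lborel. ennreal (norm (M x)) \<le> ennreal (1 / 2 * (t / h))"
      using esssup_AE[of "\<lambda>x. ennreal (norm (M x))" lborel] Linf unfolding Linf_norm_def M_def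
      by (auto elim!: eventually_mono intro: order_trans)
    then show "AE x in lborel. M x \<le> 1 / 2 * (t / h)"
    proof eventually_elim
      case (elim x)
      then show ?case using t h M0[of x] by (simp add: ennreal_le_iff)
    qed
  qed
  have HM: "norm (H x v) \<le> M x * norm v" for x v
    unfolding M_def by (rule norm_le_matrix_norm_hessian[OF g G])
  define N where "N x = l\<^sup>2 * M (l *\<^sub>R x)" for x :: "real ^ 3"
  have N_meas: "N \<in> borel_measurable borel" unfolding N_def by measurable
  define z' where "z' = (1 / \<kappa>) *\<^sub>R z"
  \<comment> \<open>The modulation enters the phase as the linear term
    \<open>x \<bullet> z'\<close>. It shifts the gradient but leaves \<open>E\<close> and
    \<open>N\<close> unchanged, so the constants are independent of \<open>z\<close>.\<close>
  interpret nondegenerate_phase "\<lambda>x. (norm x)\<^sup>2 / 2 + g (l *\<^sub>R x) - x \<bullet> z'" "\<lambda>x. x + l *\<^sub>R G (l *\<^sub>R x) - z'"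
    "\<lambda>x v. l\<^sup>2 *\<^sub>R H (l *\<^sub>R x) v" N
  proof
    show "DIM(real ^ 3) = 3" by simp
    have sc: "((\<lambda>x. l *\<^sub>R x) has_derivative (\<lambda>v. l *\<^sub>R v)) (at x)" for x :: "real ^ 3"
      by (auto intro!: derivative_eq_intros)
    fix x :: "real ^ 3"
    have "((\<lambda>x. x \<bullet> x / 2) has_derivative (\<lambda>v. (x \<bullet> v + v \<bullet> x) / 2)) (at x)"
      by (auto intro!: derivative_eq_intros)
    then have "((\<lambda>x. x \<bullet> x / 2 + g (l *\<^sub>R x) - x \<bullet> z') has_derivative (\<lambda>v. (x \<bullet> v + v \<bullet> x) / 2 + G (l *\<^sub>R x) \<bullet> (l *\<^sub>R v) - v \<bullet> z')) (at x)"
      by (intro has_derivative_add has_derivative_diff has_derivative_inner_left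
          has_derivative_ident has_derivative_compose[OF sc g])
    then show "((\<lambda>x. (norm x)\<^sup>2 / 2 + g (l *\<^sub>R x) - x \<bullet> z') has_derivative (\<lambda>v. (x + l *\<^sub>R G (l *\<^sub>R x) - z') \<bullet> v)) (at x)"
      by (simp add: power2_norm_eq_inner inner_add_left inner_diff_left inner_commute[of _ z'] inner_commute[of _ x])
    have "((\<lambda>x. x + l *\<^sub>R G (l *\<^sub>R x) - z') has_derivative (\<lambda>v. v + l *\<^sub>R H (l *\<^sub>R x) (l *\<^sub>R v) - 0)) (at x)"
      by (intro has_derivative_add has_derivative_diff has_derivative_scaleR_right has_derivative_ident has_derivative_const
          has_derivative_compose[OF sc G])
    moreover have "H (l *\<^sub>R x) (l *\<^sub>R v) = l *\<^sub>R H (l *\<^sub>R x) v" for v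
      using has_derivative_bounded_linear[OF G] by (rule linear_simps(5))
    ultimately show "((\<lambda>x. x + l *\<^sub>R G (l *\<^sub>R x) - z') has_derivative (\<lambda>v. v + l\<^sup>2 *\<^sub>R H (l *\<^sub>R x) v)) (at x)"
      by (simp add: power2_eq_square)
    show "continuous_on UNIV (\<lambda>x. l\<^sup>2 *\<^sub>R H (l *\<^sub>R x) v)" for v
      by (intro continuous_intros continuous_on_compose2[OF H]) auto
    show "norm (l\<^sup>2 *\<^sub>R H (l *\<^sub>R x) v) \<le> N x * norm v" for v
      unfolding N_def using mult_left_mono[OF HM[of "l *\<^sub>R x" v], of "l\<^sup>2"] by (simp add: mult.assoc)
    have "N x \<le> l\<^sup>2 * (1 / 2 * (t / h))" unfolding N_def by (intro mult_left_mono M_le) auto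
    also have "\<dots> = 1 / 2 * (l\<^sup>2 * (t / h))" by (simp only: mult_ac)
    finally show "N x \<le> 1 / 2" unfolding l2 by simp
  qed
  let ?C = "1 + 2 * unit_ball_vol 3"
  have C: "?C \<ge> 0" by (auto intro!: add_nonneg_nonneg)
  \<comment> \<open>In dimension 3 the weighted integral of \<open>N\<close> is \<open>l\<close>
    times that of \<open>M\<close>: two powers of \<open>l\<close> from the Hessian and two from the
    weight, less three from the Jacobian. The Lorentz bound supplies
    \<open>A * sqrt (t / h)\<close>, and \<open>l * sqrt (t / h) = 1\<close>.\<close>
  have NA: "(\<integral>\<^sup>+x. ennreal (N x) * ennreal (1 / (norm (x - c))\<^sup>2) \<partial>lborel) \<le> ennreal (?C * A)" for c
  proof -
    define I where "I = (\<integral>\<^sup>+x. ennreal (M x) * ennreal (1 / (norm (x - l *\<^sub>R c))\<^sup>2) \<partial>lborel)"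
    have "I = ennreal (l ^ 3) * (\<integral>\<^sup>+x. ennreal (M (l *\<^sub>R x)) * ennreal (1 / (norm (l *\<^sub>R x - l *\<^sub>R c))\<^sup>2) \<partial>lborel)"
      unfolding I_def using l by (subst nn_integral_lborel_affine[where c=l and t=0]) auto
    also have "(\<integral>\<^sup>+x. ennreal (M (l *\<^sub>R x)) * ennreal (1 / (norm (l *\<^sub>R x - l *\<^sub>R c))\<^sup>2) \<partial>lborel)
      = (\<integral>\<^sup>+x. ennreal (1 / l ^ 4) * (ennreal (N x) * ennreal (1 / (norm (x - c))\<^sup>2)) \<partial>lborel)"
    proof (rule nn_integral_cong)
      fix x :: "real ^ 3"
      have "1 / (norm (l *\<^sub>R x - l *\<^sub>R c))\<^sup>2 = 1 / l\<^sup>2 * (1 / (norm (x - c))\<^sup>2)"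
        by (simp add: scaleR_diff_right[symmetric] power_mult_distrib)
      moreover have "M (l *\<^sub>R x) = 1 / l\<^sup>2 * N x" using l by (simp add: N_def)
      moreover have "1 / l ^ 4 = 1 / l\<^sup>2 * (1 / l\<^sup>2)" by (simp add: power2_eq_square power4_eq_xxxx)
      moreover have "0 \<le> N x" by (rule N_nonneg)
      ultimately show "ennreal (M (l *\<^sub>R x)) * ennreal (1 / (norm (l *\<^sub>R x - l *\<^sub>R c))\<^sup>2)
         = ennreal (1 / l ^ 4) * (ennreal (N x) * ennreal (1 / (norm (x - c))\<^sup>2))"
        by (simp only: ennreal_mult divide_nonneg_nonneg zero_le_power2 zero_le_one mult_ac)
    qed
    also have "\<dots> = ennreal (1 / l ^ 4) * (\<integral>\<^sup>+x. ennreal (N x) * ennreal (1 / (norm (x - c))\<^sup>2) \<partial>lborel)"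
    proof (rule nn_integral_cmult)
      have [measurable]: "N \<in> borel_measurable lborel" using N_meas by simp
      show "(\<lambda>x. ennreal (N x) * ennreal (1 / (norm (x - c))\<^sup>2)) \<in> borel_measurable lborel" by measurable
    qed
    finally have I_eq: "I = ennreal (l ^ 3) * (ennreal (1 / l ^ 4) * (\<integral>\<^sup>+x. ennreal (N x) * ennreal (1 / (norm (x - c))\<^sup>2) \<partial>lborel))" .
    have one: "ennreal l * (ennreal (l ^ 3) * ennreal (1 / l ^ 4)) = 1"
      using l by (simp add: eval_nat_numeral flip: ennreal_mult)
    have "(\<integral>\<^sup>+x. ennreal (N x) * ennreal (1 / (norm (x - c))\<^sup>2) \<partial>lborel)
      = (ennreal l * (ennreal (l ^ 3) * ennreal (1 / l ^ 4))) * (\<integral>\<^sup>+x. ennreal (N x) * ennreal (1 / (norm (x - c))\<^sup>2) \<partial>lborel)"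
      unfolding one by simp
    also have "\<dots> = ennreal l * I" unfolding I_eq by (simp only: mult_ac)
    also have "\<dots> \<le> ennreal l * (ennreal ?C * Lorentz_norm 3 1 M)"
      unfolding I_def by (intro mult_left_mono nn_integral_inverse_square_le_Lorentz) (auto simp: M0)
    also have "\<dots> \<le> ennreal l * (ennreal ?C * ennreal (A * sqrt (t / h)))"
      using Lorentz unfolding M_def by (intro mult_left_mono) auto
    also have "\<dots> = ennreal (?C * A * (l * sqrt (t / h)))"
    proof -
      have "0 \<le> A * sqrt (t / h)" using A t h by auto
      then have "ennreal l * (ennreal ?C * ennreal (A * sqrt (t / h))) = ennreal (l * (?C * (A * sqrt (t / h))))"
        using l C by (simp only: ennreal_mult[symmetric] less_imp_le mult_nonneg_nonneg)
      then show ?thesis by (simp only: mult_ac)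
    qed
    also have "l * sqrt (t / h) = 1"
    proof -
      have "0 \<le> t / h" using t h by simp
      then have "(l * sqrt (t / h))\<^sup>2 = 1" by (simp only: power_mult_distrib real_sqrt_pow2 l2)
      moreover have "l * sqrt (t / h) \<ge> 0" using l t h by simp
      ultimately show ?thesis by (metis power2_eq_1_iff neg_0_le_iff_le not_one_le_zero)
    qed
    finally show ?thesis by simp
  qed
  let ?e = "e :: real ^ 3 \<Rightarrow> complex"
  \<comment> \<open>After rescaling, the regularization parameter is
    \<open>\<epsilon> / \<kappa>^2\<close>, which is large when \<open>t * h\<close> is small; hence
    the bound has to hold for all positive parameters.\<close>
  have B: "norm (LBINT x. of_real (exp (- (\<epsilon> / \<kappa>\<^sup>2 * (norm x)\<^sup>2))) * e x) \<le> kernel_const A"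
    unfolding kernel_const_def
  proof (rule oscillatory_integral_bound_uniform[OF _ N_meas _ NA])
    show "0 < \<epsilon> / \<kappa>\<^sup>2" using \<epsilon> \<kappa>(1) by (intro divide_pos_pos zero_less_power)
  qed (rule mult_nonneg_nonneg[OF C A])
  let ?F = "\<lambda>\<xi>. cis (\<xi> \<bullet> z) * (of_real (exp (- (\<epsilon> * (norm \<xi>)\<^sup>2))) *
      (exp (- \<i> * of_real (t * h * (norm \<xi>)\<^sup>2 / 2)) * exp (- \<i> * of_real (g (h *\<^sub>R \<xi>)))))"
  have g_cont: "continuous_on UNIV g"
    using g by (intro has_derivative_continuous_on) (auto intro: has_derivative_at_withinI)
  have F_eq: "?F (0 + (1 / \<kappa>) *\<^sub>R x) = of_real (exp (- (\<epsilon> / \<kappa>\<^sup>2 * (norm x)\<^sup>2))) * e x" for x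
  proof -
    have ex: "exp (- \<i> * of_real y) = cis (- y)" for y by (simp add: cis_conv_exp)
    have "t * h * (norm ((1 / \<kappa>) *\<^sub>R x))\<^sup>2 / 2 = (norm x)\<^sup>2 / 2"
      using \<kappa> by (simp add: power_mult_distrib power_divide flip: \<kappa>(2))
    moreover have "\<epsilon> * (norm ((1 / \<kappa>) *\<^sub>R x))\<^sup>2 = \<epsilon> / \<kappa>\<^sup>2 * (norm x)\<^sup>2"
      by (simp add: power_mult_distrib power_divide)
    moreover have "h *\<^sub>R (1 / \<kappa>) *\<^sub>R x = l *\<^sub>R x" by (simp add: l_def)
    moreover have "((1 / \<kappa>) *\<^sub>R x) \<bullet> z = x \<bullet> z'" by (simp add: z'_def)
    ultimately have "?F (0 + (1 / \<kappa>) *\<^sub>R x) = cis (x \<bullet> z') * (of_real (exp (- (\<epsilon> / \<kappa>\<^sup>2 * (norm x)\<^sup>2))) * (cis (- ((norm x)\<^sup>2 / 2)) * cis (- g (l *\<^sub>R x))))"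
      unfolding ex add_0 by (simp only:)
    also have "\<dots> = of_real (exp (- (\<epsilon> / \<kappa>\<^sup>2 * (norm x)\<^sup>2))) * (cis (x \<bullet> z') * (cis (- ((norm x)\<^sup>2 / 2)) * cis (- g (l *\<^sub>R x))))"
      by (simp only: mult_ac)
    also have "cis (x \<bullet> z') * (cis (- ((norm x)\<^sup>2 / 2)) * cis (- g (l *\<^sub>R x))) = e x"
      unfolding e_def cis_mult by (rule arg_cong[where f=cis]) simp
    finally show ?thesis .
  qed
  have "(LBINT \<xi>. ?F \<xi>) = \<bar>1 / \<kappa>\<bar> ^ DIM(real ^ 3) *\<^sub>R (LBINT x. ?F (0 + (1 / \<kappa>) *\<^sub>R x))"
    using \<kappa> by (intro integral_lborel_affine borel_measurable_continuous_onI) (auto intro!: continuous_intros continuous_on_compose2[OF g_cont])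
  also have "\<dots> = (1 / \<kappa> ^ 3) *\<^sub>R (LBINT x. of_real (exp (- (\<epsilon> / \<kappa>\<^sup>2 * (norm x)\<^sup>2))) * e x)"
    unfolding F_eq using \<kappa> by (simp add: power_divide)
  finally have "norm (LBINT \<xi>. ?F \<xi>) = 1 / \<kappa> ^ 3 * norm (LBINT x. of_real (exp (- (\<epsilon> / \<kappa>\<^sup>2 * (norm x)\<^sup>2))) * e x)"
    using \<kappa> by simp
  also have "\<dots> \<le> 1 / \<kappa> ^ 3 * kernel_const A" using \<kappa> B by (intro mult_left_mono) auto
  also have "\<kappa> ^ 3 = (t * h) powr (3 / 2)"
  proof -
    have "\<kappa> = (t * h) powr (1 / 2)" using t h by (simp add: \<kappa>_def powr_half_sqrt)
    then show ?thesis using t h by (simp add: powr_power)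
  qed
  finally show ?thesis by simp
qed

theorem proposition3p5:
  fixes \<Psi> :: "real \<Rightarrow> real \<Rightarrow> real ^ 3 \<Rightarrow> real"
  assumes C2: "\<And>h. h \<in> {0<..1} \<Longrightarrow> C2_on ({0<..} \<times> UNIV) (\<lambda>(t, \<xi>). \<Psi> h t \<xi>)"
    and hess_Linf: "\<And>h t. h \<in> {0<..1} \<Longrightarrow> t \<in> {0<..} \<Longrightarrow>
      Linf_norm (\<lambda>\<xi>. matrix_norm (hessian (\<Psi> h t) \<xi>)) \<le> ennreal (1 / 2 * \<bar>t / h\<bar>)"
    and hess_Lorentz: "\<exists>A>0. \<forall>h\<in>{0<..1}. \<forall>t\<in>{0<..}.
      Lorentz_norm 3 1 (\<lambda>\<xi>. matrix_norm (hessian (\<Psi> h t) \<xi>)) \<le> ennreal (A * sqrt (t / h))"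
  shows "\<exists>C>0. \<forall>h\<in>{0<..1}. \<forall>t\<in>{0<..}.
      L1_Linf_norm (free_propagator h t \<circ> phase_multiplier h (\<Psi> h t))
        \<le> ennreal (C / \<bar>t * h\<bar> powr (3 / 2))"
proof -
  obtain A where A: "A > 0" and Lorentz: "\<And>h t. h \<in> {0<..1} \<Longrightarrow> t \<in> {0<..} \<Longrightarrow>
      Lorentz_norm 3 1 (\<lambda>\<xi>. matrix_norm (hessian (\<Psi> h t) \<xi>)) \<le> ennreal (A * sqrt (t / h))"
    using hess_Lorentz by blast
  \<comment> \<open>\<open>A\<close> is fixed before \<open>h\<close> and \<open>t\<close>, so this
    constant is uniform in both. \<open>ft_const\<close> enters twice, through the forward and the
    inverse transform.\<close>
  define C where "C = (ft_const TYPE(real ^ 3))\<^sup>2 * kernel_const A"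
  have "kernel_const A > 0"
    unfolding kernel_const_def using A by (auto intro!: add_pos_nonneg mult_nonneg_nonneg)
  then have "C > 0" unfolding C_def using ft_const_pos[where 'a="real ^ 3"] by simp
  moreover have "L1_Linf_norm (free_propagator h t \<circ> phase_multiplier h (\<Psi> h t))
        \<le> ennreal (C / \<bar>t * h\<bar> powr (3 / 2))" if h: "h \<in> {0<..1}" and t: "t \<in> {0<..}" for h t
  proof -
    have pos: "h > 0" "t > 0" using h t by auto
    obtain G H where GH: "\<And>x. (\<Psi> h t has_derivative (\<lambda>v. G x \<bullet> v)) (at x)"
      "\<And>x. (G has_derivative H x) (at x)" "\<And>v. continuous_on UNIV (\<lambda>x. H x v)"
      using C2_on_slice[OF C2[OF h] pos(2)] by blast
    have cont: "continuous_on UNIV (\<Psi> h t)"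
      using GH(1) by (intro has_derivative_continuous_on) (auto intro: has_derivative_at_withinI)
    have "L1_Linf_norm (free_propagator h t \<circ> phase_multiplier h (\<Psi> h t))
        \<le> ennreal ((ft_const TYPE(real ^ 3))\<^sup>2 * (kernel_const A / (t * h) powr (3 / 2)))"
      unfolding free_propagator_def phase_multiplier_def
    proof (rule L1_Linf_norm_fourier_multiplier_comp)
      show "(\<lambda>\<xi>. exp (- \<i> * of_real (\<Psi> h t (h *\<^sub>R \<xi>)))) \<in> borel_measurable borel"
        by (intro borel_measurable_continuous_onI continuous_intros continuous_on_compose2[OF cont]) auto
      show "(\<lambda>\<xi>::real ^ 3. exp (- \<i> * complex_of_real (t * h * (norm \<xi>)\<^sup>2 / 2))) \<in> borel_measurable borel"
        by (intro borel_measurable_continuous_onI continuous_intros) auto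
      have unit: "norm (exp (- \<i> * complex_of_real y)) \<le> 1" for y by simp
      show "norm (exp (- \<i> * complex_of_real (\<Psi> h t (h *\<^sub>R \<xi>)))) \<le> 1"
        and "norm (exp (- \<i> * complex_of_real (t * h * (norm \<xi>)\<^sup>2 / 2))) \<le> 1" for \<xi> :: "real ^ 3"
        by (rule unit)+
      show "norm (LBINT \<xi>. cis (\<xi> \<bullet> z) * (of_real (exp (- (\<epsilon> * (norm \<xi>)\<^sup>2))) *
          (exp (- \<i> * of_real (t * h * (norm \<xi>)\<^sup>2 / 2)) * exp (- \<i> * of_real (\<Psi> h t (h *\<^sub>R \<xi>))))))
          \<le> kernel_const A / (t * h) powr (3 / 2)" if "0 < \<epsilon>" for \<epsilon> z
        using hess_Linf[OF h t] Lorentz[OF h t] A pos that by (intro kernel_bound[OF GH]) auto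
    qed
    also have "(ft_const TYPE(real ^ 3))\<^sup>2 * (kernel_const A / (t * h) powr (3 / 2)) = C / \<bar>t * h\<bar> powr (3 / 2)"
      using pos by (simp add: C_def)
    finally show ?thesis .
  qed
  ultimately show ?thesis by blast
qed

end
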